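(* Let $t\ge 2$ and let $K_{n_1,n_2,\ldots,n_t}$ denote the complete multipartite graph with parts of sizes $n_1,\ldots,n_t\ge 1$ (so on $\sum_{s=1}^t n_s$ vertices). Then for every positive integer $r$, the $\mathbb N$-graded Betti numbers are given, for all $i\ge 1$ and all $d$, by $$\beta_{i,i+d}(R_{K_{n_1,\ldots,n_t}}/I_r(K_{n_1,\ldots,n_t}))=\begin{cases}\displaystyle\binom{\sum_{s=1}^t n_s}{i+r}\binom{i+r-1}{r}-\sum_{\substack{(j_1,\ldots,j_t)\in\mathbb N^t\\ \sum_{s=1}^t j_s=i+r}}\left[\prod_{s=1}^t\binom{n_s}{j_s}\right]\sum_{s=1}^t\binom{j_s-1}{r} & \text{if } d=r,\\ 0 & \text{otherwise.}\end{cases}$$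
   Context: $\mathbb K$ is a field. For a finite simple graph $G$ with vertex set $V(G)$, $R_G$ is the polynomial ring over $\mathbb K$ whose variables are the vertices of $G$ (standard grading). For a positive integer $r$, $I_r(G)\subseteq R_G$ is the square-free monomial ideal generated by the monomials $\prod_{x\in A}x$, where $A$ ranges over all subsets $A\subseteq V(G)$ with $|A|=r+1$ such that the induced subgraph $G[A]$ is connected ($I_r(G)=0$ if there are none). In the complete multipartite graph, two vertices are adjacent if and only if they lie in different parts. $\beta_{i,j}(R/I)$ denotes the $(i,j)$-th graded Betti number, i.e. the multiplicity of $R(-j)$ in homological degree $i$ of the graded minimal free resolution of $R/I$. Here $\mathbb N=\{0,1,2,\ldots\}$, and $\binom{a}{b}=0$ whenever $a<b$; in particular $\binom{-1}{r}=0$. *)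

theory Defs
  imports
    "HOL-Library.Poly_Mapping"
    "HOL-Algebra.QuotRing"
    "Graph_Theory.Graph_Theory"
begin

section \<open>Polynomial rings in a given set of variables\<close>

text \<open>A polynomial is a finitely supported map from monomials to coefficients, and a monomial
  is a finitely supported map from variables to exponents. The type contains the polynomials in
  all variables of type \<open>'v\<close>; the carrier below keeps those that only involve variables
  from \<open>V\<close>.\<close>

type_synonym ('v, 'k) mpoly = "('v \<Rightarrow>\<^sub>0 nat) \<Rightarrow>\<^sub>0 'k"

definition poly_ring :: "'v set \<Rightarrow> ('v, 'k::field) mpoly ring" where
  "poly_ring V = \<lparr>carrier = {p. \<forall>m\<in>Poly_Mapping.keys p. Poly_Mapping.keys m \<subseteq> V},
     monoid.mult = (*), one = 1, zero = 0, add = (+)\<rparr>"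

definition var :: "'v \<Rightarrow> ('v, 'k::field) mpoly" where
  "var x = Poly_Mapping.single (Poly_Mapping.single x 1) 1"

definition mon_degree :: "('v \<Rightarrow>\<^sub>0 nat) \<Rightarrow> nat" where
  "mon_degree m = (\<Sum>x\<in>Poly_Mapping.keys m. Poly_Mapping.lookup m x)"

text \<open>Degrees are integers so that the degree of a matrix entry can be a genuine difference of
  shifts. The zero polynomial is homogeneous of every degree, and it is the only homogeneous
  polynomial of negative degree.\<close>

definition homogeneous :: "int \<Rightarrow> ('v, 'k::field) mpoly \<Rightarrow> bool" where
  "homogeneous d p \<longleftrightarrow> (\<forall>m\<in>Poly_Mapping.keys p. int (mon_degree m) = d)"

definition irrelevant_ideal :: "'v set \<Rightarrow> ('v, 'k::field) mpoly set" where
  "irrelevant_ideal V = Idl\<^bsub>poly_ring V\<^esub> (var ` V)"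

section \<open>Graded minimal free resolutions of quotients \<open>R/I\<close>\<close>

definition free_mod :: "('a, 'b) ring_scheme \<Rightarrow> nat \<Rightarrow> (nat \<Rightarrow> 'a) set" where
  "free_mod R n = {..<n} \<rightarrow>\<^sub>E carrier R"

definition free_zero :: "('a, 'b) ring_scheme \<Rightarrow> nat \<Rightarrow> nat \<Rightarrow> 'a" where
  "free_zero R n = (\<lambda>k\<in>{..<n}. \<zero>\<^bsub>R\<^esub>)"

text \<open>The linear map from rank \<open>n\<close> to rank \<open>m\<close> with the \<open>m \<times> n\<close> matrix \<open>A\<close>.\<close>

definition mat_map ::
    "('a, 'b) ring_scheme \<Rightarrow> nat \<Rightarrow> nat \<Rightarrow> (nat \<Rightarrow> nat \<Rightarrow> 'a) \<Rightarrow> (nat \<Rightarrow> 'a) \<Rightarrow> nat \<Rightarrow> 'a" where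
  "mat_map R m n A u = (\<lambda>k\<in>{..<m}. \<Oplus>\<^bsub>R\<^esub>l\<in>{..<n}. A k l \<otimes>\<^bsub>R\<^esub> u l)"

text \<open>The module homomorphism from rank \<open>n\<close> to \<open>R/I\<close> that sends the \<open>k\<close>-th basis vector to
  the class of \<open>g k\<close>.\<close>

definition augmentation ::
    "('a, 'b) ring_scheme \<Rightarrow> 'a set \<Rightarrow> nat \<Rightarrow> (nat \<Rightarrow> 'a) \<Rightarrow> (nat \<Rightarrow> 'a) \<Rightarrow> 'a set" where
  "augmentation R I n g u = I +>\<^bsub>R\<^esub> (\<Oplus>\<^bsub>R\<^esub>k\<in>{..<n}. g k \<otimes>\<^bsub>R\<^esub> u k)"

text \<open>The complex
  \<open>\<dots> \<rightarrow> F 2 \<rightarrow> F 1 \<rightarrow> F 0 \<rightarrow> R/I \<rightarrow> 0\<close>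
  with \<open>F i\<close> the direct sum of the modules \<open>R(- e i k)\<close> for \<open>k < b i\<close>. The map
  from \<open>F (i+1)\<close> to \<open>F i\<close> has matrix \<open>\<phi> i\<close>. Homogeneity of the entries says that all maps
  preserve degrees; minimality says that each image lies in the irrelevant ideal times the
  target. Ranks may be zero from some point on.\<close>

locale graded_minimal_free_resolution =
  fixes V :: "'v set"
    and I :: "('v, 'k::field) mpoly set"
    and b :: "nat \<Rightarrow> nat"
    and e :: "nat \<Rightarrow> nat \<Rightarrow> int"
    and g :: "nat \<Rightarrow> ('v, 'k) mpoly"
    and \<phi> :: "nat \<Rightarrow> nat \<Rightarrow> nat \<Rightarrow> ('v, 'k) mpoly"
    and R :: "('v, 'k) mpoly ring"
    and F :: "nat \<Rightarrow> (nat \<Rightarrow> ('v, 'k) mpoly) set"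
    and D :: "nat \<Rightarrow> (nat \<Rightarrow> ('v, 'k) mpoly) \<Rightarrow> nat \<Rightarrow> ('v, 'k) mpoly"
    and \<epsilon> :: "(nat \<Rightarrow> ('v, 'k) mpoly) \<Rightarrow> ('v, 'k) mpoly set"
  defines "R \<equiv> poly_ring V"
    and "F \<equiv> \<lambda>i. free_mod R (b i)"
    and "D \<equiv> \<lambda>i. mat_map R (b i) (b (Suc i)) (\<phi> i)"
    and "\<epsilon> \<equiv> augmentation R I (b 0) g"
  assumes aug_entries: "\<And>k. k < b 0 \<Longrightarrow> g k \<in> carrier R \<and> homogeneous (e 0 k) (g k)"
    and entries: "\<And>i k l. k < b i \<Longrightarrow> l < b (Suc i) \<Longrightarrow>
      \<phi> i k l \<in> carrier R \<and> homogeneous (e (Suc i) l - e i k) (\<phi> i k l)"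
    and aug_surj: "\<epsilon> ` F 0 = carrier (R Quot I)"
    and exact_0: "{u \<in> F 0. \<epsilon> u = \<zero>\<^bsub>R Quot I\<^esub>} = D 0 ` F 1"
    and exact_Suc: "\<And>i. {u \<in> F (Suc i). D i u = free_zero R (b i)} = D (Suc i) ` F (Suc (Suc i))"
    and minimal: "\<And>i u k. u \<in> F (Suc i) \<Longrightarrow> k < b i \<Longrightarrow> D i u k \<in> irrelevant_ideal V"

text \<open>\<open>graded_betti V I i j\<close> is the multiplicity of \<open>R(-j)\<close> in homological degree \<open>i\<close> of the
  graded minimal free resolution of \<open>R/I\<close>, where \<open>R = poly_ring V\<close>.\<close>

definition graded_betti :: "'v set \<Rightarrow> ('v, 'k::field) mpoly set \<Rightarrow> nat \<Rightarrow> int \<Rightarrow> nat" where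
  "graded_betti V I i j =
     (THE n. \<exists>b e g \<phi>. graded_minimal_free_resolution V I b e g \<phi> \<and> n = card {k. k < b i \<and> e i k = j})"

section \<open>The ideals \<open>I\<^sub>r(G)\<close> and complete multipartite graphs\<close>

definition conn_ideal :: "nat \<Rightarrow> 'v pair_pre_digraph \<Rightarrow> ('v, 'k::field) mpoly set" where
  "conn_ideal r G = Idl\<^bsub>poly_ring (pverts G)\<^esub>
     {\<Otimes>\<^bsub>poly_ring (pverts G)\<^esub>x\<in>A. var x | A. A \<subseteq> pverts G \<and> card A = r + 1 \<and>
        Digraph_Component.connected (induce_subgraph (with_proj G) A)}"

text \<open>A simple graph is a symmetric loopfree relation. The vertex \<open>(s, a)\<close> is the \<open>a\<close>-th vertex
  of the \<open>s\<close>-th part, and parts are numbered from \<open>0\<close>.\<close>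

definition complete_multipartite :: "nat list \<Rightarrow> (nat \<times> nat) pair_pre_digraph" where
  "complete_multipartite ns =
     \<lparr>pverts = {(s, a). s < length ns \<and> a < ns ! s},
      parcs = {((s, a), (s', a')). s < length ns \<and> a < ns ! s \<and> s' < length ns \<and> a' < ns ! s' \<and> s \<noteq> s'}\<rparr>"

lemma pair_graph_complete_multipartite: "pair_graph (complete_multipartite ns)"
proof -
  let ?V = "pverts (complete_multipartite ns)"
  have "?V = Sigma {..<length ns} (\<lambda>s. {..<ns ! s})"
    by (auto simp: complete_multipartite_def)
  then have fin: "finite ?V" by simp
  have "parcs (complete_multipartite ns) \<subseteq> ?V \<times> ?V"
    by (auto simp: complete_multipartite_def)
  then have fin': "finite (parcs (complete_multipartite ns))"
    using fin by (meson finite_SigmaI finite_subset)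
  show ?thesis
    by unfold_locales
      (use fin fin' in \<open>auto simp: complete_multipartite_def symmetric_def arcs_ends_def
        arc_to_ends_def with_proj_def intro!: symI\<close>)
qed

lemma poly_ring_simps:
  "p \<in> carrier (poly_ring V) \<longleftrightarrow> (\<forall>m\<in>Poly_Mapping.keys p. Poly_Mapping.keys m \<subseteq> V)"
  "p \<otimes>\<^bsub>poly_ring V\<^esub> q = p * q" "p \<oplus>\<^bsub>poly_ring V\<^esub> q = p + q"
  "\<one>\<^bsub>poly_ring V\<^esub> = 1" "\<zero>\<^bsub>poly_ring V\<^esub> = 0"
  by (simp_all add: poly_ring_def)

lemma cring_poly_ring: "cring (poly_ring V :: ('v, 'k::field) mpoly ring)"
proof (rule cringI)
  let ?R = "poly_ring V :: ('v, 'k) mpoly ring"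
  have add: "p + q \<in> carrier ?R" if "p \<in> carrier ?R" "q \<in> carrier ?R" for p q
    using that Poly_Mapping.keys_add[of p q] by (fastforce simp: poly_ring_simps(1))
  have neg: "- p \<in> carrier ?R" if "p \<in> carrier ?R" for p
    using that by (simp add: poly_ring_simps(1))
  have mult: "p * q \<in> carrier ?R" if p: "p \<in> carrier ?R" and q: "q \<in> carrier ?R" for p q
    unfolding poly_ring_simps(1)
  proof
    fix m assume "m \<in> Poly_Mapping.keys (p * q)"
    then obtain m1 m2 where m: "m = m1 + m2" "m1 \<in> Poly_Mapping.keys p" "m2 \<in> Poly_Mapping.keys q"
      using Poly_Mapping.keys_mult[of p q] by blast
    have "Poly_Mapping.keys m1 \<subseteq> V" "Poly_Mapping.keys m2 \<subseteq> V"
      using p q m(2,3) unfolding poly_ring_simps(1) by blast+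
    then show "Poly_Mapping.keys m \<subseteq> V"
      using m(1) Poly_Mapping.keys_add[of m1 m2] by blast
  qed
  have zero: "0 \<in> carrier ?R" and one: "1 \<in> carrier ?R"
    by (simp_all add: poly_ring_simps(1))
  show "abelian_group ?R"
  proof (rule abelian_groupI, unfold poly_ring_simps(2-))
    fix p assume p: "p \<in> carrier ?R"
    show "\<exists>q\<in>carrier ?R. q + p = 0"
      by (rule bexI[of _ "- p"]) (use neg[OF p] in simp_all)
  qed (use add zero in \<open>simp_all add: ac_simps\<close>)
  show "Group.comm_monoid ?R"
    by (rule comm_monoidI, unfold poly_ring_simps(2-)) (use mult one in \<open>simp_all add: ac_simps\<close>)
  show "(x \<oplus>\<^bsub>?R\<^esub> y) \<otimes>\<^bsub>?R\<^esub> z = x \<otimes>\<^bsub>?R\<^esub> z \<oplus>\<^bsub>?R\<^esub> y \<otimes>\<^bsub>?R\<^esub> z" for x y z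
    unfolding poly_ring_simps(2-) by (rule distrib_right)
qed

end

theory Submission
  imports Defs "HOL-Library.Function_Algebras" "HOL-Library.Product_Lexorder"
begin

text \<open>For \<open>r \<ge> 1\<close> a set of \<open>r + 1\<close> vertices of a complete multipartite graph is connected iff it
  is not contained in one part, and these sets are the bases of a matroid. Hence the ideal has
  linear quotients in the reverse lexicographic order: each colon ideal is generated by
  variables. Iterated mapping cones, whose building blocks are the Koszul complexes of the colon
  ideals (mapping cones as well), give a linear resolution, minimal for degree reasons, with
  \<open>\<Sum>B. (n B choose (i - 1))\<close> generators in homological degree \<open>i \<ge> 1\<close>, where \<open>n B\<close> is the number
  of variables in the colon ideal at \<open>B\<close>. Comparison of resolutions up to homotopy shows that
  every graded minimal free resolution has the same shifts. Finally, the sum counts pairs of a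
  set \<open>W\<close> of \<open>i + r\<close> vertices and an admissible \<open>B \<subseteq> W\<close>; such \<open>B\<close> consist of \<open>Max W\<close> and an
  \<open>r\<close>-subset of \<open>W - {Max W}\<close> that is contained in no \<open>W\<^sub>s - {Max W\<^sub>s}\<close>, where \<open>W\<^sub>s\<close> is the
  part of \<open>W\<close> with index \<open>s\<close>.\<close>


text \<open>\<open>graded_betti\<close> is a definite description over all graded minimal free
  resolutions, so an explicit resolution must be complemented by uniqueness of the shifts.
  Minimality makes the composites of comparison maps the identity on constant coefficients, and a
  constant entry can only join generators of equal degree; hence the ranks agree degree by degree.
  In homological degree i >= 1 a linear resolution of an ideal generated in degree r + 1 has the
  single shift i + r, which accounts for the value 0 when \<open>d\<close> differs from
  \<open>r\<close>. The same shifts force the entries of the differentials to have positive degree,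
  so minimality need not be tracked through the cones: only ranks and exactness are. A Koszul
  complex fits in because, twisted by r + 1, its generators in homological degree i have degree i +
  r + 1, the degree required one step further in the cone. In the count, no inclusion-exclusion is
  needed: for r >= 1 a set of \<open>r\<close> vertices is nonempty and lies in at most one part.
  The convention for an upper entry -1 agrees with truncated subtraction, again because r >=
  1.\<close>

abbreviation PR :: "'v set \<Rightarrow> ('v, 'k::field) mpoly set" where
  "PR V \<equiv> carrier (poly_ring V)"

abbreviation supp :: "('a \<Rightarrow>\<^sub>0 'b::zero) \<Rightarrow> 'a set" where
  "supp \<equiv> Poly_Mapping.keys"

abbreviation coef :: "('a \<Rightarrow>\<^sub>0 'b::zero) \<Rightarrow> 'a \<Rightarrow> 'b" where
  "coef \<equiv> Poly_Mapping.lookup"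

section \<open>Closure properties of the polynomial ring\<close>

lemma PR_add: "p \<in> PR V \<Longrightarrow> q \<in> PR V \<Longrightarrow> p + q \<in> PR V"
  using cring.cring_simprules(1)[OF cring_poly_ring] by (simp add: poly_ring_simps)

lemma PR_mult: "p \<in> PR V \<Longrightarrow> q \<in> PR V \<Longrightarrow> p * q \<in> PR V"
  using cring.cring_simprules(5)[OF cring_poly_ring] by (simp add: poly_ring_simps)

lemma PR_uminus: "p \<in> PR V \<Longrightarrow> - p \<in> PR V"
  by (simp add: poly_ring_simps(1))

lemma PR_minus: "p \<in> PR V \<Longrightarrow> q \<in> PR V \<Longrightarrow> p - q \<in> PR V"
  using PR_add[of p V "- q"] PR_uminus[of q V] by simp

lemma PR_zero: "0 \<in> PR V" and PR_one: "1 \<in> PR V"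
  by (simp_all add: poly_ring_simps(1))

lemma PR_sum: "(\<And>x. x \<in> S \<Longrightarrow> f x \<in> PR V) \<Longrightarrow> sum f S \<in> PR V"
  by (induction S rule: infinite_finite_induct) (auto simp: PR_zero PR_add)

lemma PR_single: "supp m \<subseteq> V \<Longrightarrow> Poly_Mapping.single m c \<in> PR V"
  by (auto simp: poly_ring_simps(1))

lemmas PR_intros = PR_add PR_mult PR_uminus PR_minus PR_zero PR_one PR_sum

lemma supp_add_nat: "supp (m + n) = supp m \<union> supp (n :: 'v \<Rightarrow>\<^sub>0 nat)"
  by (auto simp: in_keys_iff lookup_add)

lemma poly_eq_sum_single: "p = (\<Sum>m\<in>supp p. Poly_Mapping.single m (coef p m))"
  by (rule poly_mapping_eqI) (simp add: lookup_sum lookup_single when_def in_keys_iff)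

section \<open>Homogeneous components\<close>

lemma mon_degree_superset:
  assumes "finite S" "supp m \<subseteq> S"
  shows "mon_degree m = (\<Sum>x\<in>S. coef m x)"
  unfolding mon_degree_def by (rule sum.mono_neutral_left) (use assms in \<open>auto simp: in_keys_iff\<close>)

lemma mon_degree_add: "mon_degree (m + n) = mon_degree m + mon_degree n"
proof -
  let ?S = "supp m \<union> supp n"
  have "mon_degree (m + n) = (\<Sum>x\<in>?S. coef (m + n) x)"
    by (rule mon_degree_superset) (simp_all add: supp_add_nat)
  also have "\<dots> = (\<Sum>x\<in>?S. coef m x) + (\<Sum>x\<in>?S. coef n x)"
    by (simp add: lookup_add sum.distrib)
  also have "\<dots> = mon_degree m + mon_degree n"
    by (simp add: mon_degree_superset[of ?S])
  finally show ?thesis .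
qed

definition hcomp :: "int \<Rightarrow> ('v, 'k::field) mpoly \<Rightarrow> ('v, 'k) mpoly" where
  "hcomp d p = Poly_Mapping.mapp (\<lambda>m c. c when int (mon_degree m) = d) p"

lemma coef_hcomp: "coef (hcomp d p) m = (coef p m when int (mon_degree m) = d)"
  by (auto simp: hcomp_def lookup_mapp when_def in_keys_iff)

lemma supp_hcomp: "supp (hcomp d p) = {m \<in> supp p. int (mon_degree m) = d}"
  by (auto simp: in_keys_iff coef_hcomp when_def split: if_splits)

lemma homogeneous_hcomp: "homogeneous d (hcomp d p)"
  by (simp add: homogeneous_def supp_hcomp)

lemma hcomp_PR: "p \<in> PR V \<Longrightarrow> hcomp d p \<in> PR V"
  by (simp add: poly_ring_simps(1) supp_hcomp)

lemma hcomp_add: "hcomp d (p + q) = hcomp d p + hcomp d q"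
  by (rule poly_mapping_eqI) (simp add: coef_hcomp lookup_add when_def)

lemma hcomp_minus: "hcomp d (p - q) = hcomp d p - hcomp d q"
  by (rule poly_mapping_eqI) (simp add: coef_hcomp lookup_minus when_def)

lemma hcomp_zero [simp]: "hcomp d 0 = 0"
  by (rule poly_mapping_eqI) (simp add: coef_hcomp)

lemma hcomp_sum: "hcomp d (sum f S) = (\<Sum>x\<in>S. hcomp d (f x))"
  by (induction S rule: infinite_finite_induct) (auto simp: hcomp_add)

lemma homogeneous_zero [simp]: "homogeneous d 0"
  by (simp add: homogeneous_def)

lemma homogeneous_one [simp]: "homogeneous 0 1"
  by (simp add: homogeneous_def mon_degree_def)

lemma homogeneous_add: "homogeneous d p \<Longrightarrow> homogeneous d q \<Longrightarrow> homogeneous d (p + q)"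
  using Poly_Mapping.keys_add[of p q] by (auto simp: homogeneous_def)

lemma homogeneous_uminus: "homogeneous d p \<Longrightarrow> homogeneous d (- p)"
  by (simp add: homogeneous_def)

lemma homogeneous_minus: "homogeneous d p \<Longrightarrow> homogeneous d q \<Longrightarrow> homogeneous d (p - q)"
  using homogeneous_add[of d p "- q"] homogeneous_uminus by auto

lemma homogeneous_sum: "(\<And>x. x \<in> S \<Longrightarrow> homogeneous d (f x)) \<Longrightarrow> homogeneous d (sum f S)"
  by (induction S rule: infinite_finite_induct) (auto simp: homogeneous_add)

lemma homogeneous_mult:
  assumes "homogeneous d p" "homogeneous d' q"
  shows "homogeneous (d + d') (p * q)"
  unfolding homogeneous_def
proof
  fix m assume "m \<in> supp (p * q)"
  then obtain a b where "m = a + b" "a \<in> supp p" "b \<in> supp q"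
    using Poly_Mapping.keys_mult[of p q] by blast
  then show "int (mon_degree m) = d + d'"
    using assms by (auto simp: homogeneous_def mon_degree_add)
qed

lemma hcomp_homogeneous: "homogeneous d' p \<Longrightarrow> hcomp d p = (if d = d' then p else 0)"
  by (rule poly_mapping_eqI) (auto simp: coef_hcomp homogeneous_def in_keys_iff when_def)

lemma sum_hcomp:
  assumes "finite S" "(\<lambda>m. int (mon_degree m)) ` supp p \<subseteq> S"
  shows "p = (\<Sum>d\<in>S. hcomp d p)"
proof (rule poly_mapping_eqI)
  fix m
  show "coef p m = coef (\<Sum>d\<in>S. hcomp d p) m"
  proof (cases "m \<in> supp p")
    case True
    then have "int (mon_degree m) \<in> S" using assms by auto
    then show ?thesis using assms(1) by (simp add: lookup_sum coef_hcomp when_def)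
  next
    case False
    then show ?thesis by (simp add: lookup_sum coef_hcomp in_keys_iff when_def)
  qed
qed

lemma hcomp_mult:
  assumes "homogeneous d' q"
  shows "hcomp d (p * q) = hcomp (d - d') p * q"
proof -
  \<comment> \<open>\<open>d - d'\<close> is inserted so that the sum over \<open>S\<close> has this
    index even if \<open>p\<close> has no monomial of that degree.\<close>
  define S where "S = insert (d - d') ((\<lambda>m. int (mon_degree m)) ` supp p)"
  have fin: "finite S" by (simp add: S_def)
  have p: "p = (\<Sum>\<delta>\<in>S. hcomp \<delta> p)" by (rule sum_hcomp) (auto simp: S_def)
  have "hcomp d (p * q) = (\<Sum>\<delta>\<in>S. hcomp d (hcomp \<delta> p * q))"
    by (subst p) (simp add: sum_distrib_right hcomp_sum)
  also have "\<dots> = (\<Sum>\<delta>\<in>S. if \<delta> = d - d' then hcomp \<delta> p * q else 0)"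
    by (rule sum.cong[OF refl], subst hcomp_homogeneous[OF homogeneous_mult[OF homogeneous_hcomp assms]]) auto
  also have "\<dots> = hcomp (d - d') p * q" using fin by (simp add: S_def)
  finally show ?thesis .
qed

section \<open>Constant coefficients\<close>

text \<open>A sum of exponent vectors vanishes only if both do. So taking constant coefficients is
  multiplicative: it is reduction modulo the irrelevant ideal, and turns matrices of maps into
  matrices over the field.\<close>

lemma coef_mult_0: "coef (p * q) 0 = coef p 0 * coef q (0 :: 'v \<Rightarrow>\<^sub>0 nat)"
proof -
  have zero: "a = 0 \<and> b = 0" if "0 = a + b" for a b :: "'v \<Rightarrow>\<^sub>0 nat"
  proof -
    have "supp a \<union> supp b = {}" using arg_cong[OF that, of supp] by (simp add: supp_add_nat)
    then show ?thesis by simp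
  qed
  have "coef p k * (\<Sum>q'. coef q q' when 0 = k + q') = (coef p 0 * coef q 0 when k = 0)" for k
  proof (cases "k = 0")
    case True
    have "(\<Sum>q'. coef q q' when 0 = q') = coef q 0" by (simp only: Sum_any_when_equal')
    then show ?thesis using True by simp
  next
    case False
    then have "(coef q q' when 0 = k + q') = 0" for q'
      using zero[of k q'] by (auto simp: when_def)
    then show ?thesis using False by simp
  qed
  then show ?thesis by (simp add: lookup_mult)
qed

lemma coef_0_homogeneous: "homogeneous d p \<Longrightarrow> d \<noteq> 0 \<Longrightarrow> coef p 0 = 0"
  by (force simp: homogeneous_def in_keys_iff mon_degree_def)

lemma coef_one_0: "coef (1 :: ('v, 'k::field) mpoly) 0 = 1"
  by (simp add: lookup_one)

lemma var_PR: "x \<in> V \<Longrightarrow> var x \<in> PR V"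
  unfolding var_def by (rule PR_single) simp

section \<open>Ideals of the polynomial ring and the irrelevant ideal\<close>

lemma ideal_poly_ringI:
  fixes S :: "('v, 'k::field) mpoly set"
  assumes sub: "S \<subseteq> PR V" and zero: "0 \<in> S" and add: "\<And>p q. p \<in> S \<Longrightarrow> q \<in> S \<Longrightarrow> p + q \<in> S"
    and mult: "\<And>c p. c \<in> PR V \<Longrightarrow> p \<in> S \<Longrightarrow> c * p \<in> S"
  shows "ideal S (poly_ring V)"
proof -
  interpret cring "poly_ring V :: ('v, 'k) mpoly ring" by (rule cring_poly_ring)
  have inv: "\<ominus>\<^bsub>poly_ring V\<^esub> p = - p" if "p \<in> PR V" for p :: "('v, 'k) mpoly"
    using that minus_equality[of "- p" p] by (simp add: poly_ring_simps(2-) PR_uminus)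
  have neg: "- p \<in> S" if "p \<in> S" for p
    using mult[OF PR_uminus[OF PR_one] that] by simp
  have mult': "p * c \<in> S" if "p \<in> S" "c \<in> PR V" for p c
    using mult[OF that(2,1)] by (simp add: mult.commute)
  show ?thesis
  proof (rule idealI)
    show "Ring.ring (poly_ring V :: ('v, 'k) mpoly ring)" by (rule ring_axioms)
    show "subgroup S (add_monoid (poly_ring V))"
    proof (rule group.subgroupI)
      show "group (add_monoid (poly_ring V :: ('v, 'k) mpoly ring))" by (rule a_group)
      show "S \<noteq> {}" using zero by auto
    next
      fix p assume "p \<in> S"
      then show "inv\<^bsub>add_monoid (poly_ring V)\<^esub> p \<in> S"
        using inv[of p] neg sub by (auto simp: a_inv_def)
    qed (use sub add in \<open>auto simp: poly_ring_simps(3)\<close>)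
  qed (use mult mult' in \<open>auto simp: poly_ring_simps(2)\<close>)
qed

lemma ideal_poly_ringD:
  assumes "ideal S (poly_ring V)"
  shows "S \<subseteq> PR V" "0 \<in> S" "p \<in> S \<Longrightarrow> q \<in> S \<Longrightarrow> p + q \<in> S"
    "c \<in> PR V \<Longrightarrow> p \<in> S \<Longrightarrow> c * p \<in> S"
proof -
  interpret ideal S "poly_ring V" by fact
  show "S \<subseteq> PR V" by (rule a_subset)
  show "0 \<in> S" using additive_subgroup.zero_closed[OF is_additive_subgroup] by (simp add: poly_ring_simps)
  show "p \<in> S \<Longrightarrow> q \<in> S \<Longrightarrow> p + q \<in> S" using additive_subgroup.a_closed[OF is_additive_subgroup] by (simp add: poly_ring_simps)
  show "c \<in> PR V \<Longrightarrow> p \<in> S \<Longrightarrow> c * p \<in> S" using I_l_closed by (simp add: poly_ring_simps)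
qed

lemma ideal_poly_ring_sum:
  assumes "ideal S (poly_ring V)" "\<And>x. x \<in> X \<Longrightarrow> f x \<in> S"
  shows "sum f X \<in> S"
  using assms(2) by (induction X rule: infinite_finite_induct)
    (auto simp: ideal_poly_ringD[OF assms(1)])

text \<open>A monomial other than 1 has a variable as a factor. This turns minimality into the
  condition on constant coefficients that \<open>resolution\<close> states.\<close>

lemma irrelevant_ideal_eq:
  fixes V :: "'v set"
  shows "irrelevant_ideal V = {p \<in> PR V. coef p 0 = (0::'k::field)}"
proof
  interpret cring "poly_ring V :: ('v, 'k) mpoly ring" by (rule cring_poly_ring)
  let ?M = "{p \<in> PR V. coef p 0 = (0::'k)}"
  have "ideal ?M (poly_ring V)"
    by (rule ideal_poly_ringI) (auto simp: PR_intros lookup_add coef_mult_0)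
  moreover have "var ` V \<subseteq> ?M"
    by (auto simp: var_PR) (auto simp: var_def lookup_single when_def, metis lookup_single_eq lookup_zero nat.simps(3))
  ultimately show "irrelevant_ideal V \<subseteq> ?M"
    unfolding irrelevant_ideal_def by (rule genideal_minimal)
  have sub: "var ` V \<subseteq> (PR V :: ('v, 'k) mpoly set)" by (auto simp: var_PR)
  have id: "ideal (irrelevant_ideal V) (poly_ring V :: ('v, 'k) mpoly ring)"
    unfolding irrelevant_ideal_def by (rule genideal_ideal[OF sub])
  show "?M \<subseteq> irrelevant_ideal V"
  proof
    fix p :: "('v, 'k) mpoly" assume p: "p \<in> ?M"
    have single: "Poly_Mapping.single m c \<in> irrelevant_ideal V"
      if m: "m \<noteq> 0" "supp m \<subseteq> V" for m and c :: 'k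
    proof -
      obtain x where x: "x \<in> supp m" using m(1) by fastforce
      define m' where "m' = m - Poly_Mapping.single x 1"
      have m': "m = m' + Poly_Mapping.single x 1"
        by (rule poly_mapping_eqI) (use x in \<open>auto simp: m'_def lookup_add lookup_minus lookup_single when_def in_keys_iff\<close>)
      have "supp m' \<subseteq> V" using m(2) m' by (auto simp: supp_add_nat)
      moreover have "(var x :: ('v, 'k) mpoly) \<in> irrelevant_ideal V"
        unfolding irrelevant_ideal_def
        by (rule subsetD[OF genideal_self[OF sub] imageI]) (rule subsetD[OF m(2) x])
      ultimately have "Poly_Mapping.single m' c * var x \<in> irrelevant_ideal V"
        by (intro ideal_poly_ringD(4)[OF id PR_single])
      then show ?thesis using m' by (simp add: var_def mult_single)
    qed
    have "(\<Sum>m\<in>supp p. Poly_Mapping.single m (coef p m)) \<in> irrelevant_ideal V"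
      by (rule ideal_poly_ring_sum[OF id], rule single)
        (use p in \<open>auto simp: poly_ring_simps(1) in_keys_iff\<close>)
    then show "p \<in> irrelevant_ideal V" by (simp flip: poly_eq_sum_single)
  qed
qed

section \<open>Square-free monomial ideals\<close>

text \<open>For square-free generators divisibility is inclusion in the support, so membership is
  read off each monomial, and homogeneity, colon ideals and new generators become matters of sets.
  \<open>sqf_ideal_eq_genideal\<close> identifies this with the generated ideal.\<close>

definition sqf_ideal :: "'v set \<Rightarrow> 'v set set \<Rightarrow> ('v, 'k::field) mpoly set" where
  "sqf_ideal V \<A> = {p \<in> PR V. \<forall>m\<in>supp p. \<exists>A\<in>\<A>. A \<subseteq> supp m}"

definition ind :: "'v set \<Rightarrow> 'v \<Rightarrow>\<^sub>0 nat" where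
  "ind A = (\<Sum>x\<in>A. Poly_Mapping.single x 1)"

definition sqf :: "'v set \<Rightarrow> ('v, 'k::field) mpoly" where
  "sqf A = Poly_Mapping.single (ind A) 1"

lemma coef_ind: "finite A \<Longrightarrow> coef (ind A) x = (if x \<in> A then 1 else 0)"
  by (simp add: ind_def lookup_sum lookup_single when_def)

lemma supp_ind: "finite A \<Longrightarrow> supp (ind A) = A"
  by (auto simp: in_keys_iff coef_ind split: if_splits)

lemma mon_degree_ind: "finite A \<Longrightarrow> mon_degree (ind A) = card A"
  by (simp add: mon_degree_def supp_ind coef_ind)

lemma ind_dvd:
  assumes "finite A" "A \<subseteq> supp m"
  obtains n where "m = ind A + n"
proof
  show "m = ind A + (m - ind A)"
    by (rule poly_mapping_eqI)
      (use assms in \<open>auto simp: lookup_add lookup_minus coef_ind in_keys_iff Suc_le_eq\<close>)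
qed

text \<open>Translation of exponents is injective, so multiplying by a monomial merges no two terms
  and nothing cancels.\<close>

lemma supp_single_mult:
  fixes t :: "'v \<Rightarrow>\<^sub>0 nat" and p :: "('v, 'k::field) mpoly"
  shows "supp (Poly_Mapping.single t 1 * p) = (+) t ` supp p"
proof -
  have p: "Poly_Mapping.single t 1 * p = (\<Sum>n\<in>supp p. Poly_Mapping.single (t + n) (coef p n))"
    by (subst poly_eq_sum_single[of p]) (simp add: sum_distrib_left mult_single)
  have "coef (Poly_Mapping.single t 1 * p) (t + n) = coef p n" for n
    by (auto simp: p lookup_sum lookup_single when_def in_keys_iff)
  note c = this
  have out: "coef (Poly_Mapping.single t 1 * p) k = 0" if "k \<notin> range ((+) t)" for k
    unfolding p lookup_sum by (rule sum.neutral) (use that in \<open>auto simp: lookup_single when_def\<close>)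
  show ?thesis
  proof (rule Set.set_eqI)
    fix k show "k \<in> supp (Poly_Mapping.single t 1 * p) \<longleftrightarrow> k \<in> (+) t ` supp p"
    proof (cases "k \<in> range ((+) t)")
      case True
      then obtain n where "k = t + n" by auto
      then show ?thesis by (auto simp: in_keys_iff c)
    next
      case False
      then show ?thesis using out by (auto simp: in_keys_iff)
    qed
  qed
qed

lemma sqf_PR: "finite A \<Longrightarrow> A \<subseteq> V \<Longrightarrow> sqf A \<in> PR V"
  unfolding sqf_def by (rule PR_single) (simp add: supp_ind)

lemma homogeneous_sqf: "finite A \<Longrightarrow> homogeneous (int (card A)) (sqf A)"
  by (simp add: homogeneous_def sqf_def mon_degree_ind)

lemma sqf_eq_prod: "sqf A = (\<Prod>x\<in>A. var x)"
proof (induction A rule: infinite_finite_induct)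
  case (insert x A)
  have "sqf (insert x A) = var x * (sqf A :: ('a, 'b) mpoly)"
    using insert(1,2) by (simp add: sqf_def ind_def var_def mult_single)
  then show ?case using insert by simp
qed (simp_all add: sqf_def ind_def)

lemma sqf_ideal_subset: "sqf_ideal V \<A> \<subseteq> PR V"
  by (auto simp: sqf_ideal_def)

lemma ideal_sqf_ideal: "ideal (sqf_ideal V \<A>) (poly_ring V)"
proof (rule ideal_poly_ringI[OF sqf_ideal_subset])
  show "0 \<in> sqf_ideal V \<A>" by (simp add: sqf_ideal_def PR_zero)
next
  fix p q :: "('a, 'b) mpoly" assume "p \<in> sqf_ideal V \<A>" "q \<in> sqf_ideal V \<A>"
  then show "p + q \<in> sqf_ideal V \<A>"
    using Poly_Mapping.keys_add[of p q] by (auto simp: sqf_ideal_def PR_add)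
next
  fix c p :: "('a, 'b) mpoly" assume cp: "c \<in> PR V" "p \<in> sqf_ideal V \<A>"
  have "\<exists>A\<in>\<A>. A \<subseteq> supp m" if m: "m \<in> supp (c * p)" for m
  proof -
    obtain a b where ab: "m = a + b" "b \<in> supp p"
      using m Poly_Mapping.keys_mult[of c p] by blast
    then obtain A where "A \<in> \<A>" "A \<subseteq> supp b" using cp by (auto simp: sqf_ideal_def)
    then show ?thesis by (auto simp: ab(1) supp_add_nat)
  qed
  then show "c * p \<in> sqf_ideal V \<A>" using cp by (simp add: sqf_ideal_def PR_mult)
qed

lemma hcomp_sqf_ideal: "p \<in> sqf_ideal V \<A> \<Longrightarrow> hcomp d p \<in> sqf_ideal V \<A>"
  by (simp add: sqf_ideal_def hcomp_PR supp_hcomp)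

lemma sqf_ideal_cong:
  assumes "\<And>A. A \<in> \<A> \<Longrightarrow> \<exists>B\<in>\<B>. B \<subseteq> A" "\<And>B. B \<in> \<B> \<Longrightarrow> \<exists>A\<in>\<A>. A \<subseteq> B"
  shows "sqf_ideal V \<A> = sqf_ideal V \<B>"
proof -
  have "(\<exists>A\<in>\<A>. A \<subseteq> X) \<longleftrightarrow> (\<exists>B\<in>\<B>. B \<subseteq> X)" for X
    using assms by (metis subset_trans)
  then show ?thesis by (simp add: sqf_ideal_def)
qed

lemma sqf_in_sqf_ideal: "finite B \<Longrightarrow> B \<subseteq> V \<Longrightarrow> B \<in> \<B> \<Longrightarrow> sqf B \<in> sqf_ideal V \<B>"
  by (auto simp: sqf_ideal_def sqf_PR) (auto simp: sqf_def supp_ind)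

text \<open>Multiplication by \<open>sqf B\<close> translates the support, and \<open>A\<close> lies
  in the union of \<open>B\<close> and \<open>X\<close> iff \<open>A - B\<close> lies in
  \<open>X\<close>. Colon ideals thus stay within the square-free monomial ideals.\<close>

lemma sqf_colon:
  assumes "finite B" "B \<subseteq> V" "c \<in> PR V"
  shows "sqf B * c \<in> sqf_ideal V \<A> \<longleftrightarrow> c \<in> sqf_ideal V ((\<lambda>A. A - B) ` \<A>)"
proof -
  have "supp (sqf B * c) = (+) (ind B) ` supp c"
    unfolding sqf_def by (rule supp_single_mult)
  moreover have "A \<subseteq> B \<union> X \<longleftrightarrow> A - B \<subseteq> X" for A X by auto
  ultimately show ?thesis
    using PR_mult[OF sqf_PR[OF assms(1,2)] assms(3)] assms(3)
    by (simp add: sqf_ideal_def supp_add_nat supp_ind[OF assms(1)])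
qed

lemma single_sqf_multiple:
  assumes "finite B" "B \<subseteq> supp m" "supp m \<subseteq> V"
  obtains c :: "('v, 'k::field) mpoly" where "c \<in> PR V" "Poly_Mapping.single m a = sqf B * c"
proof -
  obtain n where n: "m = ind B + n" using ind_dvd[OF assms(1,2)] .
  show ?thesis
  proof
    show "Poly_Mapping.single n a \<in> PR V"
      by (rule PR_single) (use assms n in \<open>auto simp: supp_add_nat\<close>)
    show "Poly_Mapping.single m a = sqf B * Poly_Mapping.single n a"
      by (simp add: n sqf_def mult_single)
  qed
qed

text \<open>Monomial by monomial: a term divisible by \<open>sqf B\<close> goes to \<open>c\<close>,
  any other lies in the smaller ideal. The right-hand side has the form of \<open>J'\<close> in
  \<open>mapping_cone\<close>.\<close>

lemma sqf_ideal_insert: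
  fixes p :: "('v, 'k::field) mpoly"
  assumes "finite B" "B \<subseteq> V"
  shows "p \<in> sqf_ideal V (insert B \<A>) \<longleftrightarrow> (\<exists>q\<in>sqf_ideal V \<A>. \<exists>c\<in>PR V. p = q + sqf B * c)"
proof
  let ?S = "{p :: ('v, 'k) mpoly. \<exists>q\<in>sqf_ideal V \<A>. \<exists>c\<in>PR V. p = q + sqf B * c}"
  note A = ideal_poly_ringD[OF ideal_sqf_ideal[of V \<A>]]
  have SI: "p \<in> ?S" if "q \<in> sqf_ideal V \<A>" "c \<in> PR V" "p = q + sqf B * c" for p q c
    using that by blast
  have S: "ideal ?S (poly_ring V)"
  proof (rule ideal_poly_ringI)
    show "?S \<subseteq> PR V" using A(1) sqf_PR[OF assms] by (auto intro!: PR_intros)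
    show "0 \<in> ?S" by (rule SI[OF A(2) PR_zero]) simp
  next
    fix p q :: "('v, 'k) mpoly" assume "p \<in> ?S" "q \<in> ?S"
    then obtain p' c q' d where "p' \<in> sqf_ideal V \<A>" "c \<in> PR V" "p = p' + sqf B * c"
      "q' \<in> sqf_ideal V \<A>" "d \<in> PR V" "q = q' + sqf B * d" by auto
    then show "p + q \<in> ?S"
      by (intro SI[OF A(3)[of p' q'] PR_add[of c V d]]) (simp_all add: algebra_simps)
  next
    fix a p :: "('v, 'k) mpoly" assume "a \<in> PR V" "p \<in> ?S"
    then obtain p' c where "p' \<in> sqf_ideal V \<A>" "c \<in> PR V" "p = p' + sqf B * c" by auto
    with \<open>a \<in> PR V\<close> show "a * p \<in> ?S"
      by (intro SI[OF A(4)[of a p'] PR_mult[of a V c]]) (simp_all add: algebra_simps)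
  qed
  assume p: "p \<in> sqf_ideal V (insert B \<A>)"
  have "Poly_Mapping.single m (coef p m) \<in> ?S" if m: "m \<in> supp p" for m
  proof -
    have V: "supp m \<subseteq> V" using p m by (auto simp: sqf_ideal_def poly_ring_simps(1))
    from p m consider "B \<subseteq> supp m" | "\<exists>A\<in>\<A>. A \<subseteq> supp m" by (auto simp: sqf_ideal_def)
    then show ?thesis
    proof cases
      case 1
      obtain c where "c \<in> PR V" "Poly_Mapping.single m (coef p m) = sqf B * c"
        using single_sqf_multiple[OF assms(1) 1 V] .
      then show ?thesis by (intro SI[OF A(2), of c]) simp_all
    next
      case 2
      then have s: "Poly_Mapping.single m (coef p m) \<in> sqf_ideal V \<A>"
        by (auto simp: sqf_ideal_def PR_single[OF V])
      then show ?thesis by (rule SI[OF _ PR_zero]) simp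
    qed
  qed
  then have "(\<Sum>m\<in>supp p. Poly_Mapping.single m (coef p m)) \<in> ?S"
    by (rule ideal_poly_ring_sum[OF S])
  then show "\<exists>q\<in>sqf_ideal V \<A>. \<exists>c\<in>PR V. p = q + sqf B * c"
    by (simp flip: poly_eq_sum_single)
next
  assume "\<exists>q\<in>sqf_ideal V \<A>. \<exists>c\<in>PR V. p = q + sqf B * c"
  then obtain q c where qc: "q \<in> sqf_ideal V \<A>" "c \<in> PR V" "p = q + sqf B * c" by auto
  have "q \<in> sqf_ideal V (insert B \<A>)" using qc(1) by (auto simp: sqf_ideal_def)
  moreover have "c * sqf B \<in> sqf_ideal V (insert B \<A>)"
    by (rule ideal_poly_ringD(4)[OF ideal_sqf_ideal qc(2)]) (rule sqf_in_sqf_ideal, use assms in auto)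
  ultimately show "p \<in> sqf_ideal V (insert B \<A>)"
    unfolding qc(3) mult.commute[of "sqf B"] by (rule ideal_poly_ringD(3)[OF ideal_sqf_ideal])
qed

lemma sqf_ideal_eq_genideal:
  fixes V :: "'v set"
  assumes "finite V" "\<A> \<subseteq> Pow V"
  shows "Idl\<^bsub>poly_ring V\<^esub> (sqf ` \<A>) = (sqf_ideal V \<A> :: ('v, 'k::field) mpoly set)"
proof
  interpret cring "poly_ring V :: ('v, 'k) mpoly ring" by (rule cring_poly_ring)
  have fin: "finite A" "A \<subseteq> V" if "A \<in> \<A>" for A
    using assms that by (auto intro: finite_subset)
  have sub: "sqf ` \<A> \<subseteq> (PR V :: ('v, 'k) mpoly set)" by (auto intro!: sqf_PR fin)
  have id: "ideal (Idl\<^bsub>poly_ring V\<^esub> (sqf ` \<A>)) (poly_ring V :: ('v, 'k) mpoly ring)"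
    by (rule genideal_ideal[OF sub])
  show "Idl\<^bsub>poly_ring V\<^esub> (sqf ` \<A>) \<subseteq> (sqf_ideal V \<A> :: ('v, 'k) mpoly set)"
    by (rule genideal_minimal[OF ideal_sqf_ideal]) (auto intro!: sqf_in_sqf_ideal fin)
  show "sqf_ideal V \<A> \<subseteq> (Idl\<^bsub>poly_ring V\<^esub> (sqf ` \<A>) :: ('v, 'k) mpoly set)"
  proof
    fix p :: "('v, 'k) mpoly" assume p: "p \<in> sqf_ideal V \<A>"
    have "Poly_Mapping.single m (coef p m) \<in> Idl\<^bsub>poly_ring V\<^esub> (sqf ` \<A>)" if m: "m \<in> supp p" for m
    proof -
      obtain A where A: "A \<in> \<A>" "A \<subseteq> supp m" using p m by (auto simp: sqf_ideal_def)
      have V: "supp m \<subseteq> V" using p m by (auto simp: sqf_ideal_def poly_ring_simps(1))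
      obtain c where c: "c \<in> PR V" "Poly_Mapping.single m (coef p m) = sqf A * c"
        using single_sqf_multiple[OF fin(1)[OF A(1)] A(2) V] .
      show ?thesis
        unfolding c(2) mult.commute[of "sqf A"]
        by (rule ideal_poly_ringD(4)[OF id c(1)]) (rule subsetD[OF genideal_self[OF sub] imageI[OF A(1)]])
    qed
    then have "(\<Sum>m\<in>supp p. Poly_Mapping.single m (coef p m)) \<in> Idl\<^bsub>poly_ring V\<^esub> (sqf ` \<A>)"
      by (rule ideal_poly_ring_sum[OF id])
    then show "p \<in> Idl\<^bsub>poly_ring V\<^esub> (sqf ` \<A>)" by (simp flip: poly_eq_sum_single)
  qed
qed


section \<open>Graded free modules of finite rank\<close>

text \<open>Coordinates beyond the rank are 0 rather than \<open>undefined\<close>, so that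
  pointwise sums and differences of functions are the module operations and vectors of all ranks
  share one type.\<close>

definition fmod :: "'v set \<Rightarrow> nat \<Rightarrow> (nat \<Rightarrow> ('v, 'k::field) mpoly) set" where
  "fmod V n = {u. (\<forall>k. u k \<in> PR V) \<and> (\<forall>k\<ge>n. u k = 0)}"

definition smul :: "'a::times \<Rightarrow> (nat \<Rightarrow> 'a) \<Rightarrow> nat \<Rightarrow> 'a" where
  "smul c u = (\<lambda>k. c * u k)"

definition unit_vec :: "nat \<Rightarrow> nat \<Rightarrow> 'a::zero_neq_one" where
  "unit_vec l = (\<lambda>k. if k = l then 1 else 0)"

text \<open>Linearity is demanded on all families, so that rewriting with it needs no membership
  conditions; only the expansion in basis vectors refers to \<open>fmod\<close>.\<close>

definition linmap :: "((nat \<Rightarrow> 'a::comm_ring_1) \<Rightarrow> nat \<Rightarrow> 'a) \<Rightarrow> bool" where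
  "linmap A \<longleftrightarrow> (\<forall>u v. A (u + v) = A u + A v) \<and> (\<forall>c u. A (smul c u) = smul c (A u))"

text \<open>Basis vector \<open>k\<close> has degree \<open>e k\<close>: these are the elements of
  degree \<delta> in the direct sum of the modules R(-e k).\<close>

definition homog_vec :: "(nat \<Rightarrow> int) \<Rightarrow> int \<Rightarrow> (nat \<Rightarrow> ('v, 'k::field) mpoly) \<Rightarrow> bool" where
  "homog_vec e \<delta> u \<longleftrightarrow> (\<forall>k. homogeneous (\<delta> - e k) (u k))"

definition gmap :: "'v set \<Rightarrow> nat \<Rightarrow> (nat \<Rightarrow> int) \<Rightarrow> nat \<Rightarrow> (nat \<Rightarrow> int) \<Rightarrow>
    ((nat \<Rightarrow> ('v, 'k::field) mpoly) \<Rightarrow> nat \<Rightarrow> ('v, 'k) mpoly) \<Rightarrow> bool" where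
  "gmap V n e m e' A \<longleftrightarrow> linmap A \<and> (\<forall>u\<in>fmod V n. A u \<in> fmod V m) \<and>
     (\<forall>\<delta>. \<forall>u\<in>fmod V n. homog_vec e \<delta> u \<longrightarrow> homog_vec e' \<delta> (A u))"

lemma fmod_add: "u \<in> fmod V n \<Longrightarrow> v \<in> fmod V n \<Longrightarrow> u + v \<in> fmod V n"
  by (simp add: fmod_def PR_add)

lemma fmod_minus: "u \<in> fmod V n \<Longrightarrow> v \<in> fmod V n \<Longrightarrow> u - v \<in> fmod V n"
  by (simp add: fmod_def PR_minus)

lemma fmod_uminus: "u \<in> fmod V n \<Longrightarrow> - u \<in> fmod V n"
  by (simp add: fmod_def PR_uminus)

lemma fmod_zero: "0 \<in> fmod V n"
  by (simp add: fmod_def PR_zero)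

lemma fmod_unit_vec: "l < n \<Longrightarrow> unit_vec l \<in> fmod V n"
  by (simp add: fmod_def unit_vec_def PR_zero PR_one)

lemma homog_vec_unit_vec: "homog_vec e (e l) (unit_vec l)"
  by (simp add: homog_vec_def unit_vec_def)

lemma linmap_add: "linmap A \<Longrightarrow> A (u + v) = A u + A v"
  and linmap_smul: "linmap A \<Longrightarrow> A (smul c u) = smul c (A u)"
  by (simp_all add: linmap_def)

lemma linmap_zero: "linmap A \<Longrightarrow> A 0 = 0"
  using linmap_add[of A 0 0] by simp

lemma linmap_uminus: "linmap A \<Longrightarrow> A (- u) = - A u"
  using linmap_smul[of A "- 1" u] by (simp add: smul_def fun_Compl_def)

lemma linmap_minus: "linmap A \<Longrightarrow> A (u - v) = A u - A v"
  using linmap_add[of A u "- v"] by (simp add: linmap_uminus fun_eq_iff)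

lemma linmap_sum: "linmap A \<Longrightarrow> A (sum f S) = (\<Sum>x\<in>S. A (f x))"
  by (induction S rule: infinite_finite_induct) (auto simp: linmap_zero linmap_add)

lemma sum_fun_apply: "sum f S x = (\<Sum>y\<in>S. f y x)"
  for f :: "'b \<Rightarrow> 'a \<Rightarrow> 'c::comm_monoid_add"
  by (induction S rule: infinite_finite_induct) auto

lemma fmod_expand:
  assumes "u \<in> fmod V n"
  shows "u = (\<Sum>l<n. smul (u l) (unit_vec l))"
proof
  fix k
  have "(\<Sum>l<n. u l * (if k = l then 1 else 0)) = (if k < n then u k else 0)"
    by (simp add: if_distrib[of "\<lambda>z. _ * z"] cong: if_cong)
  then show "u k = (\<Sum>l<n. smul (u l) (unit_vec l)) k"
    using assms by (simp add: sum_fun_apply smul_def unit_vec_def fmod_def)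
qed

lemma linmap_expand:
  assumes "linmap A" "u \<in> fmod V n"
  shows "A u k = (\<Sum>l<n. u l * A (unit_vec l) k)"
  by (subst fmod_expand[OF assms(2)])
    (simp add: linmap_sum[OF assms(1)] linmap_smul[OF assms(1)] sum_fun_apply, simp add: smul_def)

lemma gmapD:
  assumes "gmap V n e m e' A"
  shows "linmap A" "u \<in> fmod V n \<Longrightarrow> A u \<in> fmod V m"
    "u \<in> fmod V n \<Longrightarrow> homog_vec e \<delta> u \<Longrightarrow> homog_vec e' \<delta> (A u)"
  using assms by (auto simp: gmap_def)

lemma gmap_unit_vec:
  assumes "gmap V n e m e' A" "l < n"
  shows "A (unit_vec l) \<in> fmod V m" "homog_vec e' (e l) (A (unit_vec l))"
  using gmapD[OF assms(1)] fmod_unit_vec[OF assms(2)] homog_vec_unit_vec by blast+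

lemma gmap_comp:
  assumes "gmap V n e m e' A" "gmap V m e' p e'' B"
  shows "gmap V n e p e'' (\<lambda>u. B (A u))"
  using assms by (auto simp: gmap_def linmap_def)

definition lin_of :: "nat \<Rightarrow> (nat \<Rightarrow> nat \<Rightarrow> 'a::comm_ring_1) \<Rightarrow> (nat \<Rightarrow> 'a) \<Rightarrow> nat \<Rightarrow> 'a" where
  "lin_of n a u = (\<lambda>k. \<Sum>l<n. u l * a l k)"

lemma linmap_lin_of: "linmap (lin_of n a)"
  by (auto simp: linmap_def lin_of_def smul_def fun_eq_iff sum.distrib distrib_right
    sum_distrib_left mult.assoc)

lemma lin_of_unit_vec: "l < n \<Longrightarrow> lin_of n a (unit_vec l) = a l"
  by (simp add: lin_of_def unit_vec_def if_distrib[of "\<lambda>z. z * _"] cong: if_cong)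

lemma gmap_lin_of:
  assumes "\<And>l. l < n \<Longrightarrow> a l \<in> fmod V m" "\<And>l. l < n \<Longrightarrow> homog_vec e' (e l) (a l)"
  shows "gmap V n e m e' (lin_of n a)"
  unfolding gmap_def
proof (intro conjI ballI allI impI)
  show "linmap (lin_of n a)" by (rule linmap_lin_of)
next
  fix u :: "nat \<Rightarrow> ('a, 'b) mpoly" assume "u \<in> fmod V n"
  then show "lin_of n a u \<in> fmod V m"
    using assms(1) by (auto simp: fmod_def lin_of_def intro!: PR_sum PR_mult sum.neutral)
next
  fix \<delta> and u :: "nat \<Rightarrow> ('a, 'b) mpoly" assume u: "u \<in> fmod V n" "homog_vec e \<delta> u"
  have "homogeneous (\<delta> - e' k) (u l * a l k)" if "l < n" for k l
  proof -
    have "homogeneous ((\<delta> - e l) + (e l - e' k)) (u l * a l k)"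
      by (rule homogeneous_mult) (use u assms(2)[OF that] in \<open>simp_all add: homog_vec_def\<close>)
    then show ?thesis by simp
  qed
  then show "homog_vec e' \<delta> (lin_of n a u)"
    by (auto simp: homog_vec_def lin_of_def intro!: homogeneous_sum)
qed

definition hcomp_vec :: "(nat \<Rightarrow> int) \<Rightarrow> int \<Rightarrow> (nat \<Rightarrow> ('v, 'k::field) mpoly) \<Rightarrow> nat \<Rightarrow> ('v, 'k) mpoly" where
  "hcomp_vec e \<delta> u = (\<lambda>k. hcomp (\<delta> - e k) (u k))"

lemma hcomp_vec_fmod: "u \<in> fmod V n \<Longrightarrow> hcomp_vec e \<delta> u \<in> fmod V n"
  by (simp add: hcomp_vec_def fmod_def hcomp_PR)

lemma homog_vec_hcomp_vec: "homog_vec e \<delta> (hcomp_vec e \<delta> u)"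
  by (simp add: hcomp_vec_def homog_vec_def homogeneous_hcomp)

lemma hcomp_homogeneous_same: "homogeneous d p \<Longrightarrow> hcomp d p = p"
  by (simp add: hcomp_homogeneous[of d p d])

lemma hcomp_vec_homog: "homog_vec e \<delta> u \<Longrightarrow> hcomp_vec e \<delta> u = u"
  by (simp add: hcomp_vec_def homog_vec_def hcomp_homogeneous_same fun_eq_iff)

lemma gmap_hcomp_vec:
  assumes A: "gmap V n e m e' A" and u: "u \<in> fmod V n"
  shows "A (hcomp_vec e \<delta> u) = hcomp_vec e' \<delta> (A u)"
proof
  fix k
  note lin = gmapD(1)[OF A]
  have "hcomp (\<delta> - e l) (u l) * A (unit_vec l) k = hcomp (\<delta> - e' k) (u l * A (unit_vec l) k)"
    if "l < n" for l
  proof -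
    have "homogeneous (e l - e' k) (A (unit_vec l) k)"
      using gmap_unit_vec(2)[OF A that] by (simp add: homog_vec_def)
    from hcomp_mult[OF this, of "\<delta> - e' k" "u l"] show ?thesis by (simp add: algebra_simps)
  qed
  then show "A (hcomp_vec e \<delta> u) k = hcomp_vec e' \<delta> (A u) k"
    by (simp add: linmap_expand[OF lin hcomp_vec_fmod[OF u]])
      (simp add: hcomp_vec_def linmap_expand[OF lin u] hcomp_sum)
qed

lemma gmap_eq_on_basis:
  assumes "linmap A" "linmap B" "\<And>l. l < n \<Longrightarrow> A (unit_vec l) = B (unit_vec l)" "u \<in> fmod V n"
  shows "A u = B u"
  by (rule ext) (use assms(3) in \<open>simp add: linmap_expand[OF assms(1,4)] linmap_expand[OF assms(2,4)]\<close>)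

lemma linmap_comp: "linmap A \<Longrightarrow> linmap B \<Longrightarrow> linmap (\<lambda>u. B (A u))"
  by (simp add: linmap_def)

text \<open>Graded free modules are projective: the lift of a basis vector may be replaced by its
  homogeneous component.\<close>

lemma gmap_lift:
  assumes D: "gmap V m e' p e'' D" and T: "gmap V n e p e'' T"
    and im: "\<And>l. l < n \<Longrightarrow> T (unit_vec l) \<in> D ` fmod V m"
  obtains A where "gmap V n e m e' A" "\<And>u. u \<in> fmod V n \<Longrightarrow> D (A u) = T u"
proof -
  have "\<exists>a\<in>fmod V m. homog_vec e' (e l) a \<and> D a = T (unit_vec l)" if l: "l < n" for l
  proof -
    obtain v where v: "v \<in> fmod V m" "T (unit_vec l) = D v" using im[OF l] by auto
    have "D (hcomp_vec e' (e l) v) = T (unit_vec l)"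
      using gmap_hcomp_vec[OF D v(1), of "e l"] hcomp_vec_homog[OF gmap_unit_vec(2)[OF T l]] v(2)
      by simp
    then show ?thesis using hcomp_vec_fmod[OF v(1)] homog_vec_hcomp_vec by blast
  qed
  then obtain a where a: "\<And>l. l < n \<Longrightarrow> a l \<in> fmod V m"
    "\<And>l. l < n \<Longrightarrow> homog_vec e' (e l) (a l)" "\<And>l. l < n \<Longrightarrow> D (a l) = T (unit_vec l)"
    by metis
  show ?thesis
  proof
    show A: "gmap V n e m e' (lin_of n a)" by (rule gmap_lin_of) (use a in auto)
    show "D (lin_of n a u) = T u" if "u \<in> fmod V n" for u
      by (rule gmap_eq_on_basis[of "\<lambda>u. D (lin_of n a u)"])
        (use a that in \<open>simp_all add: lin_of_unit_vec linmap_comp gmapD(1)[OF D] gmapD(1)[OF T] linmap_lin_of\<close>)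
  qed
qed

section \<open>Uniqueness of the graded Betti numbers\<close>

definition aug :: "nat \<Rightarrow> (nat \<Rightarrow> 'a::comm_ring_1) \<Rightarrow> (nat \<Rightarrow> 'a) \<Rightarrow> 'a" where
  "aug n g u = (\<Sum>k<n. g k * u k)"

lemma aug_minus: "aug n g (u - v) = aug n g u - aug n g v"
  by (simp add: aug_def sum_subtractf right_diff_distrib)

lemma aug_fmod_in_PR: "(\<And>k. k < n \<Longrightarrow> g k \<in> PR V) \<Longrightarrow> u \<in> fmod V n \<Longrightarrow> aug n g u \<in> PR V"
  by (auto simp: aug_def fmod_def intro!: PR_sum PR_mult)

lemma aug_hcomp_vec:
  assumes "\<And>k. k < n \<Longrightarrow> homogeneous (e k) (g k)"
  shows "aug n g (hcomp_vec e \<delta> u) = hcomp \<delta> (aug n g u)"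
proof -
  have "g k * hcomp (\<delta> - e k) (u k) = hcomp \<delta> (g k * u k)" if "k < n" for k
    using hcomp_mult[OF assms[OF that], of \<delta> "u k"] by (simp add: mult.commute)
  then show ?thesis by (simp add: aug_def hcomp_vec_def hcomp_sum)
qed

text \<open>In degree 0 the kernel is that of the augmentation, whose target R/I is not a free
  module; \<open>P\<close> stands for vanishing there. As a parameter it serves both
  \<open>resolution\<close> and \<open>linear_resolution\<close>.\<close>

definition cycles :: "'v set \<Rightarrow> (nat \<Rightarrow> nat) \<Rightarrow>
    (nat \<Rightarrow> (nat \<Rightarrow> ('v, 'k::field) mpoly) \<Rightarrow> nat \<Rightarrow> ('v, 'k) mpoly) \<Rightarrow>
    ((nat \<Rightarrow> ('v, 'k) mpoly) \<Rightarrow> bool) \<Rightarrow> nat \<Rightarrow> (nat \<Rightarrow> ('v, 'k) mpoly) set" where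
  "cycles V b D P i = (case i of 0 \<Rightarrow> {u \<in> fmod V (b 0). P u} | Suc j \<Rightarrow> {u \<in> fmod V (b i). D j u = 0})"

text \<open>The same data as in the locale of graded minimal free resolutions, with the
  differentials as functions that are linear on all families of polynomials.\<close>

locale resolution =
  fixes V :: "'v set" and I :: "('v, 'k::field) mpoly set"
    and b :: "nat \<Rightarrow> nat" and e :: "nat \<Rightarrow> nat \<Rightarrow> int" and g :: "nat \<Rightarrow> ('v, 'k) mpoly"
    and D :: "nat \<Rightarrow> (nat \<Rightarrow> ('v, 'k) mpoly) \<Rightarrow> nat \<Rightarrow> ('v, 'k) mpoly"
    and Z :: "nat \<Rightarrow> (nat \<Rightarrow> ('v, 'k) mpoly) set"
  defines "Z \<equiv> cycles V b D (\<lambda>u. aug (b 0) g u \<in> I)"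
  assumes g: "k < b 0 \<Longrightarrow> g k \<in> PR V \<and> homogeneous (e 0 k) (g k)"
    and surj: "c \<in> PR V \<Longrightarrow> \<exists>u\<in>fmod V (b 0). aug (b 0) g u - c \<in> I"
    and D: "gmap V (b (Suc i)) (e (Suc i)) (b i) (e i) (D i)"
    and exact: "Z i = D i ` fmod V (b (Suc i))"
    and minimal: "u \<in> fmod V (b (Suc i)) \<Longrightarrow> coef (D i u k) 0 = 0"
begin

lemma Z_0: "Z 0 = {u \<in> fmod V (b 0). aug (b 0) g u \<in> I}"
  and Z_Suc: "Z (Suc i) = {u \<in> fmod V (b (Suc i)). D i u = 0}"
  by (simp_all add: Z_def cycles_def)

end

text \<open>Cycles of the target are boundaries, so \<open>A\<close> after \<open>D i\<close> lands
  in the image of \<open>D' i\<close> and lifts by projectivity. The new map sends cycles to cycles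
  again, which the next lift requires.\<close>

lemma lift_chain_map:
  assumes "resolution V I b e g D" "resolution V I b' e' g' D'"
  defines "Z \<equiv> cycles V b D (\<lambda>u. aug (b 0) g u \<in> I)"
    and "Z' \<equiv> cycles V b' D' (\<lambda>u. aug (b' 0) g' u \<in> I)"
  assumes A: "gmap V (b i) (e i) (b' i) (e' i) A" "A ` Z i \<subseteq> Z' i"
  obtains A' where "gmap V (b (Suc i)) (e (Suc i)) (b' (Suc i)) (e' (Suc i)) A'"
    "A' ` Z (Suc i) \<subseteq> Z' (Suc i)"
    "\<And>u. u \<in> fmod V (b (Suc i)) \<Longrightarrow> D' i (A' u) = A (D i u)"
proof -
  interpret F: resolution V I b e g D Z unfolding Z_def by fact
  interpret F': resolution V I b' e' g' D' Z' unfolding Z'_def by fact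
  have "A (D i (unit_vec l)) \<in> D' i ` fmod V (b' (Suc i))" if "l < b (Suc i)" for l
    using A(2) fmod_unit_vec[OF that] unfolding F.exact F'.exact by blast
  from gmap_lift[OF F'.D gmap_comp[OF F.D A(1)] this]
  obtain A' where A': "gmap V (b (Suc i)) (e (Suc i)) (b' (Suc i)) (e' (Suc i)) A'"
    "\<And>u. u \<in> fmod V (b (Suc i)) \<Longrightarrow> D' i (A' u) = A (D i u)" by blast
  show ?thesis
  proof
    show "A' ` Z (Suc i) \<subseteq> Z' (Suc i)"
      using A' gmapD(2)[OF A'(1)] linmap_zero[OF gmapD(1)[OF A(1)]]
      by (auto simp: F.Z_Suc F'.Z_Suc)
  qed (use A' in auto)
qed

text \<open>\<open>homotopic_one \<dots> C\<close> says that \<open>C - 1\<close> is, up to cycles, a map that vanishes on cycles and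
  is zero modulo the irrelevant ideal: it plays the role of \<open>h D\<close> for a chain
  homotopy \<open>h\<close>.\<close>

definition homotopic_one :: "'v set \<Rightarrow> nat \<Rightarrow> (nat \<Rightarrow> int) \<Rightarrow> (nat \<Rightarrow> ('v, 'k::field) mpoly) set \<Rightarrow>
    ((nat \<Rightarrow> ('v, 'k) mpoly) \<Rightarrow> nat \<Rightarrow> ('v, 'k) mpoly) \<Rightarrow> bool" where
  "homotopic_one V n e Z C \<longleftrightarrow> (\<exists>H. gmap V n e n e H \<and> (\<forall>u\<in>Z. H u = 0) \<and>
     (\<forall>u\<in>fmod V n. \<forall>k. coef (H u k) 0 = 0) \<and> (\<forall>u\<in>fmod V n. C u - u - H u \<in> Z))"

lemma gmap_id: "gmap V n e n e (\<lambda>u. u)"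
  by (simp add: gmap_def linmap_def)

lemma gmap_diff:
  assumes "gmap V n e m e' A" "gmap V n e m e' B"
  shows "gmap V n e m e' (\<lambda>u. A u - B u)"
  using assms by (auto simp: gmap_def linmap_def fmod_minus homog_vec_def homogeneous_minus smul_def
    fun_eq_iff right_diff_distrib)

text \<open>\<open>C - 1 - H\<close> takes values in cycles, so it lifts through \<open>D i\<close>
  to some \<open>h\<close>. Then \<open>h\<close> after \<open>D i\<close> is the next correction:
  it kills cycles, and vanishes modulo the irrelevant ideal because \<open>D i\<close> does.\<close>

lemma (in resolution) homotopic_one_Suc:
  assumes "homotopic_one V (b i) (e i) (Z i) C" "gmap V (b i) (e i) (b i) (e i) C"
    "gmap V (b (Suc i)) (e (Suc i)) (b (Suc i)) (e (Suc i)) C'"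
    "\<And>u. u \<in> fmod V (b (Suc i)) \<Longrightarrow> D i (C' u) = C (D i u)"
  shows "homotopic_one V (b (Suc i)) (e (Suc i)) (Z (Suc i)) C'"
proof -
  from assms(1) obtain H where H: "gmap V (b i) (e i) (b i) (e i) H" "\<And>u. u \<in> Z i \<Longrightarrow> H u = 0"
    "\<And>u. u \<in> fmod V (b i) \<Longrightarrow> C u - u - H u \<in> Z i"
    by (auto simp: homotopic_one_def)
  have T: "gmap V (b i) (e i) (b i) (e i) (\<lambda>u. C u - u - H u)"
    by (intro gmap_diff gmap_id assms H)
  obtain h where h: "gmap V (b i) (e i) (b (Suc i)) (e (Suc i)) h"
    "\<And>u. u \<in> fmod V (b i) \<Longrightarrow> D i (h u) = C u - u - H u"
    using gmap_lift[OF D T] H(3)[OF fmod_unit_vec] unfolding exact by blast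
  show ?thesis
    unfolding homotopic_one_def
  proof (intro exI conjI ballI allI)
    show "gmap V (b (Suc i)) (e (Suc i)) (b (Suc i)) (e (Suc i)) (\<lambda>u. h (D i u))"
      by (rule gmap_comp[OF D h(1)])
  next
    fix u assume "u \<in> Z (Suc i)"
    then show "h (D i u) = 0" using linmap_zero[OF gmapD(1)[OF h(1)]] by (simp add: Z_Suc)
  next
    fix u :: "nat \<Rightarrow> ('v, 'k) mpoly" and k assume u: "u \<in> fmod V (b (Suc i))"
    have Du: "D i u \<in> fmod V (b i)" by (rule gmapD(2)[OF D u])
    have "coef (D i u l) 0 = 0" for l by (rule minimal[OF u])
    then show "coef (h (D i u) k) 0 = 0"
      by (simp add: linmap_expand[OF gmapD(1)[OF h(1)] Du] lookup_sum coef_mult_0)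
  next
    fix u :: "nat \<Rightarrow> ('v, 'k) mpoly" assume u: "u \<in> fmod V (b (Suc i))"
    have Du: "D i u \<in> fmod V (b i)" by (rule gmapD(2)[OF D u])
    have mem: "C' u - u - h (D i u) \<in> fmod V (b (Suc i))"
      by (intro fmod_minus gmapD(2)[OF assms(3)] gmapD(2)[OF h(1)] u Du)
    \<comment> \<open>\<open>D i u\<close> is a boundary, hence a cycle, where \<open>H\<close>
      vanishes; this is the only term left in \<open>D i (C' u - u - h (D i u))\<close>.\<close>
    have "H (D i u) = 0" by (rule H(2)) (use u exact in blast)
    then have "D i (C' u - u - h (D i u)) = 0"
      by (simp add: linmap_minus[OF gmapD(1)[OF D]] h(2)[OF Du] assms(4)[OF u])
    with mem show "C' u - u - h (D i u) \<in> Z (Suc i)" by (simp add: Z_Suc)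
  qed
qed

text \<open>Each unit vector with index in \<open>S\<close> is a combination of the columns of
  \<beta>, of which there are at most \<open>card S'\<close>, and unit vectors are
  independent.\<close>

lemma left_invertible_card_le:
  fixes \<alpha> \<beta> :: "nat \<Rightarrow> nat \<Rightarrow> 'k::field"
  assumes fin: "finite S" "finite S'"
    and inv: "\<And>j l. j \<in> S \<Longrightarrow> l \<in> S \<Longrightarrow> (\<Sum>k\<in>S'. \<beta> j k * \<alpha> k l) = (if j = l then 1 else 0)"
  shows "card S \<le> card S'"
proof -
  interpret vector_space "\<lambda>(c::'k) (f :: nat \<Rightarrow> 'k) i. c * f i"
    by unfold_locales (auto simp: fun_eq_iff algebra_simps)
  define \<delta> :: "nat \<Rightarrow> nat \<Rightarrow> 'k" where "\<delta> l = (\<lambda>j. if j = l then 1 else 0)" for l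
  define w where "w k = (\<lambda>j. if j \<in> S then \<beta> j k else 0)" for k
  have inj: "inj_on \<delta> S"
    by (rule inj_onI) (metis \<delta>_def zero_neq_one)
  have "\<delta> l \<in> span (w ` S')" if l: "l \<in> S" for l
  proof -
    have "\<delta> l = (\<Sum>k\<in>S'. (\<lambda>i. \<alpha> k l * w k i))"
    proof
      fix j show "\<delta> l j = (\<Sum>k\<in>S'. (\<lambda>i. \<alpha> k l * w k i)) j"
        using inv[of j l] l by (cases "j \<in> S") (auto simp: sum_fun_apply \<delta>_def w_def mult.commute)
    qed
    also have "\<dots> \<in> span (w ` S')" by (intro span_sum span_scale span_base imageI)
    finally show ?thesis .
  qed
  moreover have "independent (\<delta> ` S)"
  proof (rule independent_if_scalars_zero)
    fix f v assume f: "(\<Sum>x\<in>\<delta> ` S. (\<lambda>i. f x * x i)) = 0" "v \<in> \<delta> ` S"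
    then obtain l where l: "l \<in> S" "v = \<delta> l" by auto
    have "0 = (\<Sum>x\<in>\<delta> ` S. (\<lambda>i. f x * x i)) l" using f by simp
    also have "\<dots> = (\<Sum>m\<in>S. f (\<delta> m) * \<delta> m l)"
      by (simp add: sum_fun_apply sum.reindex[OF inj])
    also have "\<dots> = f v"
      using l fin by (simp add: \<delta>_def if_distrib[of "\<lambda>z. _ * z"] cong: if_cong)
    finally show "f v = 0" by simp
  qed (use fin in simp)
  ultimately have "card (\<delta> ` S) \<le> card (w ` S')"
    using independent_span_bound[of "w ` S'" "\<delta> ` S"] fin by auto
  also have "\<dots> \<le> card S'" by (rule card_image_le[OF fin(2)])
  finally show ?thesis by (simp add: card_image[OF inj])
qed

text \<open>An entry of \<open>A\<close> between generators of different degrees is homogeneous of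
  nonzero degree and has no constant term. The constant matrices therefore split into one block per
  degree, and each block of \<open>A\<close> has that of \<open>B\<close> as left inverse.\<close>

lemma card_degree_le:
  fixes V :: "'v set"
  assumes A: "gmap V n e n' e' A" and B: "gmap V n' e' n e B"
    and one: "\<And>u k. u \<in> fmod V n \<Longrightarrow> coef (B (A u) k) 0 = (coef (u k) 0 :: 'k::field)"
  shows "card {k. k < n \<and> e k = j} \<le> card {k. k < n' \<and> e' k = j}"
proof (rule left_invertible_card_le)
  fix i l assume i: "i \<in> {k. k < n \<and> e k = j}" and l: "l \<in> {k. k < n \<and> e k = j}"
  let ?\<beta> = "\<lambda>i k. coef (B (unit_vec k) i) 0" and ?\<alpha> = "\<lambda>k l. coef (A (unit_vec l) k) (0 :: 'v \<Rightarrow>\<^sub>0 nat)"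
  have Al: "A (unit_vec l) \<in> fmod V n'" "homog_vec e' (e l) (A (unit_vec l))"
    using gmap_unit_vec[OF A] l by auto
  have zero: "?\<alpha> k l = 0" if "e' k \<noteq> j" for k
    by (rule coef_0_homogeneous[of "e l - e' k"]) (use Al(2) that l in \<open>auto simp: homog_vec_def\<close>)
  have "(if i = l then 1 else 0) = coef (unit_vec l i) (0 :: 'v \<Rightarrow>\<^sub>0 nat)"
    by (simp add: unit_vec_def coef_one_0)
  also have "\<dots> = coef (B (A (unit_vec l)) i) 0"
    using one[OF fmod_unit_vec] l by simp
  also have "\<dots> = (\<Sum>k<n'. ?\<beta> i k * ?\<alpha> k l)"
    by (simp add: linmap_expand[OF gmapD(1)[OF B] Al(1)] lookup_sum coef_mult_0 mult.commute)
  also have "\<dots> = (\<Sum>k | k < n' \<and> e' k = j. ?\<beta> i k * ?\<alpha> k l)"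
    by (rule sum.mono_neutral_right) (auto simp: zero)
  finally show "(\<Sum>k | k < n' \<and> e' k = j. ?\<beta> i k * ?\<alpha> k l) = (if i = l then 1 else 0)" by simp
qed auto

lemma homotopic_one_coef_0:
  assumes "homotopic_one V n e Z C" "\<And>v k. v \<in> Z \<Longrightarrow> coef (v k) 0 = 0" "u \<in> fmod V n"
  shows "coef (C u k) 0 = coef (u k) 0"
proof -
  from assms(1) obtain H where H: "\<And>u k. u \<in> fmod V n \<Longrightarrow> coef (H u k) 0 = 0"
    "\<And>u. u \<in> fmod V n \<Longrightarrow> C u - u - H u \<in> Z"
    unfolding homotopic_one_def by blast
  have "coef ((C u - u - H u) k) 0 = 0" by (intro assms(2) H(2) assms(3))
  then show ?thesis by (simp add: lookup_minus H(1)[OF assms(3)])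
qed

text \<open>The start of a chain map. As the augmentations end in R/I, they can be matched modulo
  \<open>I\<close> only; since \<open>I\<close> is homogeneous, the preimage of \<open>g l\<close>
  may be replaced by its component of degree \<open>e 0 l\<close>.\<close>

lemma augmentation_lift:
  fixes I :: "('v, 'k::field) mpoly set"
  assumes I: "ideal I (poly_ring V)" and hI: "\<And>p d. p \<in> I \<Longrightarrow> hcomp d p \<in> I"
    and F: "resolution V I b e g D" and F': "resolution V I b' e' g' D'"
  obtains A where "gmap V (b 0) (e 0) (b' 0) (e' 0) A"
    "\<And>u. u \<in> fmod V (b 0) \<Longrightarrow> aug (b' 0) g' (A u) - aug (b 0) g u \<in> I"
proof -
  note g = resolution.g[OF F] and g' = resolution.g[OF F']
  have "\<exists>a\<in>fmod V (b' 0). homog_vec (e' 0) (e 0 l) a \<and> aug (b' 0) g' a - g l \<in> I" if l: "l < b 0" for l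
  proof -
    obtain v where v: "v \<in> fmod V (b' 0)" "aug (b' 0) g' v - g l \<in> I"
      using resolution.surj[OF F', of "g l"] g[OF l] by blast
    have "hcomp (e 0 l) (aug (b' 0) g' v - g l) = aug (b' 0) g' (hcomp_vec (e' 0) (e 0 l) v) - g l"
      using g' g[OF l] by (simp add: hcomp_minus aug_hcomp_vec hcomp_homogeneous_same)
    then show ?thesis
      using hI[OF v(2), of "e 0 l"] hcomp_vec_fmod[OF v(1)] homog_vec_hcomp_vec by metis
  qed
  then obtain a where a: "\<And>l. l < b 0 \<Longrightarrow> a l \<in> fmod V (b' 0)"
    "\<And>l. l < b 0 \<Longrightarrow> homog_vec (e' 0) (e 0 l) (a l)" "\<And>l. l < b 0 \<Longrightarrow> aug (b' 0) g' (a l) - g l \<in> I"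
    by metis
  show ?thesis
  proof
    show "gmap V (b 0) (e 0) (b' 0) (e' 0) (lin_of (b 0) a)"
      by (rule gmap_lin_of) (use a in auto)
    fix u :: "nat \<Rightarrow> ('v, 'k) mpoly" assume u: "u \<in> fmod V (b 0)"
    have "aug (b' 0) g' (lin_of (b 0) a u) = (\<Sum>k<b' 0. \<Sum>l<b 0. g' k * (u l * a l k))"
      by (simp add: aug_def lin_of_def sum_distrib_left)
    also have "\<dots> = (\<Sum>l<b 0. \<Sum>k<b' 0. g' k * (u l * a l k))" by (rule sum.swap)
    also have "\<dots> = (\<Sum>l<b 0. u l * aug (b' 0) g' (a l))"
      by (simp add: aug_def sum_distrib_left mult.left_commute)
    finally have "aug (b' 0) g' (lin_of (b 0) a u) - aug (b 0) g u
        = (\<Sum>l<b 0. u l * (aug (b' 0) g' (a l) - g l))"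
      by (simp add: aug_def[of "b 0" g] sum_subtractf right_diff_distrib mult.commute)
    also have "\<dots> \<in> I"
      by (rule ideal_poly_ring_sum[OF I], rule ideal_poly_ringD(4)[OF I])
        (use a(3) u in \<open>auto simp: fmod_def\<close>)
    finally show "aug (b' 0) g' (lin_of (b 0) a u) - aug (b 0) g u \<in> I" .
  qed
qed

theorem resolution_card_degree_eq:
  fixes I :: "('v, 'k::field) mpoly set"
  assumes I: "ideal I (poly_ring V)" and hI: "\<And>p d. p \<in> I \<Longrightarrow> hcomp d p \<in> I"
    and F: "resolution V I b e g D" and F': "resolution V I b' e' g' D'"
  shows "card {k. k < b i \<and> e i k = j} = card {k. k < b' i \<and> e' i k = j}"
proof -
  define Z where "Z = cycles V b D (\<lambda>u. aug (b 0) g u \<in> I)"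
  define Z' where "Z' = cycles V b' D' (\<lambda>u. aug (b' 0) g' u \<in> I)"
  interpret F: resolution V I b e g D Z unfolding Z_def by fact
  interpret F': resolution V I b' e' g' D' Z' unfolding Z'_def by fact
  note lift = lift_chain_map[OF F F', folded Z_def Z'_def]
  note lift' = lift_chain_map[OF F' F, folded Z_def Z'_def]
  note I_add = ideal_poly_ringD(3)[OF I]
  have I_trans: "x \<in> I" if "x - y \<in> I" "y \<in> I" for x y
    using I_add[OF that] by simp
  have "\<exists>A B. gmap V (b i) (e i) (b' i) (e' i) A \<and> gmap V (b' i) (e' i) (b i) (e i) B \<and>
      A ` Z i \<subseteq> Z' i \<and> B ` Z' i \<subseteq> Z i \<and>
      homotopic_one V (b i) (e i) (Z i) (\<lambda>u. B (A u)) \<and> homotopic_one V (b' i) (e' i) (Z' i) (\<lambda>u. A (B u))"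
  proof (induction i)
    case 0
    obtain A where A: "gmap V (b 0) (e 0) (b' 0) (e' 0) A"
      "\<And>u. u \<in> fmod V (b 0) \<Longrightarrow> aug (b' 0) g' (A u) - aug (b 0) g u \<in> I"
      using augmentation_lift[OF I hI F F'] by blast
    obtain B where B: "gmap V (b' 0) (e' 0) (b 0) (e 0) B"
      "\<And>u. u \<in> fmod V (b' 0) \<Longrightarrow> aug (b 0) g (B u) - aug (b' 0) g' u \<in> I"
      using augmentation_lift[OF I hI F' F] by blast
    have 1: "A ` Z 0 \<subseteq> Z' 0"
      using A(2) gmapD(2)[OF A(1)] by (auto simp: F.Z_0 F'.Z_0 intro: I_trans)
    have 2: "B ` Z' 0 \<subseteq> Z 0"
      using B(2) gmapD(2)[OF B(1)] by (auto simp: F.Z_0 F'.Z_0 intro: I_trans)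
    \<comment> \<open>Both augmentations agree modulo \<open>I\<close>, so in degree 0 the
      composites differ from the identity by cycles alone and the correction \<open>H\<close> can be
      0.\<close>
    have zero: "gmap V n e n e (\<lambda>_. 0)" for n e
      using fmod_zero by (auto simp: gmap_def linmap_def homog_vec_def smul_def fun_eq_iff)
    have 3: "homotopic_one V (b 0) (e 0) (Z 0) (\<lambda>u. B (A u))"
      unfolding homotopic_one_def
    proof (intro exI[of _ "\<lambda>_. 0"] conjI ballI)
      fix u :: "nat \<Rightarrow> ('v, 'k) mpoly" assume u: "u \<in> fmod V (b 0)"
      note Au = gmapD(2)[OF A(1) u]
      show "B (A u) - u - 0 \<in> Z 0"
        using I_add[OF B(2)[OF Au] A(2)[OF u]] fmod_minus[OF gmapD(2)[OF B(1) Au] u]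
        by (simp add: F.Z_0 aug_minus)
    qed (simp_all add: zero)
    have 4: "homotopic_one V (b' 0) (e' 0) (Z' 0) (\<lambda>u. A (B u))"
      unfolding homotopic_one_def
    proof (intro exI[of _ "\<lambda>_. 0"] conjI ballI)
      fix u :: "nat \<Rightarrow> ('v, 'k) mpoly" assume u: "u \<in> fmod V (b' 0)"
      note Bu = gmapD(2)[OF B(1) u]
      show "A (B u) - u - 0 \<in> Z' 0"
        using I_add[OF A(2)[OF Bu] B(2)[OF u]] fmod_minus[OF gmapD(2)[OF A(1) Bu] u]
        by (simp add: F'.Z_0 aug_minus)
    qed (simp_all add: zero)
    show ?case using A(1) B(1) 1 2 3 4 by blast
  next
    case (Suc i)
    then obtain A B where AB: "gmap V (b i) (e i) (b' i) (e' i) A" "gmap V (b' i) (e' i) (b i) (e i) B"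
      "A ` Z i \<subseteq> Z' i" "B ` Z' i \<subseteq> Z i"
      "homotopic_one V (b i) (e i) (Z i) (\<lambda>u. B (A u))" "homotopic_one V (b' i) (e' i) (Z' i) (\<lambda>u. A (B u))"
      by blast
    obtain A' where A': "gmap V (b (Suc i)) (e (Suc i)) (b' (Suc i)) (e' (Suc i)) A'"
      "A' ` Z (Suc i) \<subseteq> Z' (Suc i)"
      "\<And>u. u \<in> fmod V (b (Suc i)) \<Longrightarrow> D' i (A' u) = A (D i u)"
      using lift[OF AB(1,3)] by blast
    obtain B' where B': "gmap V (b' (Suc i)) (e' (Suc i)) (b (Suc i)) (e (Suc i)) B'"
      "B' ` Z' (Suc i) \<subseteq> Z (Suc i)"
      "\<And>u. u \<in> fmod V (b' (Suc i)) \<Longrightarrow> D i (B' u) = B (D' i u)"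
      using lift'[OF AB(2,4)] by blast
    have "homotopic_one V (b (Suc i)) (e (Suc i)) (Z (Suc i)) (\<lambda>u. B' (A' u))"
      by (rule F.homotopic_one_Suc[OF AB(5) gmap_comp[OF AB(1,2)] gmap_comp[OF A'(1) B'(1)]])
        (simp add: B'(3) A'(3) gmapD(2)[OF A'(1)])
    moreover have "homotopic_one V (b' (Suc i)) (e' (Suc i)) (Z' (Suc i)) (\<lambda>u. A' (B' u))"
      by (rule F'.homotopic_one_Suc[OF AB(6) gmap_comp[OF AB(2,1)] gmap_comp[OF B'(1) A'(1)]])
        (simp add: B'(3) A'(3) gmapD(2)[OF B'(1)])
    ultimately show ?case using A'(1,2) B'(1,2) by blast
  qed
  then obtain A B where AB: "gmap V (b i) (e i) (b' i) (e' i) A" "gmap V (b' i) (e' i) (b i) (e i) B"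
    "homotopic_one V (b i) (e i) (Z i) (\<lambda>u. B (A u))" "homotopic_one V (b' i) (e' i) (Z' i) (\<lambda>u. A (B u))"
    by blast
  \<comment> \<open>By exactness cycles are boundaries, and by minimality boundaries have no
    constant terms, so both composites preserve constant coefficients.\<close>
  have ZC: "coef (v k) 0 = 0" if "v \<in> Z i" for v k
    using that F.minimal unfolding F.exact by blast
  have ZC': "coef (v k) 0 = 0" if "v \<in> Z' i" for v k
    using that F'.minimal unfolding F'.exact by blast
  have 1: "coef (B (A u) k) 0 = coef (u k) 0" if "u \<in> fmod V (b i)" for u k
    by (rule homotopic_one_coef_0[OF AB(3) _ that]) (rule ZC)
  have 2: "coef (A (B u) k) 0 = coef (u k) 0" if "u \<in> fmod V (b' i)" for u k
    by (rule homotopic_one_coef_0[OF AB(4) _ that]) (rule ZC')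
  show ?thesis
    by (rule antisym[OF card_degree_le[OF AB(1,2) 1] card_degree_le[OF AB(2,1) 2]])
qed


section \<open>Linear resolutions and mapping cones\<close>

text \<open>Shifts of a \<open>d\<close>-linear resolution of R/J: R itself in homological degree 0,
  and for i >= 1 the degree i + d - 1, beginning with generators of J in degree
  \<open>d\<close>.\<close>

definition lin_shift :: "int \<Rightarrow> nat \<Rightarrow> int" where
  "lin_shift d i = (if i = 0 then 0 else int i + d - 1)"

text \<open>One shift per homological degree and augmentation 1, which is why coordinate 0 takes the
  place of \<open>aug\<close>. Minimality is recovered from the shifts in
  \<open>linear_resolution_imp_resolution\<close>.\<close>

locale linear_resolution =
  fixes V :: "'v set" and d :: int and J :: "('v, 'k::field) mpoly set" and b :: "nat \<Rightarrow> nat"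
    and D :: "nat \<Rightarrow> (nat \<Rightarrow> ('v, 'k) mpoly) \<Rightarrow> nat \<Rightarrow> ('v, 'k) mpoly"
    and Z :: "nat \<Rightarrow> (nat \<Rightarrow> ('v, 'k) mpoly) set"
  defines "Z \<equiv> cycles V b D (\<lambda>u. u 0 \<in> J)"
  assumes b_0: "b 0 = 1"
    and D: "gmap V (b (Suc i)) (\<lambda>_. lin_shift d (Suc i)) (b i) (\<lambda>_. lin_shift d i) (D i)"
    and exact: "Z i = D i ` fmod V (b (Suc i))"
begin

lemma Z_0: "Z 0 = {u \<in> fmod V (b 0). u 0 \<in> J}"
  and Z_Suc: "Z (Suc i) = {u \<in> fmod V (b (Suc i)). D i u = 0}"
  by (simp_all add: Z_def cycles_def)

end

lemma lin_shift_diff_pos: "d \<ge> 1 \<Longrightarrow> lin_shift d (Suc i) - lin_shift d i \<noteq> 0"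
  by (auto simp: lin_shift_def)

text \<open>Consecutive shifts differ by 1, or by \<open>d\<close> at the start, so the entries of
  the differentials have positive degree and no constant term.\<close>

lemma linear_resolution_imp_resolution:
  assumes F: "linear_resolution V d J b D" and d: "d \<ge> 1" and J: "ideal J (poly_ring V)"
  shows "resolution V J b (\<lambda>i _. lin_shift d i) (\<lambda>_. 1) D"
proof -
  define Z where "Z = cycles V b D (\<lambda>u. u 0 \<in> J)"
  interpret linear_resolution V d J b D Z unfolding Z_def by fact
  have aug: "aug (b 0) (\<lambda>_. 1) u = u 0" for u :: "nat \<Rightarrow> ('a, 'b) mpoly"
    by (simp add: aug_def b_0)
  show ?thesis
  proof (unfold_locales, goal_cases)
    case 1
    then show ?case by (simp add: lin_shift_def PR_one)
  next
    case (2 c)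
    then have "(\<lambda>k. if k = 0 then c else 0) \<in> fmod V (b 0)"
      by (simp add: fmod_def b_0 PR_zero)
    then show ?case
      by (rule bexI[rotated]) (simp add: aug ideal_poly_ringD(2)[OF J])
  next
    case 3
    then show ?case by (rule D)
  next
    case (4 i)
    then show ?case using exact[of i] by (simp add: Z_def aug)
  next
    case (5 u i k)
    have "coef (D i (unit_vec l) k) 0 = 0" if "l < b (Suc i)" for l
      by (rule coef_0_homogeneous[OF _ lin_shift_diff_pos[OF d, of i]])
        (use gmap_unit_vec(2)[OF D that] in \<open>simp add: homog_vec_def\<close>)
    then show ?case
      by (simp add: linmap_expand[OF gmapD(1)[OF D] 5] lookup_sum coef_mult_0)
  qed
qed

section \<open>Block vectors and mapping cones\<close>

definition left_part :: "nat \<Rightarrow> (nat \<Rightarrow> 'a::zero) \<Rightarrow> nat \<Rightarrow> 'a" where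
  "left_part n w = (\<lambda>k. if k < n then w k else 0)"

definition right_part :: "nat \<Rightarrow> (nat \<Rightarrow> 'a) \<Rightarrow> nat \<Rightarrow> 'a" where
  "right_part n w = (\<lambda>k. w (k + n))"

definition append_vec :: "nat \<Rightarrow> (nat \<Rightarrow> 'a) \<Rightarrow> (nat \<Rightarrow> 'a) \<Rightarrow> nat \<Rightarrow> 'a" where
  "append_vec n u v = (\<lambda>k. if k < n then u k else v (k - n))"

lemma right_part_append_vec [simp]: "right_part n (append_vec n u v) = v"
  by (simp add: right_part_def append_vec_def)

lemma left_part_append_vec [simp]: "u \<in> fmod V n \<Longrightarrow> left_part n (append_vec n u v) = u"
  by (auto simp: left_part_def append_vec_def fmod_def)

lemma append_vec_parts [simp]: "append_vec n (left_part n w) (right_part n w) = w"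
  by (auto simp: left_part_def append_vec_def right_part_def)

lemma append_vec_eq_0_iff: "u \<in> fmod V n \<Longrightarrow> append_vec n u v = 0 \<longleftrightarrow> u = 0 \<and> v = 0"
proof
  assume u: "u \<in> fmod V n" and 0: "append_vec n u v = 0"
  have "u = left_part n 0" using left_part_append_vec[OF u, of v] 0 by simp
  moreover have "v = right_part n 0" using right_part_append_vec[of n u v] 0 by simp
  ultimately show "u = 0 \<and> v = 0" by (simp add: left_part_def right_part_def fun_eq_iff)
qed (simp add: append_vec_def fun_eq_iff)

lemma gmap_left_part: "gmap V (n + m) (\<lambda>_. s) n (\<lambda>_. s) (left_part n)"
  by (auto simp: gmap_def linmap_def fmod_def homog_vec_def left_part_def smul_def fun_eq_iff PR_zero)

lemma gmap_right_part: "gmap V (n + m) (\<lambda>_. s) m (\<lambda>_. s) (right_part n)"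
  by (auto simp: gmap_def linmap_def fmod_def homog_vec_def right_part_def smul_def fun_eq_iff)

lemma append_vec_fmod: "u \<in> fmod V n \<Longrightarrow> v \<in> fmod V m \<Longrightarrow> append_vec n u v \<in> fmod V (n + m)"
  by (auto simp: fmod_def append_vec_def)

lemma gmap_append_vec:
  assumes "gmap V p e n (\<lambda>_. s) A" "gmap V p e m (\<lambda>_. s) B"
  shows "gmap V p e (n + m) (\<lambda>_. s) (\<lambda>u. append_vec n (A u) (B u))"
  using assms by (auto simp: gmap_def linmap_def append_vec_fmod)
    (auto simp: append_vec_def smul_def fun_eq_iff homog_vec_def)

lemma gmap_add:
  assumes "gmap V n e m e' A" "gmap V n e m e' B"
  shows "gmap V n e m e' (\<lambda>u. A u + B u)"
  using assms by (auto simp: gmap_def linmap_def fmod_add homog_vec_def homogeneous_add smul_def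
    fun_eq_iff distrib_left)

lemma gmap_uminus:
  assumes "gmap V n e m e' A"
  shows "gmap V n e m e' (\<lambda>u. - A u)"
  using assms by (auto simp: gmap_def linmap_def fmod_uminus homog_vec_def homogeneous_uminus smul_def
    fun_eq_iff)

lemma gmap_shift:
  assumes "gmap V n (\<lambda>_. s) m (\<lambda>_. t) A"
  shows "gmap V n (\<lambda>_. s + a) m (\<lambda>_. t + a) A"
  unfolding gmap_def
proof (intro conjI ballI allI impI gmapD(1)[OF assms] gmapD(2)[OF assms])
  fix \<delta> and u :: "nat \<Rightarrow> ('a, 'b) mpoly" assume u: "u \<in> fmod V n" "homog_vec (\<lambda>_. s + a) \<delta> u"
  then have "homog_vec (\<lambda>_. s) (\<delta> - a) u" by (simp add: homog_vec_def algebra_simps)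
  from gmapD(3)[OF assms u(1) this] show "homog_vec (\<lambda>_. t + a) \<delta> (A u)"
    by (simp add: homog_vec_def algebra_simps)
qed

lemma fmod_smul: "c \<in> PR V \<Longrightarrow> u \<in> fmod V n \<Longrightarrow> smul c u \<in> fmod V n"
  by (simp add: fmod_def smul_def PR_mult)

lemma gmap_smul:
  assumes "c \<in> PR V" "homogeneous a c"
  shows "gmap V n (\<lambda>_. s + a) n (\<lambda>_. s) (smul c)"
  unfolding gmap_def
proof (intro conjI ballI allI impI)
  show "linmap (smul c)" by (simp add: linmap_def smul_def fun_eq_iff distrib_left mult.left_commute)
next
  fix \<delta> and u :: "nat \<Rightarrow> ('a, 'b) mpoly" assume u: "u \<in> fmod V n" "homog_vec (\<lambda>_. s + a) \<delta> u"
  then have "homogeneous (a + (\<delta> - (s + a))) (c * u k)" for k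
    by (intro homogeneous_mult assms(2)) (simp add: homog_vec_def)
  then show "homog_vec (\<lambda>_. s) \<delta> (smul c u)" by (simp add: homog_vec_def smul_def)
qed (use assms(1) in \<open>simp add: fmod_smul\<close>)

text \<open>A lift to resolutions of multiplication by \<open>x\<close>, seen as a map from
  \<open>R/(J : x)\<close> to \<open>R/J\<close>.\<close>

lemma colon_chain_map:
  assumes F: "linear_resolution V d J b D" and G: "linear_resolution V 1 K c E"
    and x: "x \<in> PR V" "homogeneous d x" and K: "K = {p \<in> PR V. x * p \<in> J}"
  obtains T where "T 0 = smul x"
    "\<And>i. gmap V (c i) (\<lambda>_. int i + d) (b i) (\<lambda>_. lin_shift d i) (T i)"
    "\<And>i u. u \<in> fmod V (c (Suc i)) \<Longrightarrow> D i (T (Suc i) u) = T i (E i u)"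
proof -
  define ZF where "ZF = cycles V b D (\<lambda>u. u 0 \<in> J)"
  define ZG where "ZG = cycles V c E (\<lambda>u. u 0 \<in> K)"
  interpret F: linear_resolution V d J b D ZF unfolding ZF_def by fact
  interpret G: linear_resolution V 1 K c E ZG unfolding ZG_def by fact
  \<comment> \<open>The invariant that cycles go to cycles makes the next lift possible; in degree 0
    it is the colon condition on \<open>K\<close>.\<close>
  define P where "P i t \<longleftrightarrow> gmap V (c i) (\<lambda>_. int i + d) (b i) (\<lambda>_. lin_shift d i) t \<and>
    t ` ZG i \<subseteq> ZF i \<and> (i = 0 \<longrightarrow> t = smul x)" for i t
  define Q where "Q i t t' \<longleftrightarrow> (\<forall>u\<in>fmod V (c (Suc i)). D i (t' u) = t (E i u))" for i t t'
  have "\<exists>T. \<forall>i. P i (T i) \<and> Q i (T i) (T (Suc i))"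
  proof (rule dependent_nat_choice)
    have "gmap V 1 (\<lambda>_. 0 + d) 1 (\<lambda>_. 0) (smul x)" by (rule gmap_smul[OF x])
    moreover have "smul x ` ZG 0 \<subseteq> ZF 0"
      using fmod_smul[OF x(1)] by (auto simp: G.Z_0 F.Z_0 F.b_0 G.b_0 K smul_def)
    ultimately show "\<exists>t. P 0 t" by (auto simp: P_def lin_shift_def F.b_0 G.b_0)
  next
    fix t i assume "P i t"
    then have t: "gmap V (c i) (\<lambda>_. int i + d) (b i) (\<lambda>_. lin_shift d i) t" "t ` ZG i \<subseteq> ZF i"
      by (auto simp: P_def)
    \<comment> \<open>Twisting by \<open>d\<close>, the degree of \<open>x\<close>, turns the shifts
      \<open>i\<close> of a 1-linear resolution into \<open>i + d\<close>.\<close>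
    have "gmap V (c (Suc i)) (\<lambda>_. int (Suc i) + d) (c i) (\<lambda>_. int i + d) (E i)"
      using gmap_shift[OF G.D[of i], of d] by (auto simp: lin_shift_def algebra_simps split: if_splits)
    note tE = gmap_comp[OF this t(1)]
    have "t (E i (unit_vec l)) \<in> D i ` fmod V (b (Suc i))" if "l < c (Suc i)" for l
      using t(2) fmod_unit_vec[OF that] unfolding F.exact G.exact by blast
    from gmap_lift[OF F.D tE this]
    obtain t' where t': "gmap V (c (Suc i)) (\<lambda>_. int (Suc i) + d) (b (Suc i)) (\<lambda>_. lin_shift d (Suc i)) t'"
      "\<And>u. u \<in> fmod V (c (Suc i)) \<Longrightarrow> D i (t' u) = t (E i u)" by blast
    have "t' ` ZG (Suc i) \<subseteq> ZF (Suc i)"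
      using t'(2) gmapD(2)[OF t'(1)] linmap_zero[OF gmapD(1)[OF t(1)]]
      by (auto simp: F.Z_Suc G.Z_Suc)
    then show "\<exists>t'. P (Suc i) t' \<and> Q i t t'" using t' by (auto simp: P_def Q_def)
  qed
  then obtain T where PT: "\<And>i. P i (T i)" and QT: "\<And>i. Q i (T i) (T (Suc i))" by blast
  show ?thesis
  proof
    show "T 0 = smul x" using PT[of 0] by (simp add: P_def)
    show "gmap V (c i) (\<lambda>_. int i + d) (b i) (\<lambda>_. lin_shift d i) (T i)" for i
      using PT[of i] by (simp add: P_def)
    show "D i (T (Suc i) u) = T i (E i u)" if "u \<in> fmod V (c (Suc i))" for i u
      using QT[of i] that by (simp add: Q_def)
  qed
qed

text \<open>Multiplication by \<open>x\<close> gives the exact sequence 0 -> (R/K)(-d) -> R/J ->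
  R/J' -> 0. The twisted generators of \<open>G\<close> in homological degree \<open>i\<close> have
  degree \<open>i + d = lin_shift d (Suc i)\<close>, and the cone places them in homological degree
  \<open>i + 1\<close>, so it is linear again.\<close>

lemma mapping_cone:
  assumes F: "linear_resolution V d J b D" and G: "linear_resolution V 1 K c E"
    and J: "ideal J (poly_ring V)"
    and x: "x \<in> PR V" "homogeneous d x" and K: "K = {p \<in> PR V. x * p \<in> J}"
    and J': "J' = {p. \<exists>q\<in>J. \<exists>a\<in>PR V. p = q + x * a}"
  shows "\<exists>D'. linear_resolution V d J' (case_nat 1 (\<lambda>i. b (Suc i) + c i)) D'"
proof -
  define ZF where "ZF = cycles V b D (\<lambda>u. u 0 \<in> J)"
  define ZG where "ZG = cycles V c E (\<lambda>u. u 0 \<in> K)"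
  interpret F: linear_resolution V d J b D ZF unfolding ZF_def by fact
  interpret G: linear_resolution V 1 K c E ZG unfolding ZG_def by fact
  obtain T where T_0: "T 0 = smul x"
    and T: "\<And>i. gmap V (c i) (\<lambda>_. int i + d) (b i) (\<lambda>_. lin_shift d i) (T i)"
    and comm: "\<And>i u. u \<in> fmod V (c (Suc i)) \<Longrightarrow> D i (T (Suc i) u) = T i (E i u)"
    using colon_chain_map[OF F G x K] by blast
  have E: "gmap V (c (Suc i)) (\<lambda>_. int (Suc i) + d) (c i) (\<lambda>_. int i + d) (E i)" for i
    using gmap_shift[OF G.D[of i], of d] by (auto simp: lin_shift_def algebra_simps split: if_splits)
  have D: "gmap V (b (Suc i)) (\<lambda>_. int i + d) (b i) (\<lambda>_. lin_shift d i) (D i)" for i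
    using F.D[of i] by (simp add: lin_shift_def)
  define B where "B = case_nat 1 (\<lambda>i. b (Suc i) + c i)"
  have B_0: "B 0 = 1" and B_Suc: "B (Suc i) = b (Suc i) + c i" for i by (simp_all add: B_def)
  \<comment> \<open>\<open>L\<close> is the block with values in the resolution of R/J; the other
    block is \<open>- E\<close>, with the sign that makes consecutive maps compose to 0. In degree 0
    \<open>G\<close> contributes nothing, so \<open>L\<close> is the whole map.\<close>
  define L where "L i w = D i (left_part (b (Suc i)) w) + T i (right_part (b (Suc i)) w)" for i w
  define D' where "D' i = (case i of 0 \<Rightarrow> L 0
    | Suc j \<Rightarrow> (\<lambda>w. append_vec (b (Suc j)) (L (Suc j) w) (- E j (right_part (b (Suc (Suc j))) w))))" for i
  have L: "gmap V (B (Suc i)) (\<lambda>_. int i + d) (b i) (\<lambda>_. lin_shift d i) (L i)" for i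
    unfolding L_def[abs_def] B_Suc
    by (intro gmap_add gmap_comp[OF gmap_left_part D] gmap_comp[OF gmap_right_part T])
  have left: "left_part (b (Suc i)) w \<in> fmod V (b (Suc i))" and right: "right_part (b (Suc i)) w \<in> fmod V (c i)"
    if "w \<in> fmod V (B (Suc i))" for w i
    using that gmapD(2)[OF gmap_left_part] gmapD(2)[OF gmap_right_part] unfolding B_Suc by blast+
  have gD': "gmap V (B (Suc i)) (\<lambda>_. lin_shift d (Suc i)) (B i) (\<lambda>_. lin_shift d i) (D' i)" for i
  proof (cases i)
    case 0
    then show ?thesis using L[of 0] by (simp add: D'_def B_0 F.b_0 lin_shift_def)
  next
    case (Suc j)
    have "gmap V (B (Suc (Suc j))) (\<lambda>_. int (Suc j) + d) (b (Suc j) + c j) (\<lambda>_. int j + d)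
      (\<lambda>w. append_vec (b (Suc j)) (L (Suc j) w) (- E j (right_part (b (Suc (Suc j))) w)))"
    proof (rule gmap_append_vec)
      show "gmap V (B (Suc (Suc j))) (\<lambda>_. int (Suc j) + d) (b (Suc j)) (\<lambda>_. int j + d) (L (Suc j))"
        using L[of "Suc j"] by (simp add: lin_shift_def)
      show "gmap V (B (Suc (Suc j))) (\<lambda>_. int (Suc j) + d) (c j) (\<lambda>_. int j + d)
          (\<lambda>w. - E j (right_part (b (Suc (Suc j))) w))"
        unfolding B_Suc by (intro gmap_uminus gmap_comp[OF gmap_right_part E])
    qed
    then show ?thesis by (simp add: D'_def Suc B_Suc[of j] lin_shift_def add.assoc)
  qed
  have complex: "L i (D' (Suc i) w) = 0" if w: "w \<in> fmod V (B (Suc (Suc i)))" for i w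
  proof -
    note r = right[OF w] and l = left[OF w]
    have "D i (L (Suc i) w) = T i (E i (right_part (b (Suc (Suc i))) w))"
    proof -
      have "D (Suc i) (left_part (b (Suc (Suc i))) w) \<in> ZF (Suc i)" using l F.exact by blast
      then have "D i (D (Suc i) (left_part (b (Suc (Suc i))) w)) = 0" by (simp add: F.Z_Suc)
      then show ?thesis by (simp add: L_def linmap_add[OF gmapD(1)[OF F.D]] comm[OF r])
    qed
    moreover have "left_part (b (Suc i)) (D' (Suc i) w) = L (Suc i) w"
      using left_part_append_vec[OF gmapD(2)[OF L w]] by (simp add: D'_def)
    ultimately show ?thesis
      by (simp add: L_def[of i] D'_def linmap_uminus[OF gmapD(1)[OF T]])
  qed
  \<comment> \<open>For \<open>w = (u, v)\<close> with \<open>v = E i z\<close>, the element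
    \<open>y = u + T (Suc i) z\<close> is a cycle, so \<open>y = D (Suc i) a\<close>; then
    \<open>(a, - z)\<close> is a preimage of \<open>w\<close>.\<close>
  have exact: "\<exists>w'\<in>fmod V (B (Suc (Suc i))). w = D' (Suc i) w'"
    if w: "w \<in> fmod V (B (Suc i))" "L i w = 0" "right_part (b (Suc i)) w \<in> ZG i" for i w
  proof -
    obtain z where z: "z \<in> fmod V (c (Suc i))" "right_part (b (Suc i)) w = E i z"
      using w(3) unfolding G.exact by blast
    define y where "y = left_part (b (Suc i)) w + T (Suc i) z"
    have y: "y \<in> fmod V (b (Suc i))"
      unfolding y_def by (intro fmod_add left[OF w(1)] gmapD(2)[OF T z(1)])
    have "D i y = L i w"
      by (simp add: y_def L_def linmap_add[OF gmapD(1)[OF F.D]] comm[OF z(1)] z(2))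
    then have "y \<in> ZF (Suc i)" using w(2) y by (simp add: F.Z_Suc)
    then obtain a where a: "a \<in> fmod V (b (Suc (Suc i)))" "y = D (Suc i) a"
      unfolding F.exact by blast
    show ?thesis
    proof
      show "append_vec (b (Suc (Suc i))) a (- z) \<in> fmod V (B (Suc (Suc i)))"
        unfolding B_Suc by (rule append_vec_fmod[OF a(1) fmod_uminus[OF z(1)]])
      have "L (Suc i) (append_vec (b (Suc (Suc i))) a (- z)) = y - T (Suc i) z"
        by (simp add: L_def left_part_append_vec[OF a(1)] linmap_uminus[OF gmapD(1)[OF T]] flip: a(2))
      also have "\<dots> = left_part (b (Suc i)) w" by (simp add: y_def)
      finally have "D' (Suc i) (append_vec (b (Suc (Suc i))) a (- z))
          = append_vec (b (Suc i)) (left_part (b (Suc i)) w) (right_part (b (Suc i)) w)"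
        by (simp add: D'_def linmap_uminus[OF gmapD(1)[OF E]] z(2))
      then show "w = D' (Suc i) (append_vec (b (Suc (Suc i))) a (- z))" by simp
    qed
  qed
  \<comment> \<open>The image of \<open>D 0\<close> is \<open>J\<close> and \<open>T 0\<close>
    multiplies by \<open>x\<close>, so the image of \<open>L 0\<close> is J + xR.\<close>
  have J'_eq: "{u \<in> fmod V 1. u 0 \<in> J'} = L 0 ` fmod V (B (Suc 0))"
  proof (intro equalityI subsetI)
    fix u assume "u \<in> {u \<in> fmod V 1. u 0 \<in> J'}"
    then obtain q a where u: "u \<in> fmod V 1" and q: "q \<in> J" "a \<in> PR V" "u 0 = q + x * a"
      by (auto simp: J')
    have qV: "q \<in> PR V" using ideal_poly_ringD(1)[OF J] q(1) by blast
    have fm: "(\<lambda>k. if k = 0 then p else 0) \<in> fmod V 1" if "p \<in> PR V" for p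
      using that by (simp add: fmod_def PR_zero)
    have "(\<lambda>k. if k = 0 then q else 0) \<in> ZF 0" using fm[OF qV] q(1) by (simp add: F.Z_0 F.b_0)
    then obtain v where v: "v \<in> fmod V (b (Suc 0))" "(\<lambda>k. if k = 0 then q else 0) = D 0 v"
      unfolding F.exact by auto
    have "append_vec (b (Suc 0)) v (\<lambda>k. if k = 0 then a else 0) \<in> fmod V (B (Suc 0))"
      using append_vec_fmod[OF v(1) fm[OF q(2)]] by (simp add: B_def G.b_0)
    moreover have "u = L 0 (append_vec (b (Suc 0)) v (\<lambda>k. if k = 0 then a else 0))"
      using u q(3) by (auto simp: L_def T_0 left_part_append_vec[OF v(1)] smul_def fmod_def fun_eq_iff simp flip: v(2))
    ultimately show "u \<in> L 0 ` fmod V (B (Suc 0))" by blast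
  next
    fix u assume "u \<in> L 0 ` fmod V (B (Suc 0))"
    then obtain w where w: "w \<in> fmod V (B (Suc 0))" "u = L 0 w" by auto
    have u: "u \<in> fmod V 1" using gmapD(2)[OF L w(1)] w(2) by (simp add: F.b_0)
    have "D 0 (left_part (b (Suc 0)) w) \<in> ZF 0" using left[OF w(1)] F.exact by auto
    then have "D 0 (left_part (b (Suc 0)) w) 0 \<in> J" by (simp add: F.Z_0)
    moreover have "right_part (b (Suc 0)) w 0 \<in> PR V" using right[OF w(1)] by (simp add: fmod_def)
    ultimately show "u \<in> {u \<in> fmod V 1. u 0 \<in> J'}"
      using u by (auto simp: J' w(2) L_def T_0 smul_def)
  qed
  have "linear_resolution V d J' B D'"
  proof (unfold_locales, goal_cases)
    case 1
    then show ?case by (rule B_0)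
  next
    case 2
    then show ?case by (rule gD')
  next
    case (3 i)
    show ?case
    proof (cases i)
      case 0
      then show ?thesis using J'_eq by (simp add: cycles_def B_0 D'_def)
    next
      case (Suc j)
      have "{u \<in> fmod V (B (Suc j)). D' j u = 0} = D' (Suc j) ` fmod V (B (Suc (Suc j)))"
      proof (intro equalityI subsetI)
        fix w assume "w \<in> {u \<in> fmod V (B (Suc j)). D' j u = 0}"
        then have w: "w \<in> fmod V (B (Suc j))" "D' j w = 0" by auto
        note r = right[OF w(1)] and l = left[OF w(1)]
        \<comment> \<open>\<open>exact\<close> needs the right part to be a cycle. For
          \<open>j = 0\<close> this is where the colon ideal enters: \<open>L 0 w = 0\<close> puts
          \<open>x\<close> times the right part into \<open>J\<close>.\<close>
        have "L j w = 0 \<and> right_part (b (Suc j)) w \<in> ZG j"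
        proof (cases j)
          case 0
          let ?v = "D 0 (left_part (b (Suc 0)) w)" and ?a = "right_part (b (Suc 0)) w 0"
          have "?v \<in> ZF 0" using l 0 F.exact by blast
          then have "?v 0 \<in> J" by (simp add: F.Z_0)
          moreover have L0: "L 0 w = 0" using w(2) 0 by (simp add: D'_def)
          then have "?v 0 + x * ?a = 0"
            by (metis L_def T_0 plus_fun_apply smul_def zero_fun_apply)
          then have "x * ?a = - 1 * ?v 0" by (simp add: add_eq_0_iff)
          ultimately have "x * ?a \<in> J"
            using ideal_poly_ringD(4)[OF J PR_uminus[OF PR_one]] by metis
          moreover have "?a \<in> PR V" using r 0 by (simp add: fmod_def)
          ultimately have "?a \<in> K" by (simp add: K)
          then show ?thesis using L0 r 0 by (simp add: G.Z_0)
        next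
          case (Suc k)
          have "L j w = 0 \<and> - E k (right_part (b (Suc j)) w) = 0"
            using w(2) append_vec_eq_0_iff[OF gmapD(2)[OF L w(1)]] by (simp add: D'_def Suc)
          moreover from this have "E k (right_part (b (Suc j)) w) = 0" by (metis neg_equal_0_iff_equal)
          ultimately show ?thesis using r Suc by (simp add: G.Z_Suc)
        qed
        then show "w \<in> D' (Suc j) ` fmod V (B (Suc (Suc j)))" using exact[OF w(1)] by blast
      next
        fix w assume "w \<in> D' (Suc j) ` fmod V (B (Suc (Suc j)))"
        then obtain w' where w': "w' \<in> fmod V (B (Suc (Suc j)))" "w = D' (Suc j) w'" by auto
        have w: "w \<in> fmod V (B (Suc j))" unfolding w'(2) by (rule gmapD(2)[OF gD' w'(1)])
        have Lw: "L j w = 0" unfolding w'(2) by (rule complex[OF w'(1)])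
        have "D' j w = 0"
        proof (cases j)
          case 0
          then show ?thesis using Lw by (simp add: D'_def)
        next
          case (Suc k)
          have "E j (right_part (b (Suc (Suc j))) w') \<in> ZG j" using right[OF w'(1)] G.exact by blast
          then have "E k (E j (right_part (b (Suc (Suc j))) w')) = 0" by (simp add: Suc G.Z_Suc)
          then have "E k (right_part (b (Suc j)) w) = 0"
            by (simp add: w'(2) D'_def linmap_uminus[OF gmapD(1)[OF E]])
          then show ?thesis using Lw append_vec_eq_0_iff[OF gmapD(2)[OF L w]] by (simp add: D'_def Suc)
        qed
        with w show "w \<in> {u \<in> fmod V (B (Suc j)). D' j u = 0}" by simp
      qed
      then show ?thesis by (simp add: cycles_def Suc)
    qed
  qed
  then show ?thesis unfolding B_def by blast
qed


section \<open>Linear quotients\<close>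

lemma linear_resolution_zero:
  "linear_resolution V d (sqf_ideal V {}) (case_nat 1 (\<lambda>_. 0)) (\<lambda>_ _. 0)"
proof (unfold_locales, goal_cases)
  case (2 i)
  show ?case by (auto simp: gmap_def linmap_def fmod_zero homog_vec_def smul_def fun_eq_iff)
next
  case (3 i)
  have 0: "u = 0" if "u \<in> fmod V (Suc 0)" "u 0 = 0" for u :: "nat \<Rightarrow> ('a, 'b) mpoly"
  proof
    fix k show "u k = 0 k" using that by (cases k) (auto simp: fmod_def)
  qed
  have "sqf_ideal V {} = {0 :: ('a, 'b) mpoly}" by (auto simp: sqf_ideal_def PR_zero)
  moreover have "fmod V 0 = {0 :: nat \<Rightarrow> ('a, 'b) mpoly}" by (auto simp: fmod_def PR_zero)
  moreover have "{u \<in> fmod V (Suc 0). u 0 = 0} = {0 :: nat \<Rightarrow> ('a, 'b) mpoly}"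
    using 0 by (auto simp: fmod_zero)
  ultimately show ?case by (cases i) (simp_all add: cycles_def)
qed simp

lemma linear_resolution_insert:
  fixes V :: "'v set" and D E :: "nat \<Rightarrow> (nat \<Rightarrow> ('v, 'k::field) mpoly) \<Rightarrow> nat \<Rightarrow> ('v, 'k) mpoly"
  assumes B: "finite B" "B \<subseteq> V"
    and F: "linear_resolution V (int (card B)) (sqf_ideal V \<A>) b D"
    and G: "linear_resolution V 1 (sqf_ideal V ((\<lambda>A. A - B) ` \<A>)) c E"
  shows "\<exists>D'. linear_resolution V (int (card B)) (sqf_ideal V (insert B \<A>) :: ('v, 'k) mpoly set)
    (case_nat 1 (\<lambda>i. b (Suc i) + c i)) D'"
proof (rule mapping_cone[OF F G ideal_sqf_ideal sqf_PR[OF B] homogeneous_sqf[OF B(1)]])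
  show "sqf_ideal V ((\<lambda>A. A - B) ` \<A>) = {p :: ('v, 'k) mpoly. p \<in> PR V \<and> sqf B * p \<in> sqf_ideal V \<A>}"
    using sqf_colon[OF B] sqf_ideal_subset by blast
  show "sqf_ideal V (insert B \<A>) = {p :: ('v, 'k) mpoly. \<exists>q\<in>sqf_ideal V \<A>. \<exists>a\<in>PR V. p = q + sqf B * a}"
    using sqf_ideal_insert[OF B] by blast
qed

text \<open>The Koszul complex as an iterated cone: removing \<open>y\<close> changes none of the
  other generators \<open>{x}\<close>, so the colon ideal by \<open>y\<close> is the ideal already
  resolved, and the ranks add up by Pascal's rule.\<close>

lemma linear_resolution_vars:
  fixes V :: "'v set"
  assumes "finite X" "X \<subseteq> V"
  shows "\<exists>D. linear_resolution V 1 (sqf_ideal V ((\<lambda>x. {x}) ` X) :: ('v, 'k::field) mpoly set) (\<lambda>i. card X choose i) D"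
  using assms
proof (induction X rule: finite_induct)
  case empty
  have "(\<lambda>i. card {} choose i) = case_nat 1 (\<lambda>_. 0)" by (auto split: nat.splits)
  then show ?case using linear_resolution_zero[of V 1] by auto
next
  case (insert y X)
  have img: "(\<lambda>A. A - {y}) ` (\<lambda>x. {x}) ` X = (\<lambda>x. {x}) ` X"
    unfolding image_image by (rule image_cong) (use insert(2) in auto)
  obtain D where D: "linear_resolution V 1 (sqf_ideal V ((\<lambda>x. {x}) ` X) :: ('v, 'k) mpoly set) (\<lambda>i. card X choose i) D"
    using insert by auto
  have eq: "case_nat 1 (\<lambda>i. (card X choose Suc i) + (card X choose i)) = (\<lambda>i. card (insert y X) choose i)"
    using insert(1,2) by (auto split: nat.splits)
  have "\<exists>D'. linear_resolution V (int (card {y})) (sqf_ideal V (insert {y} ((\<lambda>x. {x}) ` X)) :: ('v, 'k) mpoly set)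
      (case_nat 1 (\<lambda>i. (card X choose Suc i) + (card X choose i))) D'"
    by (rule linear_resolution_insert[where D = D and E = D], unfold img) (use D insert(4) in auto)
  then show ?case unfolding eq by simp
qed

text \<open>\<open>colon1\<close> and \<open>colon2\<close> say that the differences
  \<open>A - B\<close> with \<open>A\<close> earlier than \<open>B\<close> generate the same ideal
  as the variables in \<open>X B\<close>. So \<open>B\<close> contributes the Koszul ranks of
  \<open>X B\<close>, raised by one homological degree.\<close>

lemma linear_resolution_linear_quotients:
  fixes f :: "'v set \<Rightarrow> nat"
  assumes V: "finite V" and \<B>: "\<And>B. B \<in> \<B> \<Longrightarrow> B \<subseteq> V" "\<And>B. B \<in> \<B> \<Longrightarrow> card B = d"
    and inj: "inj_on f \<B>" and X: "\<And>B. B \<in> \<B> \<Longrightarrow> X B \<subseteq> V"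
    and colon1: "\<And>A B. A \<in> \<B> \<Longrightarrow> B \<in> \<B> \<Longrightarrow> f A < f B \<Longrightarrow> \<exists>x\<in>X B. x \<in> A - B"
    and colon2: "\<And>B x. B \<in> \<B> \<Longrightarrow> x \<in> X B \<Longrightarrow> \<exists>A\<in>\<B>. f A < f B \<and> A - B \<subseteq> {x}"
  shows "\<exists>D. linear_resolution V (int d) (sqf_ideal V \<B> :: ('v, 'k::field) mpoly set)
    (case_nat 1 (\<lambda>i. \<Sum>B\<in>\<B>. card (X B) choose i)) D"
proof -
  have fin: "finite \<B>" using V \<B>(1) by (auto intro: finite_subset[of \<B> "Pow V"])
  \<comment> \<open>Induction on a strict bound for \<open>f\<close>; by injectivity each step adds
    at most one generator.\<close>
  let ?\<B> = "\<lambda>n. {B \<in> \<B>. f B < n}"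
  have "\<exists>D. linear_resolution V (int d) (sqf_ideal V (?\<B> n) :: ('v, 'k) mpoly set)
    (case_nat 1 (\<lambda>i. \<Sum>B\<in>?\<B> n. card (X B) choose i)) D" for n
  proof (induction n)
    case 0
    have empty: "?\<B> 0 = {}" by auto
    show ?case unfolding empty sum.empty by (rule exI, rule linear_resolution_zero)
  next
    case (Suc n)
    show ?case
    proof (cases "\<exists>B\<in>\<B>. f B = n")
      case False
      then have same: "?\<B> (Suc n) = ?\<B> n" by (auto simp: less_Suc_eq)
      show ?thesis unfolding same by (rule Suc)
    next
      case True
      then obtain B where B: "B \<in> \<B>" "f B = n" by blast
      have ins: "?\<B> (Suc n) = insert B (?\<B> n)"
        using B inj by (auto simp: less_Suc_eq dest: inj_onD)
      have finB: "finite B" using \<B>(1)[OF B(1)] V by (rule finite_subset)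
      obtain D where D: "linear_resolution V (int d) (sqf_ideal V (?\<B> n) :: ('v, 'k) mpoly set)
        (case_nat 1 (\<lambda>i. \<Sum>B\<in>?\<B> n. card (X B) choose i)) D"
        using Suc by blast
      have "sqf_ideal V ((\<lambda>A. A - B) ` ?\<B> n) = (sqf_ideal V ((\<lambda>x. {x}) ` X B) :: ('v, 'k) mpoly set)"
        by (rule sqf_ideal_cong) (use colon1[OF _ B(1)] colon2[OF B(1)] B(2) in fastforce)+
      then obtain E where E: "linear_resolution V 1 (sqf_ideal V ((\<lambda>A. A - B) ` ?\<B> n) :: ('v, 'k) mpoly set)
        (\<lambda>i. card (X B) choose i) E"
        using linear_resolution_vars[of "X B" V] X[OF B(1)] V by (metis finite_subset)
      have notin: "B \<notin> ?\<B> n" "finite (?\<B> n)" using B fin by auto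
      have ranks: "case_nat 1 (\<lambda>i. (case Suc i of 0 \<Rightarrow> 1 | Suc i \<Rightarrow> \<Sum>B\<in>?\<B> n. card (X B) choose i)
            + (card (X B) choose i))
          = case_nat 1 (\<lambda>i. \<Sum>B\<in>insert B (?\<B> n). card (X B) choose i)"
        by (simp only: sum.insert[OF notin(2,1)] nat.case add.commute)
      show ?thesis
        using linear_resolution_insert[OF finB \<B>(1)[OF B(1)], unfolded \<B>(2)[OF B(1)], OF D E]
        unfolding ranks ins .
    qed
  qed
  \<comment> \<open>This bound exceeds all values of \<open>f\<close>; the inserted 0 covers the
    case of no generators.\<close>
  from this[of "Suc (Max (insert 0 (f ` \<B>)))"]
  have "\<exists>D. linear_resolution V (int d) (sqf_ideal V {B \<in> \<B>. f B < Suc (Max (insert 0 (f ` \<B>)))} :: ('v, 'k) mpoly set)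
    (case_nat 1 (\<lambda>i. \<Sum>B\<in>{B \<in> \<B>. f B < Suc (Max (insert 0 (f ` \<B>)))}. card (X B) choose i)) D" .
  moreover have all: "{B \<in> \<B>. f B < Suc (Max (insert 0 (f ` \<B>)))} = \<B>"
    using fin by (auto simp: less_Suc_eq_le intro!: Max_ge)
  ultimately show ?thesis unfolding all by blast
qed

section \<open>The reverse lexicographic order\<close>

text \<open>Binary encoding with the rank of a vertex in \<open>V\<close> as bit position: numbers
  compare as the sets do at the largest vertex in which they differ. A natural number is what
  \<open>linear_resolution_linear_quotients\<close> expects as \<open>f\<close>.\<close>

definition revlex :: "'v::linorder set \<Rightarrow> 'v set \<Rightarrow> nat" where
  "revlex V A = (\<Sum>x\<in>A. 2 ^ card {y \<in> V. y < x})"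

lemma revlex_less:
  fixes V :: "'v::linorder set"
  assumes V: "finite V" "A \<subseteq> V" "B \<subseteq> V" and x: "x \<in> B - A" "\<And>y. y \<in> A - B \<Longrightarrow> y < x"
  shows "revlex V A < revlex V B"
proof -
  let ?i = "\<lambda>x. card {y \<in> V. y < x}"
  have mono: "?i y < ?i z" if "y \<in> V" "y < z" for y z
    by (rule psubset_card_mono) (use V that in auto)
  have fin: "finite A" "finite B" using V by (auto intro: finite_subset)
  have inj: "inj_on ?i (A - B)"
  proof (rule inj_onI)
    fix y z assume "y \<in> A - B" "z \<in> A - B" "?i y = ?i z"
    then show "y = z" using mono[of y z] mono[of z y] V(2) by (cases y z rule: linorder_cases) auto
  qed
  have "(\<Sum>y\<in>A - B. 2 ^ ?i y) = (\<Sum>k\<in>?i ` (A - B). 2 ^ k :: nat)"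
    by (simp add: sum.reindex[OF inj])
  \<comment> \<open>The bit positions of \<open>A - B\<close> are distinct and below that of
    \<open>x\<close>, and all lower bits together stay below the bit of \<open>x\<close>.\<close>
  also have "\<dots> \<le> (\<Sum>k<?i x. 2 ^ k)"
    by (rule sum_mono2) (use mono x V(2) in auto)
  also have "\<dots> < 2 ^ ?i x"
    using sum_power2[of "?i x"] by (simp add: atLeast0LessThan)
  also have "\<dots> \<le> (\<Sum>y\<in>B - A. 2 ^ ?i y)"
    by (rule member_le_sum) (use x fin in auto)
  finally have less: "(\<Sum>y\<in>A - B. 2 ^ ?i y) < (\<Sum>y\<in>B - A. 2 ^ ?i y :: nat)" .
  have "revlex V A = (\<Sum>y\<in>A \<inter> B. 2 ^ ?i y) + (\<Sum>y\<in>A - B. 2 ^ ?i y)"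
    unfolding revlex_def using fin(1) by (subst sum.union_disjoint[symmetric]) (auto intro!: sum.cong)
  moreover have "revlex V B = (\<Sum>y\<in>A \<inter> B. 2 ^ ?i y) + (\<Sum>y\<in>B - A. 2 ^ ?i y)"
    unfolding revlex_def using fin by (subst sum.union_disjoint[symmetric]) (auto intro!: sum.cong)
  ultimately show ?thesis using less by simp
qed

lemma revlex_cases:
  fixes V :: "'v::linorder set"
  assumes V: "finite V" "A \<subseteq> V" "B \<subseteq> V" and ne: "A \<noteq> B"
  obtains x where "x \<in> B - A" "\<And>y. y \<in> A - B \<Longrightarrow> y < x" "revlex V A < revlex V B"
  | x where "x \<in> A - B" "\<And>y. y \<in> B - A \<Longrightarrow> y < x" "revlex V B < revlex V A"
proof -
  let ?S = "(A - B) \<union> (B - A)"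
  have S: "finite ?S" "?S \<noteq> {}" using V ne by (auto intro: finite_subset)
  have Max: "Max ?S \<in> ?S" "\<And>y. y \<in> ?S \<Longrightarrow> y \<le> Max ?S"
    using Max_in[OF S] Max_ge[OF S(1)] by blast+
  show ?thesis
  proof (cases "Max ?S \<in> B - A")
    case True
    have "y < Max ?S" if "y \<in> A - B" for y
      using Max(2)[of y] that True by (auto simp: less_le)
    then show ?thesis using that(1)[OF True] revlex_less[OF V True] by blast
  next
    case False
    then have m: "Max ?S \<in> A - B" using Max(1) by blast
    have "y < Max ?S" if "y \<in> B - A" for y
      using Max(2)[of y] that m by (auto simp: less_le)
    then show ?thesis using that(2)[OF m] revlex_less[OF V(1,3,2) m] by blast
  qed
qed

section \<open>Sets that are not contained in one part\<close>

definition spread_sets :: "('v \<Rightarrow> 'p) \<Rightarrow> 'v set \<Rightarrow> nat \<Rightarrow> 'v set set" where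
  "spread_sets \<pi> V r = {A. A \<subseteq> V \<and> card A = r + 1 \<and> (\<exists>x\<in>A. \<exists>y\<in>A. \<pi> x \<noteq> \<pi> y)}"

text \<open>The variables that generate the colon ideal at \<open>B\<close> in the reverse lexicographic order.\<close>

definition colon_vars :: "('v::linorder \<Rightarrow> 'p) \<Rightarrow> 'v set \<Rightarrow> 'v set \<Rightarrow> 'v set" where
  "colon_vars \<pi> V B = {x \<in> V - B. x < Max B \<and> \<not> (\<forall>y\<in>B - {Max B}. \<pi> y = \<pi> x \<and> y < x)}"

context
  fixes V :: "'v::linorder set" and \<pi> :: "'v \<Rightarrow> 'p" and r :: nat
  assumes V: "finite V" and r: "r \<ge> 1"
begin

lemma spread_sets_D:
  assumes "B \<in> spread_sets \<pi> V r"
  shows "B \<subseteq> V" "finite B" "card B = r + 1" "Max B \<in> B" "\<And>y. y \<in> B \<Longrightarrow> y \<le> Max B"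
    "B - {Max B} \<noteq> {}" "\<exists>x\<in>B. \<exists>y\<in>B. \<pi> x \<noteq> \<pi> y"
proof -
  show B: "B \<subseteq> V" "card B = r + 1" "\<exists>x\<in>B. \<exists>y\<in>B. \<pi> x \<noteq> \<pi> y"
    using assms by (auto simp: spread_sets_def)
  show fin: "finite B" using B(1) V by (rule finite_subset)
  have "B \<noteq> {}" using B(2) by auto
  then show max: "Max B \<in> B" "\<And>y. y \<in> B \<Longrightarrow> y \<le> Max B" using fin by auto
  have "card (B - {Max B}) = r" using max(1) fin B(2) by simp
  then show "B - {Max B} \<noteq> {}" using r by (metis card.empty not_one_le_zero)
qed

text \<open>If no element of \<open>A - B\<close> were a colon variable, all of \<open>B\<close>
  except \<open>Max B\<close> would lie below each of them and in the same part. The largest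
  difference \<open>x0\<close> would then be \<open>Max B\<close>, so \<open>A\<close> would miss it
  and lie in one part.\<close>

lemma colon_vars_exchange:
  assumes A: "A \<in> spread_sets \<pi> V r" and B: "B \<in> spread_sets \<pi> V r" and less: "revlex V A < revlex V B"
  shows "\<exists>x\<in>colon_vars \<pi> V B. x \<in> A - B"
proof (rule ccontr)
  note A' = spread_sets_D[OF A] and B' = spread_sets_D[OF B]
  have "A \<noteq> B" using less by auto
  from revlex_cases[OF V A'(1) B'(1) this] less
  obtain x0 where x0: "x0 \<in> B - A" "\<And>y. y \<in> A - B \<Longrightarrow> y < x0" by (metis less_asym')
  have "A - B \<noteq> {}" using \<open>A \<noteq> B\<close> A'(3) B'(2,3) card_subset_eq[of B A] by auto
  then obtain x1 where x1: "x1 \<in> A - B" by auto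
  obtain y1 where y1: "y1 \<in> B - {Max B}" using B'(6) by auto
  assume "\<not> (\<exists>x\<in>colon_vars \<pi> V B. x \<in> A - B)"
  moreover have "x < Max B" if "x \<in> A - B" for x
    using x0(2)[OF that] B'(5)[of x0] x0(1) by auto
  ultimately have bad: "\<pi> y = \<pi> x \<and> y < x" if "x \<in> A - B" "y \<in> B - {Max B}" for x y
    using that A'(1) unfolding colon_vars_def by blast
  \<comment> \<open>Any other \<open>x0\<close> would lie below \<open>x1\<close> by
    \<open>bad\<close>, against \<open>x1 < x0\<close>.\<close>
  have "x0 = Max B" using bad[OF x1, of x0] x0(1) x0(2)[OF x1] by fastforce
  then have "\<pi> x = \<pi> y1" if "x \<in> A" for x
    using that bad[OF _ y1, of x] bad[OF x1, of x] bad[OF x1 y1] x0(1) by (cases "x \<in> B") auto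
  then show False using A'(7) by auto
qed

text \<open>\<open>x\<close> replaces \<open>Max B\<close> if the result still meets two parts.
  Otherwise \<open>B\<close> without \<open>Max B\<close> lies in the part of \<open>x\<close>; a
  colon variable is then below some other \<open>y\<close> in \<open>B\<close>, and replacing
  \<open>y\<close> keeps \<open>Max B\<close>, which is in another part.\<close>

lemma colon_vars_generate:
  assumes B: "B \<in> spread_sets \<pi> V r" and x: "x \<in> colon_vars \<pi> V B"
  shows "\<exists>A\<in>spread_sets \<pi> V r. revlex V A < revlex V B \<and> A - B \<subseteq> {x}"
proof -
  note B' = spread_sets_D[OF B]
  have x': "x \<in> V" "x \<notin> B" "x < Max B" using x by (auto simp: colon_vars_def)
  have exch: "\<exists>A\<in>spread_sets \<pi> V r. revlex V A < revlex V B \<and> A - B \<subseteq> {x}"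
    if y: "y \<in> B" "x < y" and spread: "\<exists>u\<in>insert x (B - {y}). \<exists>v\<in>insert x (B - {y}). \<pi> u \<noteq> \<pi> v" for y
  proof (intro bexI conjI)
    show "insert x (B - {y}) \<in> spread_sets \<pi> V r"
      using spread y x' B'(1-3) by (auto simp: spread_sets_def)
    then have "insert x (B - {y}) \<subseteq> V" by (auto simp: spread_sets_def)
    then show "revlex V (insert x (B - {y})) < revlex V B"
      by (rule revlex_less[OF V _ B'(1), of _ y]) (use y x' in auto)
  qed auto
  show ?thesis
  proof (cases "\<exists>u\<in>insert x (B - {Max B}). \<exists>v\<in>insert x (B - {Max B}). \<pi> u \<noteq> \<pi> v")
    case True
    then show ?thesis using exch[OF B'(4) x'(3)] by blast
  next
    case False
    then have same: "\<pi> y = \<pi> x" if "y \<in> B - {Max B}" for y using that by blast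
    then obtain y where y: "y \<in> B - {Max B}" "\<not> y < x" using x by (auto simp: colon_vars_def)
    then have "x < y" using x'(2) by (metis DiffD1 linorder_neqE)
    moreover have "\<pi> (Max B) \<noteq> \<pi> x" using same B'(7) by (metis Diff_iff singletonD)
    ultimately show ?thesis using exch[of y] y B'(4) by blast
  qed
qed

lemma revlex_inj_on: "inj_on (revlex V) (spread_sets \<pi> V r)"
proof (rule inj_onI, rule ccontr)
  fix A B assume AB: "A \<in> spread_sets \<pi> V r" "B \<in> spread_sets \<pi> V r" "revlex V A = revlex V B" "A \<noteq> B"
  show False
    by (rule revlex_cases[OF V spread_sets_D(1)[OF AB(1)] spread_sets_D(1)[OF AB(2)] AB(4)])
      (use AB(3) in auto)
qed

lemma spread_sets_linear_resolution:
  "\<exists>D. linear_resolution V (int (r + 1)) (sqf_ideal V (spread_sets \<pi> V r) :: ('v, 'k::field) mpoly set)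
    (case_nat 1 (\<lambda>i. \<Sum>B\<in>spread_sets \<pi> V r. card (colon_vars \<pi> V B) choose i)) D"
proof (rule linear_resolution_linear_quotients[OF V])
  show "inj_on (revlex V) (spread_sets \<pi> V r)" by (rule revlex_inj_on)
  show "colon_vars \<pi> V B \<subseteq> V" for B by (auto simp: colon_vars_def)
  show "B \<subseteq> V" "card B = r + 1" if "B \<in> spread_sets \<pi> V r" for B
    using spread_sets_D[OF that] by simp_all
  show "\<exists>x\<in>colon_vars \<pi> V B. x \<in> A - B"
    if "A \<in> spread_sets \<pi> V r" "B \<in> spread_sets \<pi> V r" "revlex V A < revlex V B" for A B
    by (rule colon_vars_exchange[OF that])
  show "\<exists>A\<in>spread_sets \<pi> V r. revlex V A < revlex V B \<and> A - B \<subseteq> {x}"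
    if "B \<in> spread_sets \<pi> V r" "x \<in> colon_vars \<pi> V B" for B x
    by (rule colon_vars_generate[OF that])
qed

text \<open>\<open>card (colon_vars \<pi> V B) choose j\<close> counts the sets \<open>W = B \<union> Y\<close> with \<open>Y\<close> a
  \<open>j\<close>-subset of the colon variables. For fixed \<open>W\<close>, the admissible \<open>B\<close> contain \<open>Max W\<close>, and
  what remains of \<open>B\<close> is not contained in a part of \<open>W\<close> with its maximum removed.\<close>

lemma admissible_iff:
  fixes W :: "'v set"
  defines "P \<equiv> \<lambda>s. {x \<in> W. \<pi> x = s}"
  assumes W: "W \<subseteq> V" "W \<noteq> {}" and B': "B' \<subseteq> W - {Max W}" "card B' = r"
  shows "insert (Max W) B' \<in> spread_sets \<pi> V r \<and> W - insert (Max W) B' \<subseteq> colon_vars \<pi> V (insert (Max W) B')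
    \<longleftrightarrow> \<not> (\<exists>s. B' \<subseteq> P s - {Max (P s)})"
proof -
  let ?M = "Max W" and ?B = "insert (Max W) B'"
  have finW: "finite W" using W(1) V by (rule finite_subset)
  have fin: "finite W" "finite B'" "\<And>s. finite (P s)"
    using finW finite_subset[OF B'(1)] by (simp_all add: P_def)
  have M: "?M \<in> W" "\<And>y. y \<in> W \<Longrightarrow> y \<le> ?M" using fin W by auto
  have MP: "y \<le> Max (P s)" "Max (P s) \<in> P s" if "y \<in> P s" for y s
    using Max_ge[OF fin(3) that] Max_in[OF fin(3), of s] that by auto
  have MB: "Max ?B = ?M" by (rule Max_eqI) (use fin M B' in auto)
  have B: "?B - {Max ?B} = B'" using B' MB by auto
  have ne: "B' \<noteq> {}" using B'(2) r by auto
  show ?thesis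
  proof
    assume L: "?B \<in> spread_sets \<pi> V r \<and> W - ?B \<subseteq> colon_vars \<pi> V ?B"
    show "\<not> (\<exists>s. B' \<subseteq> P s - {Max (P s)})"
    proof
      assume "\<exists>s. B' \<subseteq> P s - {Max (P s)}"
      then obtain s where s: "B' \<subseteq> P s - {Max (P s)}" ..
      then have x: "Max (P s) \<in> P s" using ne MP(2) by blast
      show False
      proof (cases "Max (P s) = ?M")
        case True
        then have "?B \<subseteq> P s" using s x by auto
        then show False using L by (auto simp: spread_sets_def P_def)
      next
        case False
        \<comment> \<open>This maximum is in \<open>W\<close> but not in \<open>?B\<close>, so it
          has to be a colon variable; yet all of \<open>B'\<close> lies below it in its own
          part.\<close>
        then have "Max (P s) \<in> colon_vars \<pi> V ?B" using L s x by (auto simp: P_def)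
        then obtain y where y: "y \<in> B'" "\<not> (\<pi> y = \<pi> (Max (P s)) \<and> y < Max (P s))"
          unfolding colon_vars_def B by auto
        then have "y \<in> P s" "y \<noteq> Max (P s)" using s by auto
        then show False using y(2) MP(1)[of y s] x by (auto simp: P_def)
      qed
    qed
  next
    assume R: "\<not> (\<exists>s. B' \<subseteq> P s - {Max (P s)})"
    \<comment> \<open>If \<open>?B\<close> lay in one part, then \<open>Max W\<close> would be the
      maximum of that part and \<open>B'\<close> a subset of the rest, against
      \<open>R\<close>.\<close>
    have spread: "\<exists>x\<in>?B. \<exists>y\<in>?B. \<pi> x \<noteq> \<pi> y"
    proof (rule ccontr)
      assume "\<not> ?thesis"
      then have sub: "B' \<subseteq> P (\<pi> ?M)" using B' by (auto simp: P_def)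
      have "Max (P (\<pi> ?M)) = ?M" by (rule Max_eqI) (use fin M in \<open>auto simp: P_def\<close>)
      then have "B' \<subseteq> P (\<pi> ?M) - {Max (P (\<pi> ?M))}" using sub B'(1) by auto
      then show False using R by blast
    qed
    have "card ?B = r + 1" using B' fin(2) by (subst card_insert_disjoint) auto
    then have "?B \<in> spread_sets \<pi> V r" using spread W M(1) B'(1) by (auto simp: spread_sets_def)
    moreover have "W - ?B \<subseteq> colon_vars \<pi> V ?B"
    proof
      fix x assume x: "x \<in> W - ?B"
      have "\<not> (\<forall>y\<in>B'. \<pi> y = \<pi> x \<and> y < x)"
      proof
        assume all: "\<forall>y\<in>B'. \<pi> y = \<pi> x \<and> y < x"
        have "x \<le> Max (P (\<pi> x))" using x by (intro MP(1)) (auto simp: P_def)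
        then have "B' \<subseteq> P (\<pi> x) - {Max (P (\<pi> x))}" using all B'(1) by (fastforce simp: P_def)
        then show False using R by blast
      qed
      moreover have "x < ?M" using x M(2)[of x] by (auto simp: less_le)
      ultimately show "x \<in> colon_vars \<pi> V ?B"
        unfolding colon_vars_def B using x W(1) MB by auto
    qed
    ultimately show "?B \<in> spread_sets \<pi> V r \<and> W - ?B \<subseteq> colon_vars \<pi> V ?B" ..
  qed
qed

text \<open>By \<open>admissible_iff\<close> the admissible sets correspond to the
  \<open>r\<close>-subsets of \<open>W - {Max W}\<close> outside all \<open>U s\<close>, and these
  families are disjoint because their members are nonempty. The additive form avoids truncated
  subtraction.\<close>

lemma card_admissible:
  fixes W :: "'v set" and S :: "'p set"
  defines "P \<equiv> \<lambda>s. {x \<in> W. \<pi> x = s}"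
  assumes W: "W \<subseteq> V" "W \<noteq> {}" and S: "finite S" "\<pi> ` W \<subseteq> S"
  shows "card {B \<in> spread_sets \<pi> V r. B \<subseteq> W \<and> W - B \<subseteq> colon_vars \<pi> V B}
    + (\<Sum>s\<in>S. (card (P s) - 1) choose r) = (card W - 1) choose r"
proof -
  let ?M = "Max W"
  have finW: "finite W" using W(1) V by (rule finite_subset)
  then have fin: "finite W" "\<And>s. finite (P s)" by (simp_all add: P_def)
  have M: "?M \<in> W" "\<And>y. y \<in> W \<Longrightarrow> y \<le> ?M" using fin W by auto
  define T where "T = {B'. B' \<subseteq> W - {?M} \<and> card B' = r}"
  define U where "U s = {B'. B' \<subseteq> P s - {Max (P s)} \<and> card B' = r}" for s
  define A where "A = {B \<in> spread_sets \<pi> V r. B \<subseteq> W \<and> W - B \<subseteq> colon_vars \<pi> V B}"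
  have cardT: "card T = (card W - 1) choose r"
    unfolding T_def using fin(1) M(1) by (subst n_subsets) simp_all
  have cardU: "card (U s) = (card (P s) - 1) choose r" for s
  \<comment> \<open>For an empty part \<open>Max (P s)\<close> is arbitrary; both sides are 0, since
    truncated \<open>0 - 1\<close> is 0 and r >= 1.\<close>
  proof (cases "P s = {}")
    case True
    then show ?thesis unfolding U_def using r by (subst n_subsets) simp_all
  next
    case False
    then have "Max (P s) \<in> P s" using fin(2) by simp
    then show ?thesis unfolding U_def using fin(2) by (subst n_subsets) simp_all
  qed
  have U_ne: "B' \<noteq> {}" if "B' \<in> U s" for B' s using that r by (auto simp: U_def)
  have disj: "U s \<inter> U s' = {}" if "s \<noteq> s'" for s s'
  proof (rule ccontr)
    assume "U s \<inter> U s' \<noteq> {}"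
    then obtain B' x where "B' \<in> U s" "B' \<in> U s'" "x \<in> B'" using U_ne by blast
    then show False using that by (auto simp: U_def P_def)
  qed
  have finT: "finite T" unfolding T_def using fin(1) by simp
  have finU: "finite (U s)" for s unfolding U_def using fin(2) by simp
  have UT: "U s \<subseteq> T" for s
  proof
    fix B' assume B': "B' \<in> U s"
    \<comment> \<open>\<open>Max W\<close> is also the maximum of its own part, so no member of
      \<open>U s\<close> contains it.\<close>
    have "?M \<notin> B'"
    proof
      assume "?M \<in> B'"
      then have MP: "?M \<in> P s" "?M \<noteq> Max (P s)" using B' by (auto simp: U_def)
      have "Max (P s) \<in> P s" "?M \<le> Max (P s)"
        using Max_in[OF fin(2), of s] Max_ge[OF fin(2) MP(1)] MP(1) by auto
      then show False using MP M(2)[of "Max (P s)"] by (auto simp: P_def)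
    qed
    then show "B' \<in> T" using B' by (auto simp: U_def T_def P_def)
  qed
  have US: "(\<Union>s. U s) = (\<Union>s\<in>S. U s)"
  proof -
    have "s \<in> S" if "B' \<in> U s" for B' s
      using U_ne[OF that] that S(2) by (auto simp: U_def P_def)
    then show ?thesis by blast
  qed
  have "A = insert ?M ` (T - (\<Union>s. U s))"
  proof (intro equalityI subsetI)
    fix B assume "B \<in> A"
    then have B: "B \<in> spread_sets \<pi> V r" "B \<subseteq> W" "W - B \<subseteq> colon_vars \<pi> V B" by (auto simp: A_def)
    note B' = spread_sets_D[OF B(1)]
    have "?M \<in> B"
    proof (rule ccontr)
      assume "?M \<notin> B"
      then have "?M < Max B" using B(3) M(1) by (auto simp: colon_vars_def)
      then show False using M(2)[of "Max B"] B'(4) B(2) by auto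
    qed
    define C where "C = B - {?M}"
    have C: "B = insert ?M C" "C \<subseteq> W - {?M}" "card C = r"
      using \<open>?M \<in> B\<close> B(2) B'(2,3) by (auto simp: C_def)
    have "\<not> (\<exists>s. C \<subseteq> P s - {Max (P s)})"
      using admissible_iff[OF W C(2,3)] B(1,3) unfolding P_def C(1) by blast
    then have "C \<in> T - (\<Union>s. U s)" using C by (auto simp: T_def U_def)
    then show "B \<in> insert ?M ` (T - (\<Union>s. U s))" using C(1) by blast
  next
    fix B assume "B \<in> insert ?M ` (T - (\<Union>s. U s))"
    then obtain C where C: "B = insert ?M C" "C \<subseteq> W - {?M}" "card C = r" "\<And>s. C \<notin> U s"
      by (auto simp: T_def)
    then have "\<not> (\<exists>s. C \<subseteq> P s - {Max (P s)})" by (auto simp: U_def)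
    then show "B \<in> A"
      using admissible_iff[OF W C(2,3)] C(2) M(1) unfolding P_def C(1) A_def by auto
  qed
  moreover have "inj_on (insert ?M) (T - (\<Union>s. U s))"
    by (rule inj_onI) (simp add: T_def, blast)
  ultimately have "card A = card (T - (\<Union>s\<in>S. U s))" by (simp add: card_image US)
  also have "\<dots> = card T - (\<Sum>s\<in>S. card (U s))"
  proof -
    have "card (\<Union>s\<in>S. U s) = (\<Sum>s\<in>S. card (U s))"
      by (rule card_UN_disjoint) (use S(1) finU disj in auto)
    moreover have "finite (\<Union>s\<in>S. U s)" using S(1) finU by blast
    ultimately show ?thesis using card_Diff_subset[of "\<Union>s\<in>S. U s" T] UT by auto
  qed
  finally have 1: "card A = card T - (\<Sum>s\<in>S. card (U s))" .
  have "(\<Sum>s\<in>S. card (U s)) = card (\<Union>s\<in>S. U s)"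
    by (rule card_UN_disjoint[symmetric]) (use S(1) finU disj in auto)
  also have "\<dots> \<le> card T" by (rule card_mono[OF finT]) (use UT in blast)
  finally show ?thesis using 1 unfolding A_def cardT cardU by simp
qed

lemma sum_colon_vars_choose:
  assumes S: "finite S" "\<pi> ` V \<subseteq> S"
  shows "int (\<Sum>B\<in>spread_sets \<pi> V r. card (colon_vars \<pi> V B) choose j) =
    (\<Sum>W | W \<subseteq> V \<and> card W = r + 1 + j.
      int ((r + j) choose r) - (\<Sum>s\<in>S. int ((card {x \<in> W. \<pi> x = s} - 1) choose r)))"
proof -
  let ?\<B> = "spread_sets \<pi> V r" and ?\<W> = "{W. W \<subseteq> V \<and> card W = r + 1 + j}"
  let ?Y = "\<lambda>B. {Y. Y \<subseteq> colon_vars \<pi> V B \<and> card Y = j}"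
  let ?A = "\<lambda>W. {B \<in> ?\<B>. B \<subseteq> W \<and> W - B \<subseteq> colon_vars \<pi> V B}"
  have fin: "finite ?\<B>" "finite ?\<W>" using V by (auto simp: spread_sets_def)
  have finX: "finite (colon_vars \<pi> V B)" for B using V by (auto simp: colon_vars_def)
  have X: "colon_vars \<pi> V B \<subseteq> V - B" for B by (auto simp: colon_vars_def)
  have "(\<Sum>B\<in>?\<B>. card (colon_vars \<pi> V B) choose j) = (\<Sum>B\<in>?\<B>. card (?Y B))"
    using finX by (simp add: n_subsets)
  also have "\<dots> = card (Sigma ?\<B> ?Y)" using fin finX by (subst card_SigmaI) auto
  also have "\<dots> = card (Sigma ?\<W> ?A)"
  \<comment> \<open>Colon variables lie outside \<open>B\<close>, so \<open>Y\<close> is recovered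
    from \<open>W\<close> and \<open>B\<close> as \<open>W - B\<close>.\<close>
  proof (rule bij_betw_same_card[of "\<lambda>(B, Y). (B \<union> Y, B)"])
    show "bij_betw (\<lambda>(B, Y). (B \<union> Y, B)) (Sigma ?\<B> ?Y) (Sigma ?\<W> ?A)"
    proof (rule bij_betw_byWitness[where f' = "\<lambda>(W, B). (B, W - B)"])
      show "\<forall>a\<in>Sigma ?\<B> ?Y. (case case a of (B, Y) \<Rightarrow> (B \<union> Y, B) of (W, B) \<Rightarrow> (B, W - B)) = a"
        using X by (fastforce simp: subset_iff)
      show "\<forall>a\<in>Sigma ?\<W> ?A. (case case a of (W, B) \<Rightarrow> (B, W - B) of (B, Y) \<Rightarrow> (B \<union> Y, B)) = a"
        by auto
      show "(\<lambda>(B, Y). (B \<union> Y, B)) ` Sigma ?\<B> ?Y \<subseteq> Sigma ?\<W> ?A"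
      proof (rule image_subsetI)
        fix p assume "p \<in> Sigma ?\<B> ?Y"
        then obtain B Y where p: "p = (B, Y)" and B: "B \<in> ?\<B>"
          and Y: "Y \<subseteq> colon_vars \<pi> V B" "card Y = j" by blast
        note B' = spread_sets_D[OF B]
        have "finite Y" "B \<inter> Y = {}" "Y \<subseteq> V" using Y(1) finX X by (blast intro: finite_subset)+
        then show "(case p of (B, Y) \<Rightarrow> (B \<union> Y, B)) \<in> Sigma ?\<W> ?A"
          using p B B'(1-3) Y by (auto simp: card_Un_disjoint)
      qed
      show "(\<lambda>(W, B). (B, W - B)) ` Sigma ?\<W> ?A \<subseteq> Sigma ?\<B> ?Y"
      proof (rule image_subsetI)
        fix p assume "p \<in> Sigma ?\<W> ?A"
        then obtain W B where p: "p = (W, B)" "card W = r + 1 + j"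
          and B: "B \<in> ?\<B>" "B \<subseteq> W" "W - B \<subseteq> colon_vars \<pi> V B" by blast
        then show "(case p of (W, B) \<Rightarrow> (B, W - B)) \<in> Sigma ?\<B> ?Y"
          using spread_sets_D(2,3)[OF B(1)] by (simp add: card_Diff_subset)
      qed
    qed
  qed
  also have "\<dots> = (\<Sum>W\<in>?\<W>. card (?A W))" using fin by (subst card_SigmaI) auto
  finally have "int (\<Sum>B\<in>?\<B>. card (colon_vars \<pi> V B) choose j) = (\<Sum>W\<in>?\<W>. int (card (?A W)))"
    by simp
  also have "\<dots> = (\<Sum>W\<in>?\<W>. int ((r + j) choose r) - (\<Sum>s\<in>S. int ((card {x \<in> W. \<pi> x = s} - 1) choose r)))"
  proof (rule sum.cong[OF refl])
    fix W assume W: "W \<in> ?\<W>"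
    then have "W \<subseteq> V" "W \<noteq> {}" "\<pi> ` W \<subseteq> S" using S(2) by auto
    from card_admissible[OF this(1,2) S(1) this(3)]
    have "int (card (?A W)) + int (\<Sum>s\<in>S. (card {x \<in> W. \<pi> x = s} - 1) choose r) = int ((card W - 1) choose r)"
      by linarith
    then show "int (card (?A W)) = int ((r + j) choose r) - (\<Sum>s\<in>S. int ((card {x \<in> W. \<pi> x = s} - 1) choose r))"
      using W by simp
  qed
  finally show ?thesis .
qed

end

section \<open>Counting subsets by their intersections with the parts\<close>

text \<open>A subset of \<open>V\<close> amounts to the family of its intersections with the parts,
  and these are chosen independently.\<close>

lemma card_subsets_with_profile:
  fixes ns js :: "nat list"
  assumes len: "length js = length ns"
  defines "V \<equiv> {(s, a). s < length ns \<and> a < ns ! s}"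
  shows "card {W. W \<subseteq> V \<and> (\<forall>s<length ns. card {x \<in> W. fst x = s} = js ! s)}
    = (\<Prod>s<length ns. (ns ! s) choose (js ! s))"
proof -
  let ?P = "\<lambda>s. {x \<in> V. fst x = s}"
  have P: "?P s = Pair s ` {..<ns ! s}" if "s < length ns" for s using that by (auto simp: V_def)
  have cardP: "card (?P s) = ns ! s" "finite (?P s)" if "s < length ns" for s
    unfolding P[OF that] by (simp_all add: card_image inj_on_def)
  let ?F = "PiE {..<length ns} (\<lambda>s. {Y. Y \<subseteq> ?P s \<and> card Y = js ! s})"
  have "card {W. W \<subseteq> V \<and> (\<forall>s<length ns. card {x \<in> W. fst x = s} = js ! s)} = card ?F"
  proof (rule bij_betw_same_card[of "\<lambda>W. \<lambda>s\<in>{..<length ns}. {x \<in> W. fst x = s}"],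
      rule bij_betw_byWitness[where f' = "\<lambda>Y. \<Union>s<length ns. Y s"], goal_cases)
    case 1
    show ?case by (auto simp: V_def)
  next
    case 2
    show ?case
    proof
      fix Y assume Y: "Y \<in> ?F"
      have sub: "Y s \<subseteq> ?P s" if "s < length ns" for s using Y that by (auto dest!: PiE_mem)
      have eq: "{x \<in> \<Union>s<length ns. Y s. fst x = s} = Y s" if "s < length ns" for s
        using sub that by auto
      show "(\<lambda>s\<in>{..<length ns}. {x \<in> \<Union>s<length ns. Y s. fst x = s}) = Y"
      proof
        fix s show "(\<lambda>s\<in>{..<length ns}. {x \<in> \<Union>s<length ns. Y s. fst x = s}) s = Y s"
        proof (cases "s < length ns")
          case True
          then show ?thesis using eq[OF True] by (simp only: restrict_def lessThan_iff if_True)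
        next
          case False
          then show ?thesis using PiE_arb[OF Y, of s] by (simp only: restrict_def lessThan_iff if_False not_False_eq_True)
        qed
      qed
    qed
  next
    case 3
    show ?case by (auto simp: V_def)
  next
    case 4
    show ?case
    proof
      fix W assume "W \<in> (\<lambda>Y. \<Union>s<length ns. Y s) ` ?F"
      then obtain Y where Y: "Y \<in> ?F" and W: "W = (\<Union>s<length ns. Y s)" by blast
      have sub: "Y s \<subseteq> ?P s" "card (Y s) = js ! s" if "s < length ns" for s
        using Y that by (auto dest!: PiE_mem)
      have eq: "{x \<in> W. fst x = s} = Y s" if "s < length ns" for s
        unfolding W using sub(1) that by auto
      show "W \<in> {W. W \<subseteq> V \<and> (\<forall>s<length ns. card {x \<in> W. fst x = s} = js ! s)}"
        using sub eq by (auto simp: W)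
    qed
  qed
  also have "\<dots> = (\<Prod>s<length ns. (ns ! s) choose (js ! s))"
    by (simp add: card_PiE n_subsets cardP)
  finally show ?thesis .
qed

lemma finite_fixed_sum_lists: "finite {js :: nat list. length js = l \<and> sum_list js = n}"
proof (rule finite_subset)
  show "{js. length js = l \<and> sum_list js = n} \<subseteq> {js. set js \<subseteq> {..n} \<and> length js = l}"
    using member_le_sum_list by fastforce
qed (rule finite_lists_length_eq, simp)

lemma sum_subsets_by_profile:
  fixes ns :: "nat list" and h :: "nat list \<Rightarrow> int"
  defines "V \<equiv> {(s, a). s < length ns \<and> a < ns ! s}"
  shows "(\<Sum>W | W \<subseteq> V \<and> card W = n. h (map (\<lambda>s. card {x \<in> W. fst x = s}) [0..<length ns])) =
    (\<Sum>js | length js = length ns \<and> sum_list js = n. (\<Prod>s<length ns. int ((ns ! s) choose (js ! s))) * h js)"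
proof -
  let ?\<W> = "{W. W \<subseteq> V \<and> card W = n}" and ?J = "{js :: nat list. length js = length ns \<and> sum_list js = n}"
  let ?p = "\<lambda>W :: (nat \<times> nat) set. map (\<lambda>s. card {x \<in> W. fst x = s}) [0..<length ns]"
  have "V = Sigma {..<length ns} (\<lambda>s. {..<ns ! s})" by (auto simp: V_def)
  then have V: "finite V" by simp
  have sum_p: "sum_list (?p W) = card W" if W: "W \<subseteq> V" for W
  proof -
    have fin: "finite W" using W V by (rule finite_subset)
    have "W = (\<Union>s\<in>{..<length ns}. {x \<in> W. fst x = s})" using W by (auto simp: V_def)
    then have "card W = card (\<Union>s\<in>{..<length ns}. {x \<in> W. fst x = s})" by simp
    also have "\<dots> = (\<Sum>s<length ns. card {x \<in> W. fst x = s})"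
      by (rule card_UN_disjoint) (use fin in auto)
    finally show ?thesis by (simp add: interv_sum_list_conv_sum_set_nat atLeast0LessThan)
  qed
  have fiber: "{W \<in> ?\<W>. ?p W = js} = {W. W \<subseteq> V \<and> (\<forall>s<length ns. card {x \<in> W. fst x = s} = js ! s)}"
    if js: "js \<in> ?J" for js
  proof -
    have "?p W = js \<longleftrightarrow> (\<forall>s<length ns. card {x \<in> W. fst x = s} = js ! s)" for W
      using js by (subst list_eq_iff_nth_eq) simp
    moreover have "card W = n" if "W \<subseteq> V" "?p W = js" for W 
      using sum_p[OF that(1)] js unfolding that(2) by simp
    ultimately show ?thesis by blast
  qed
  have "(\<Sum>W\<in>?\<W>. h (?p W)) = (\<Sum>js\<in>?J. \<Sum>W | W \<in> ?\<W> \<and> ?p W = js. h (?p W))"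
    by (rule sum.group[symmetric]) (use V sum_p finite_fixed_sum_lists in auto)
  also have "\<dots> = (\<Sum>js\<in>?J. (\<Prod>s<length ns. int ((ns ! s) choose (js ! s))) * h js)"
  proof (rule sum.cong[OF refl])
    fix js assume js: "js \<in> ?J"
    have "(\<Sum>W | W \<in> ?\<W> \<and> ?p W = js. h (?p W)) = (\<Sum>W | W \<in> ?\<W> \<and> ?p W = js. h js)"
      by (rule sum.cong) auto
    also have "\<dots> = int (card {W \<in> ?\<W>. ?p W = js}) * h js" by simp
    also have "card {W \<in> ?\<W>. ?p W = js} = (\<Prod>s<length ns. (ns ! s) choose (js ! s))"
      unfolding fiber[OF js] unfolding V_def by (rule card_subsets_with_profile) (use js in simp)
    finally show "(\<Sum>W | W \<in> ?\<W> \<and> ?p W = js. h (?p W))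
        = (\<Prod>s<length ns. int ((ns ! s) choose (js ! s))) * h js" by simp
  qed
  finally show ?thesis .
qed


section \<open>Graded Betti numbers\<close>

text \<open>Passes from \<open>fmod\<close>, with 0 beyond the rank, to the extensional families of
  \<open>free_mod\<close>, with \<open>undefined\<close> there.\<close>

definition ext_vec :: "nat \<Rightarrow> (nat \<Rightarrow> 'a) \<Rightarrow> nat \<Rightarrow> 'a" where
  "ext_vec n u = restrict u {..<n}"

lemma inj_on_ext_vec: "inj_on (ext_vec n) (fmod V n)"
proof (rule inj_onI)
  fix u v :: "nat \<Rightarrow> ('a, 'b) mpoly" assume uv: "u \<in> fmod V n" "v \<in> fmod V n" "ext_vec n u = ext_vec n v"
  show "u = v"
  proof
    fix k show "u k = v k"
      using uv(1,2) fun_cong[OF uv(3), of k] by (cases "k < n") (auto simp: fmod_def ext_vec_def)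
  qed
qed

lemma ext_vec_image: "ext_vec n ` fmod V n = free_mod (poly_ring V) n"
proof (intro equalityI subsetI)
  fix u :: "nat \<Rightarrow> ('a, 'b) mpoly" assume "u \<in> ext_vec n ` fmod V n"
  then show "u \<in> free_mod (poly_ring V) n" by (auto simp: free_mod_def ext_vec_def fmod_def split: if_splits)
next
  fix u :: "nat \<Rightarrow> ('a, 'b) mpoly" assume u: "u \<in> free_mod (poly_ring V) n"
  have "(\<lambda>k. if k < n then u k else 0) \<in> fmod V n"
    using u by (auto simp: fmod_def free_mod_def PR_zero)
  moreover have "u = ext_vec n (\<lambda>k. if k < n then u k else 0)"
  proof
    fix k show "u k = ext_vec n (\<lambda>k. if k < n then u k else 0) k"
      using PiE_arb[OF u[unfolded free_mod_def], of k] by (cases "k < n") (simp_all add: ext_vec_def)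
  qed
  ultimately show "u \<in> ext_vec n ` fmod V n" by blast
qed

section \<open>Ring operations, matrices and cosets in elementary terms\<close>

lemma finsum_poly_ring:
  assumes "finite S" "\<And>x. x \<in> S \<Longrightarrow> f x \<in> PR V"
  shows "finsum (poly_ring V) f S = (\<Sum>x\<in>S. f x :: ('v, 'k::field) mpoly)"
proof -
  interpret cring "poly_ring V :: ('v, 'k) mpoly ring" by (rule cring_poly_ring)
  show ?thesis
    using assms by (induction S rule: finite_induct) (auto simp: poly_ring_simps(3,5) finsum_insert)
qed

lemma finprod_poly_ring:
  assumes "finite S" "\<And>x. x \<in> S \<Longrightarrow> f x \<in> PR V"
  shows "finprod (poly_ring V) f S = (\<Prod>x\<in>S. f x :: ('v, 'k::field) mpoly)"
proof -
  interpret cring "poly_ring V :: ('v, 'k) mpoly ring" by (rule cring_poly_ring)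
  show ?thesis
    using assms by (induction S rule: finite_induct) (auto simp: poly_ring_simps(2,4) finprod_insert)
qed

lemma mat_map_ext_vec:
  assumes D: "linmap D" and \<phi>: "\<And>k l. k < m \<Longrightarrow> l < n \<Longrightarrow> \<phi> k l = D (unit_vec l) k \<and> \<phi> k l \<in> PR V"
    and u: "u \<in> fmod V n"
  shows "mat_map (poly_ring V) m n \<phi> (ext_vec n u) = ext_vec m (D u)"
  unfolding mat_map_def ext_vec_def[of m]
proof (rule restrict_ext)
  fix k assume k: "k \<in> {..<m}"
  have "finsum (poly_ring V) (\<lambda>l. \<phi> k l \<otimes>\<^bsub>poly_ring V\<^esub> ext_vec n u l) {..<n}
      = (\<Sum>l<n. \<phi> k l \<otimes>\<^bsub>poly_ring V\<^esub> ext_vec n u l)"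
    by (rule finsum_poly_ring) (use \<phi>[THEN conjunct2] k u in \<open>auto simp: poly_ring_simps(2) ext_vec_def fmod_def intro!: PR_mult\<close>)
  also have "\<dots> = D u k"
    using k \<phi>[THEN conjunct1] by (auto simp: linmap_expand[OF D u] poly_ring_simps(2) ext_vec_def intro!: sum.cong)
  finally show "finsum (poly_ring V) (\<lambda>l. \<phi> k l \<otimes>\<^bsub>poly_ring V\<^esub> ext_vec n u l) {..<n} = D u k" .
qed

lemma coset_poly_ring: "I +>\<^bsub>poly_ring V\<^esub> a = (\<lambda>h. h + a) ` I"
  by (auto simp: a_r_coset_def r_coset_def poly_ring_simps)

lemma coset_poly_ring_eq_iff:
  assumes I: "ideal I (poly_ring V)"
  shows "I +>\<^bsub>poly_ring V\<^esub> a = I +>\<^bsub>poly_ring V\<^esub> c \<longleftrightarrow> a - c \<in> I"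
proof
  note I_0 = ideal_poly_ringD(2)[OF I]
  assume "I +>\<^bsub>poly_ring V\<^esub> a = I +>\<^bsub>poly_ring V\<^esub> c"
  then have "0 + a \<in> (\<lambda>h. h + c) ` I" using I_0 unfolding coset_poly_ring by blast
  then show "a - c \<in> I" by auto
next
  assume ac: "a - c \<in> I"
  note I_add = ideal_poly_ringD(3)[OF I]
  have "- (a - c) \<in> I" using ideal_poly_ringD(4)[OF I PR_uminus[OF PR_one] ac] by simp
  then have ca: "c - a \<in> I" by simp
  have "h + a \<in> (\<lambda>h. h + c) ` I" if "h \<in> I" for h
    by (rule image_eqI[of _ _ "h + (a - c)"]) (use I_add[OF that ac] in simp_all)
  moreover have "h + c \<in> (\<lambda>h. h + a) ` I" if "h \<in> I" for h
    by (rule image_eqI[of _ _ "h + (c - a)"]) (use I_add[OF that ca] in simp_all)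
  ultimately show "I +>\<^bsub>poly_ring V\<^esub> a = I +>\<^bsub>poly_ring V\<^esub> c"
    unfolding coset_poly_ring by blast
qed

lemma augmentation_ext_vec:
  assumes g: "\<And>k. k < n \<Longrightarrow> g k \<in> PR V" and u: "u \<in> fmod V n"
  shows "augmentation (poly_ring V) I n g (ext_vec n u) = I +>\<^bsub>poly_ring V\<^esub> aug n g u"
proof -
  have "finsum (poly_ring V) (\<lambda>k. g k \<otimes>\<^bsub>poly_ring V\<^esub> ext_vec n u k) {..<n}
      = (\<Sum>k<n. g k \<otimes>\<^bsub>poly_ring V\<^esub> ext_vec n u k)"
    by (rule finsum_poly_ring) (use g u in \<open>auto simp: poly_ring_simps(2) ext_vec_def fmod_def intro!: PR_mult\<close>)
  also have "\<dots> = aug n g u" by (simp add: aug_def poly_ring_simps(2) ext_vec_def)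
  finally show ?thesis by (simp add: augmentation_def)
qed

lemma carrier_Quot_poly_ring: "carrier (poly_ring V Quot I) = (\<lambda>c. I +>\<^bsub>poly_ring V\<^esub> c) ` PR V"
  by (auto simp: FactRing_def A_RCOSETS_def RCOSETS_def a_r_coset_def)

lemma ext_vec_eq_free_zero:
  assumes "u \<in> fmod V n"
  shows "ext_vec n u = free_zero (poly_ring V) n \<longleftrightarrow> u = 0"
proof -
  have "free_zero (poly_ring V) n = ext_vec n (0 :: nat \<Rightarrow> ('a, 'b) mpoly)"
    by (auto simp: free_zero_def ext_vec_def poly_ring_simps fun_eq_iff)
  then show ?thesis using inj_on_eq_iff[OF inj_on_ext_vec assms fmod_zero] by simp
qed

lemma Collect_mem_image:
  assumes "\<And>x. x \<in> X \<Longrightarrow> P (f x) \<longleftrightarrow> Q x"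
  shows "{y \<in> f ` X. P y} = f ` {x \<in> X. Q x}"
  using assms by auto

text \<open>The dictionary between matrices acting on extensional families and linear maps acting
  on families that vanish outside of the index range.\<close>

lemma graded_minimal_free_resolution_iff:
  fixes I :: "('v, 'k::field) mpoly set"
  assumes I: "ideal I (poly_ring V)"
    and D: "\<And>i. linmap (D i)" "\<And>i u. u \<in> fmod V (b (Suc i)) \<Longrightarrow> D i u \<in> fmod V (b i)"
    and \<phi>: "\<And>i k l. k < b i \<Longrightarrow> l < b (Suc i) \<Longrightarrow> \<phi> i k l = D i (unit_vec l) k"
  shows "graded_minimal_free_resolution V I b e g \<phi> \<longleftrightarrow> resolution V I b e g D"
proof -
  have \<phi>_PR: "\<phi> i k l = D i (unit_vec l) k \<and> \<phi> i k l \<in> PR V" if "k < b i" "l < b (Suc i)" for i k l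
    using D(2)[OF fmod_unit_vec[OF that(2)]] \<phi>[OF that] by (simp add: fmod_def)
  have mat: "mat_map (poly_ring V) (b i) (b (Suc i)) (\<phi> i) (ext_vec (b (Suc i)) u) = ext_vec (b i) (D i u)"
    if "u \<in> fmod V (b (Suc i))" for i u
    by (rule mat_map_ext_vec[OF D(1) \<phi>_PR that])
  have homog: "(\<forall>k l. k < b i \<longrightarrow> l < b (Suc i) \<longrightarrow>
      \<phi> i k l \<in> PR V \<and> homogeneous (e (Suc i) l - e i k) (\<phi> i k l))
    \<longleftrightarrow> gmap V (b (Suc i)) (e (Suc i)) (b i) (e i) (D i)" for i
  proof
    assume h: "\<forall>k l. k < b i \<longrightarrow> l < b (Suc i) \<longrightarrow>
      \<phi> i k l \<in> PR V \<and> homogeneous (e (Suc i) l - e i k) (\<phi> i k l)"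
    let ?L = "lin_of (b (Suc i)) (\<lambda>l. D i (unit_vec l))"
    have L: "D i u = ?L u" if "u \<in> fmod V (b (Suc i))" for u
      by (rule gmap_eq_on_basis[OF D(1) linmap_lin_of _ that]) (simp add: lin_of_unit_vec)
    have "gmap V (b (Suc i)) (e (Suc i)) (b i) (e i) ?L"
    proof (rule gmap_lin_of)
      fix l assume l: "l < b (Suc i)"
      show Dl: "D i (unit_vec l) \<in> fmod V (b i)" by (rule D(2)[OF fmod_unit_vec[OF l]])
      show "homog_vec (e i) (e (Suc i) l) (D i (unit_vec l))"
        unfolding homog_vec_def
      proof
        fix k show "homogeneous (e (Suc i) l - e i k) (D i (unit_vec l) k)"
        proof (cases "k < b i")
          case True
          then have "homogeneous (e (Suc i) l - e i k) (\<phi> i k l)" using h l by blast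
          then show ?thesis by (simp only: \<phi>[OF True l])
        qed (use Dl in \<open>simp add: fmod_def\<close>)
      qed
    qed
    then show "gmap V (b (Suc i)) (e (Suc i)) (b i) (e i) (D i)"
      using D(1) by (simp add: gmap_def L)
  next
    assume G: "gmap V (b (Suc i)) (e (Suc i)) (b i) (e i) (D i)"
    then show "\<forall>k l. k < b i \<longrightarrow> l < b (Suc i) \<longrightarrow>
      \<phi> i k l \<in> PR V \<and> homogeneous (e (Suc i) l - e i k) (\<phi> i k l)"
      using \<phi>_PR gmap_unit_vec(2)[OF G] unfolding homog_vec_def by metis
  qed
  have im: "mat_map (poly_ring V) (b i) (b (Suc i)) (\<phi> i) ` free_mod (poly_ring V) (b (Suc i))
      = ext_vec (b i) ` (D i ` fmod V (b (Suc i)))" for i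
    unfolding ext_vec_image[symmetric] image_image using mat by (intro image_cong) auto
  have Z_Suc: "{u \<in> free_mod (poly_ring V) (b (Suc i)).
        mat_map (poly_ring V) (b i) (b (Suc i)) (\<phi> i) u = free_zero (poly_ring V) (b i)}
      = ext_vec (b (Suc i)) ` {u \<in> fmod V (b (Suc i)). D i u = 0}" for i
    unfolding ext_vec_image[symmetric]
    by (rule Collect_mem_image) (simp only: mat ext_vec_eq_free_zero[OF D(2)])
  \<comment> \<open>Both sides of each exactness condition are images under the injective
    \<open>ext_vec\<close>, which can be cancelled.\<close>
  have ex: "ext_vec (b i) ` X = ext_vec (b i) ` (D i ` fmod V (b (Suc i))) \<longleftrightarrow> X = D i ` fmod V (b (Suc i))"
    if "X \<subseteq> fmod V (b i)" for i X
    by (rule inj_on_image_eq_iff[OF inj_on_ext_vec that]) (use D(2) in auto)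
  have exact_Suc: "{u \<in> free_mod (poly_ring V) (b (Suc i)).
        mat_map (poly_ring V) (b i) (b (Suc i)) (\<phi> i) u = free_zero (poly_ring V) (b i)}
      = mat_map (poly_ring V) (b (Suc i)) (b (Suc (Suc i))) (\<phi> (Suc i)) ` free_mod (poly_ring V) (b (Suc (Suc i)))
    \<longleftrightarrow> {u \<in> fmod V (b (Suc i)). D i u = 0} = D (Suc i) ` fmod V (b (Suc (Suc i)))" for i
    unfolding Z_Suc im by (rule ex) auto
  have minimal: "(\<forall>u k. u \<in> free_mod (poly_ring V) (b (Suc i)) \<longrightarrow> k < b i \<longrightarrow>
      mat_map (poly_ring V) (b i) (b (Suc i)) (\<phi> i) u k \<in> irrelevant_ideal V)
    \<longleftrightarrow> (\<forall>u k. u \<in> fmod V (b (Suc i)) \<longrightarrow> coef (D i u k) 0 = 0)" for i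
  proof -
    have "mat_map (poly_ring V) (b i) (b (Suc i)) (\<phi> i) (ext_vec (b (Suc i)) u) k \<in> irrelevant_ideal V
        \<longleftrightarrow> coef (D i u k) 0 = 0" if "u \<in> fmod V (b (Suc i))" "k < b i" for u k
      unfolding mat[OF that(1)]
      using D(2)[OF that(1)] that(2) by (simp add: irrelevant_ideal_eq ext_vec_def fmod_def)
    \<comment> \<open>The locale speaks of rows below \<open>b i\<close> only; beyond them
      \<open>D i u\<close> vanishes.\<close>
    moreover have "coef (D i u k) 0 = 0" if "u \<in> fmod V (b (Suc i))" "\<not> k < b i" for u k
      using D(2)[OF that(1)] that(2) by (simp add: fmod_def)
    ultimately show ?thesis unfolding ext_vec_image[symmetric] by blast
  qed
  have augs: "(augmentation (poly_ring V) I (b 0) g ` free_mod (poly_ring V) (b 0) = carrier (poly_ring V Quot I)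
      \<longleftrightarrow> (\<forall>c\<in>PR V. \<exists>u\<in>fmod V (b 0). aug (b 0) g u - c \<in> I))
    \<and> ({u \<in> free_mod (poly_ring V) (b 0). augmentation (poly_ring V) I (b 0) g u = \<zero>\<^bsub>poly_ring V Quot I\<^esub>}
      = mat_map (poly_ring V) (b 0) (b (Suc 0)) (\<phi> 0) ` free_mod (poly_ring V) (b (Suc 0))
      \<longleftrightarrow> {u \<in> fmod V (b 0). aug (b 0) g u \<in> I} = D 0 ` fmod V (b (Suc 0)))"
    if g: "\<And>k. k < b 0 \<Longrightarrow> g k \<in> PR V"
  proof
    have A: "augmentation (poly_ring V) I (b 0) g (ext_vec (b 0) u) = I +>\<^bsub>poly_ring V\<^esub> aug (b 0) g u"
      if "u \<in> fmod V (b 0)" for u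
      by (rule augmentation_ext_vec[OF g that])
    have imA: "augmentation (poly_ring V) I (b 0) g ` free_mod (poly_ring V) (b 0)
        = (\<lambda>u. I +>\<^bsub>poly_ring V\<^esub> aug (b 0) g u) ` fmod V (b 0)"
      unfolding ext_vec_image[symmetric] image_image using A by (intro image_cong) auto
    have sub: "(\<lambda>u. I +>\<^bsub>poly_ring V\<^esub> aug (b 0) g u) ` fmod V (b 0) \<subseteq> (\<lambda>c. I +>\<^bsub>poly_ring V\<^esub> c) ` PR V"
      using aug_fmod_in_PR[OF g] by auto
    have "(\<lambda>c. I +>\<^bsub>poly_ring V\<^esub> c) ` PR V \<subseteq> (\<lambda>u. I +>\<^bsub>poly_ring V\<^esub> aug (b 0) g u) ` fmod V (b 0)
      \<longleftrightarrow> (\<forall>c\<in>PR V. \<exists>u\<in>fmod V (b 0). aug (b 0) g u - c \<in> I)"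
      by (auto simp: image_subset_iff image_iff coset_poly_ring_eq_iff[OF I, symmetric]) (metis+)
    then show "augmentation (poly_ring V) I (b 0) g ` free_mod (poly_ring V) (b 0) = carrier (poly_ring V Quot I)
      \<longleftrightarrow> (\<forall>c\<in>PR V. \<exists>u\<in>fmod V (b 0). aug (b 0) g u - c \<in> I)"
      unfolding imA carrier_Quot_poly_ring using sub by blast
    have zero: "\<zero>\<^bsub>poly_ring V Quot I\<^esub> = I +>\<^bsub>poly_ring V\<^esub> 0"
      by (simp add: FactRing_def coset_poly_ring)
    have "{u \<in> free_mod (poly_ring V) (b 0). augmentation (poly_ring V) I (b 0) g u = \<zero>\<^bsub>poly_ring V Quot I\<^esub>}
      = ext_vec (b 0) ` {u \<in> fmod V (b 0). aug (b 0) g u \<in> I}"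
      unfolding ext_vec_image[symmetric] zero
      by (rule Collect_mem_image) (simp only: A coset_poly_ring_eq_iff[OF I] diff_zero)
    then show "{u \<in> free_mod (poly_ring V) (b 0). augmentation (poly_ring V) I (b 0) g u = \<zero>\<^bsub>poly_ring V Quot I\<^esub>}
      = mat_map (poly_ring V) (b 0) (b (Suc 0)) (\<phi> 0) ` free_mod (poly_ring V) (b (Suc 0))
      \<longleftrightarrow> {u \<in> fmod V (b 0). aug (b 0) g u \<in> I} = D 0 ` fmod V (b (Suc 0))"
      unfolding im by (simp only:) (rule ex, auto)
  qed
  have cyc: "(\<forall>i. cycles V b D (\<lambda>u. aug (b 0) g u \<in> I) i = D i ` fmod V (b (Suc i)))
    \<longleftrightarrow> {u \<in> fmod V (b 0). aug (b 0) g u \<in> I} = D 0 ` fmod V (b (Suc 0))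
      \<and> (\<forall>i. {u \<in> fmod V (b (Suc i)). D i u = 0} = D (Suc i) ` fmod V (b (Suc (Suc i))))"
  proof -
    have "(\<forall>i. P i) \<longleftrightarrow> P 0 \<and> (\<forall>i. P (Suc i))" for P :: "nat \<Rightarrow> bool"
      by (metis not0_implies_Suc)
    from this[of "\<lambda>i. cycles V b D (\<lambda>u. aug (b 0) g u \<in> I) i = D i ` fmod V (b (Suc i))"]
    show ?thesis by (simp add: cycles_def)
  qed
  show ?thesis
  \<comment> \<open>The ring sum in \<open>augmentation\<close> becomes an ordinary sum once all
    \<open>g k\<close> are in the carrier; otherwise both sides fail by their condition on
    \<open>g\<close>.\<close>
  proof (cases "\<forall>k<b 0. g k \<in> PR V")
    case True
    have "(\<forall>i u k. u \<in> free_mod (poly_ring V) (b (Suc i)) \<longrightarrow> k < b i \<longrightarrow>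
        mat_map (poly_ring V) (b i) (b (Suc i)) (\<phi> i) u k \<in> irrelevant_ideal V)
      \<longleftrightarrow> (\<forall>u i k. u \<in> fmod V (b (Suc i)) \<longrightarrow> coef (D i u k) 0 = 0)"
      using minimal by blast
    moreover have "(\<forall>i k l. k < b i \<longrightarrow> l < b (Suc i) \<longrightarrow>
        \<phi> i k l \<in> PR V \<and> homogeneous (e (Suc i) l - e i k) (\<phi> i k l))
      \<longleftrightarrow> (\<forall>i. gmap V (b (Suc i)) (e (Suc i)) (b i) (e i) (D i))"
      using homog by blast
    ultimately show ?thesis
      using augs True
      unfolding graded_minimal_free_resolution_def resolution_def cyc exact_Suc Ball_def
      by (simp add: conj_ac)
  next
    case False
    then obtain k where k: "k < b 0" "g k \<notin> PR V" by blast
    have "\<not> graded_minimal_free_resolution V I b e g \<phi>"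
      using graded_minimal_free_resolution.aug_entries[of V I b e g \<phi>, OF _ k(1)] k(2) by metis
    moreover have "\<not> resolution V I b e g D"
      using resolution.g[of V I b e g D, OF _ k(1)] k(2) by metis
    ultimately show ?thesis by simp
  qed
qed

text \<open>The definite description needs a witness and uniqueness: the matrices of the
  differentials \<open>D\<close> give the first, \<open>resolution_card_degree_eq\<close> the
  second.\<close>

lemma graded_betti_eqI:
  fixes I :: "('v, 'k::field) mpoly set"
  assumes I: "ideal I (poly_ring V)" and hI: "\<And>p d. p \<in> I \<Longrightarrow> hcomp d p \<in> I"
    and F: "resolution V I b e g D"
  shows "graded_betti V I i j = card {k. k < b i \<and> e i k = j}"
  unfolding graded_betti_def
proof (rule the_equality)
  have D: "linmap (D i)" "u \<in> fmod V (b (Suc i)) \<Longrightarrow> D i u \<in> fmod V (b i)" for i u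
    using gmapD[OF resolution.D[OF F]] by blast+
  have "graded_minimal_free_resolution V I b e g (\<lambda>i k l. D i (unit_vec l) k)"
    by (rule graded_minimal_free_resolution_iff[where D = D, OF I, THEN iffD2, OF _ _ _ F])
      (simp_all add: D)
  then show "\<exists>b' e' g' \<phi>. graded_minimal_free_resolution V I b' e' g' \<phi> \<and>
      card {k. k < b i \<and> e i k = j} = card {k. k < b' i \<and> e' i k = j}"
    by blast
next
  fix n assume "\<exists>b e g \<phi>. graded_minimal_free_resolution V I b e g \<phi> \<and> n = card {k. k < b i \<and> e i k = j}"
  then obtain b' e' g' \<phi> where F': "graded_minimal_free_resolution V I b' e' g' \<phi>"
    and n: "n = card {k. k < b' i \<and> e' i k = j}" by blast
  \<comment> \<open>The locale does not constrain entries in rows from \<open>b' i\<close> on;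
    replacing them by 0 makes the values of \<open>D'\<close> vanish beyond the rank.\<close>
  define D' where "D' i = lin_of (b' (Suc i)) (\<lambda>l k. if k < b' i then \<phi> i k l else 0)" for i
  have \<phi>: "\<phi> i k l \<in> PR V" if "k < b' i" "l < b' (Suc i)" for i k l
    using graded_minimal_free_resolution.entries[OF F' that] by blast
  have "resolution V I b' e' g' D'"
  proof (rule graded_minimal_free_resolution_iff[where D = D', OF I, THEN iffD1, OF _ _ _ F'])
    show "linmap (D' i)" for i unfolding D'_def by (rule linmap_lin_of)
    show "D' i u \<in> fmod V (b' i)" if "u \<in> fmod V (b' (Suc i))" for i u
      using that \<phi> by (auto simp: D'_def lin_of_def fmod_def PR_zero intro!: PR_sum PR_mult)
    show "\<phi> i k l = D' i (unit_vec l) k" if "k < b' i" "l < b' (Suc i)" for i k l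
      using that by (simp add: D'_def lin_of_unit_vec)
  qed
  from resolution_card_degree_eq[OF I hI this F] show "n = card {k. k < b i \<and> e i k = j}"
    unfolding n .
qed

section \<open>Complete multipartite graphs\<close>

text \<open>Vertices of different parts are adjacent, and two in one part have a common neighbour
  once \<open>A\<close> meets another part. Conversely, a connected set with at least two vertices
  has an arc.\<close>

lemma connected_induce_complete_multipartite_iff:
  assumes A: "A \<subseteq> pverts (complete_multipartite ns)" and card: "card A \<ge> 2"
  shows "Digraph_Component.connected (induce_subgraph (with_proj (complete_multipartite ns)) A)
    \<longleftrightarrow> (\<exists>x\<in>A. \<exists>y\<in>A. fst x \<noteq> fst y)"
proof -
  let ?E = "{(x, y). x \<in> A \<and> y \<in> A \<and> fst x \<noteq> fst y}"
  let ?G = "induce_subgraph (with_proj (complete_multipartite ns)) A"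
  have arcs: "arcs ?G = ?E" using A by (auto simp: complete_multipartite_def)
  \<comment> \<open>The arc relation is already symmetric, so the symmetric closure in the
    definition of connectedness adds nothing.\<close>
  have "(\<Union>e\<in>?E. {(fst e, snd e), (snd e, fst e)}) = ?E"
  proof (intro equalityI subsetI)
    fix p assume "p \<in> (\<Union>e\<in>?E. {(fst e, snd e), (snd e, fst e)})"
    then show "p \<in> ?E" by (elim UN_E) auto
  next
    fix p assume "p \<in> ?E"
    then show "p \<in> (\<Union>e\<in>?E. {(fst e, snd e), (snd e, fst e)})" by (rule UN_I) simp
  qed
  then have "parcs (mk_symmetric ?G) = ?E"
    unfolding parcs_mk_symmetric arcs by simp
  then have "arcs_ends (with_proj (mk_symmetric ?G)) = ?E" by (simp add: arcs_ends_conv)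
  then have conn: "Digraph_Component.connected (induce_subgraph (with_proj (complete_multipartite ns)) A)
      \<longleftrightarrow> A \<noteq> {} \<and> (\<forall>u\<in>A. \<forall>v\<in>A. (u, v) \<in> rtrancl_on A ?E)"
    by (simp add: Digraph_Component.connected_def strongly_connected_def reachable_def)
  have arc: "(x, y) \<in> rtrancl_on A ?E" if "x \<in> A" "y \<in> A" "fst x \<noteq> fst y" for x y
    using that by (auto intro: rtrancl_on_into_rtrancl_on[OF rtrancl_on_refl])
  show ?thesis
  proof
    assume "Digraph_Component.connected (induce_subgraph (with_proj (complete_multipartite ns)) A)"
    then have all: "\<forall>u\<in>A. \<forall>v\<in>A. (u, v) \<in> rtrancl_on A ?E" using conn by blast
    obtain x y where xy: "x \<in> A" "y \<in> A" "x \<noteq> y"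
      using card by (metis card_le_Suc0_iff_eq card.infinite not_less_eq_eq numeral_2_eq_2 zero_le)
    then have "(x, y) \<in> rtrancl_on A ?E" using all by blast
    \<comment> \<open>As \<open>x\<close> and \<open>y\<close> differ, the walk is nontrivial, and
      its last arc joins two parts.\<close>
    then show "\<exists>x\<in>A. \<exists>y\<in>A. fst x \<noteq> fst y"
      by (cases rule: rtrancl_on.cases) (use xy(3) in auto)
  next
    assume "\<exists>x\<in>A. \<exists>y\<in>A. fst x \<noteq> fst y"
    then obtain x y where xy: "x \<in> A" "y \<in> A" "fst x \<noteq> fst y" by blast
    have "(u, v) \<in> rtrancl_on A ?E" if uv: "u \<in> A" "v \<in> A" for u v
    proof (cases "fst u = fst v")
      case False
      then show ?thesis using arc uv by blast
    next
      case True
      obtain w where w: "w \<in> A" "fst w \<noteq> fst u" using xy by metis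
      then show ?thesis using arc[OF uv(1) w(1)] uv w True
        by (auto intro: rtrancl_on_into_rtrancl_on)
    qed
    then show "Digraph_Component.connected (induce_subgraph (with_proj (complete_multipartite ns)) A)"
      using conn xy(1) by blast
  qed
qed

text \<open>With r >= 1 the generating sets have at least two vertices, so connectedness means
  meeting two parts; a single vertex would be connected without doing so.\<close>

lemma conn_ideal_complete_multipartite:
  fixes ns :: "nat list"
  assumes r: "r \<ge> 1"
  defines "V \<equiv> pverts (complete_multipartite ns)"
  shows "conn_ideal r (complete_multipartite ns) = (sqf_ideal V (spread_sets fst V r) :: (nat \<times> nat, 'k::field) mpoly set)"
proof -
  have "V = Sigma {..<length ns} (\<lambda>s. {..<ns ! s})" by (auto simp: V_def complete_multipartite_def)
  then have V: "finite V" by simp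
  have spread: "A \<in> spread_sets fst V r \<longleftrightarrow> A \<subseteq> V \<and> card A = r + 1 \<and>
      Digraph_Component.connected (induce_subgraph (with_proj (complete_multipartite ns)) A)" for A
  proof (cases "A \<subseteq> V \<and> card A = r + 1")
    case True
    then have "A \<subseteq> pverts (complete_multipartite ns)" "card A \<ge> 2" using r by (simp_all add: V_def)
    from connected_induce_complete_multipartite_iff[OF this] show ?thesis
      using True by (simp only: spread_sets_def mem_Collect_eq)
  next
    case False
    then show ?thesis unfolding spread_sets_def mem_Collect_eq by blast
  qed
  have prod: "finprod (poly_ring V) var A = (sqf A :: (nat \<times> nat, 'k) mpoly)" if "A \<subseteq> V" for A
    using that V by (subst finprod_poly_ring) (auto simp: sqf_eq_prod var_PR intro: finite_subset)
  have "{finprod (poly_ring V) var A | A. A \<subseteq> V \<and> card A = r + 1 \<and>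
      Digraph_Component.connected (induce_subgraph (with_proj (complete_multipartite ns)) A)}
    = finprod (poly_ring V) var ` spread_sets fst V r"
    unfolding spread[symmetric] by blast
  also have "\<dots> = (sqf ` spread_sets fst V r :: (nat \<times> nat, 'k) mpoly set)"
    by (rule image_cong[OF refl], rule prod) (simp add: spread_sets_def)
  finally have "{finprod (poly_ring V) var A | A. A \<subseteq> V \<and> card A = r + 1 \<and>
      Digraph_Component.connected (induce_subgraph (with_proj (complete_multipartite ns)) A)}
    = (sqf ` spread_sets fst V r :: (nat \<times> nat, 'k) mpoly set)" .
  then show ?thesis
    unfolding conn_ideal_def V_def[symmetric]
    by (simp only:) (rule sqf_ideal_eq_genideal[OF V], auto simp: spread_sets_def)
qed

theorem theorem4p4:
  fixes ns :: "nat list" and r i :: nat and d :: int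
  assumes "length ns \<ge> 2"
    and "\<forall>n\<in>set ns. n \<ge> 1"
    and "r \<ge> 1"
    and "i \<ge> 1"
  shows "int (graded_betti (pverts (complete_multipartite ns))
            (conn_ideal r (complete_multipartite ns) :: (nat \<times> nat, 'k::field) mpoly set)
            i (int i + d)) =
    (if d = int r then
       int ((sum_list ns choose (i + r)) * ((i + r - 1) choose r))
       - (\<Sum>js\<in>{js :: nat list. length js = length ns \<and> sum_list js = i + r}.
            (\<Prod>s<length ns. int ((ns ! s) choose (js ! s)))
            * (\<Sum>s<length ns. if js ! s = 0 then 0 else int ((js ! s - 1) choose r)))
     else 0)"
proof -
  define V where "V = {(s, a). s < length ns \<and> a < ns ! s}"
  have pverts: "pverts (complete_multipartite ns) = V" by (simp add: complete_multipartite_def V_def)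
  have VS: "V = Sigma {..<length ns} (\<lambda>s. {..<ns ! s})" by (auto simp: V_def)
  then have V: "finite V" by simp
  have "card V = (\<Sum>s<length ns. ns ! s)" unfolding VS by (subst card_SigmaI) auto
  then have cardV: "card V = sum_list ns" by (simp add: sum_list_sum_nth atLeast0LessThan)
  let ?I = "sqf_ideal V (spread_sets fst V r) :: (nat \<times> nat, 'k) mpoly set"
  let ?\<beta> = "\<lambda>j. \<Sum>B\<in>spread_sets fst V r. card (colon_vars fst V B) choose j"
  obtain j where i: "i = Suc j" using assms(4) by (cases i) auto
  obtain D where "linear_resolution V (int (r + 1)) ?I (case_nat 1 ?\<beta>) D"
    using spread_sets_linear_resolution[OF V assms(3)] by blast
  then have "resolution V ?I (case_nat 1 ?\<beta>) (\<lambda>i _. lin_shift (int (r + 1)) i) (\<lambda>_. 1) D"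
    by (rule linear_resolution_imp_resolution) (simp_all add: ideal_sqf_ideal)
  from graded_betti_eqI[OF ideal_sqf_ideal hcomp_sqf_ideal this]
  \<comment> \<open>All generators in homological degree \<open>i\<close> have degree
    \<open>lin_shift (r + 1) i = i + r\<close>, which is \<open>i + d\<close> only for
    \<open>d = r\<close>. Their number comes from choosing \<open>j = i - 1\<close> colon
    variables.\<close>
  have betti: "graded_betti V ?I i (int i + d) = (if d = int r then ?\<beta> j else 0)"
    by (simp add: i lin_shift_def)
  define h :: "nat list \<Rightarrow> int" where "h js = (\<Sum>s<length ns. int ((js ! s - 1) choose r))" for js
  have S: "fst ` V \<subseteq> {..<length ns}" by (auto simp: V_def)
  have idx: "r + 1 + j = i + r" "r + j = i + r - 1" by (simp_all add: i)
  have "int (?\<beta> j) = (\<Sum>W | W \<subseteq> V \<and> card W = i + r. int ((i + r - 1) choose r)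
      - (\<Sum>s<length ns. int ((card {x \<in> W. fst x = s} - 1) choose r)))"
    using sum_colon_vars_choose[OF V assms(3) finite_lessThan S, of j] unfolding idx .
  also have "\<dots> = (\<Sum>W | W \<subseteq> V \<and> card W = i + r. int ((i + r - 1) choose r)
      - h (map (\<lambda>s. card {x \<in> W. fst x = s}) [0..<length ns]))"
    by (simp add: h_def)
  \<comment> \<open>The first term is the same for all \<open>W\<close>; the second depends only on
    how many vertices \<open>W\<close> has in each part.\<close>
  also have "\<dots> = int (card {W. W \<subseteq> V \<and> card W = i + r} * ((i + r - 1) choose r))
      - (\<Sum>js | length js = length ns \<and> sum_list js = i + r.
          (\<Prod>s<length ns. int ((ns ! s) choose (js ! s))) * h js)"
    by (simp add: sum_subtractf V_def sum_subsets_by_profile)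
  also have "card {W. W \<subseteq> V \<and> card W = i + r} = sum_list ns choose (i + r)"
    by (simp add: n_subsets[OF V] cardV)
  finally have \<beta>: "int (?\<beta> j) = int ((sum_list ns choose (i + r)) * ((i + r - 1) choose r))
      - (\<Sum>js | length js = length ns \<and> sum_list js = i + r.
          (\<Prod>s<length ns. int ((ns ! s) choose (js ! s))) * h js)" .
  \<comment> \<open>The value 0 at \<open>js ! s = 0\<close> is the convention for upper entry -1;
    \<open>h\<close> yields it since truncated \<open>0 - 1\<close> is 0 and
    \<open>0 choose r = 0\<close> for r >= 1.\<close>
  have "h js = (\<Sum>s<length ns. if js ! s = 0 then 0 else int ((js ! s - 1) choose r))" for js
    unfolding h_def using assms(3) by (intro sum.cong) auto
  then show ?thesis
    unfolding conn_ideal_complete_multipartite[OF assms(3)] pverts betti using \<beta> by simp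
qed

end
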